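(* For any $\epsilon>0$, the Subset FVS in Split Graphs problem parameterized by the solution size $k$ does not admit a polynomial kernel of size $\mathcal{O}(k^{2-\epsilon})$ bits, unless $\mathsf{NP}\subseteq\mathsf{coNP}/\mathsf{poly}$.
   Context: A split graph is a graph whose vertex set can be partitioned into a clique and an independent set. For a set $T$ of vertices, a $T$-cycle is a cycle containing a vertex of $T$. Subset FVS in Split Graphs: given a split graph $G$, a set $T\subseteq V(G)$ and an integer $k$ (the parameter), decide whether there is $S\subseteq V(G)$ with $|S|\leq k$ such that $G-S$ has no $T$-cycle. A kernel is a polynomial-time algorithm that maps an instance $(I;k)$ to an equivalent instance $(I';k')$ of the same problem with $k'$ bounded by a computable function of $k$; its size is the size of the output instance. *)

theory Defs
  imports Complex_Main "HOL-Computational_Algebra.Polynomial" "HOL-Library.Landau_Symbols"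
begin

section \<open>Turing machines\<close>

text \<open>
  Deterministic multi-tape machines over the tape alphabet 0, 1, blank (blank is \<open>None\<close>). Tapes are
  two-way infinite; the scanned cell always has index 0, so moving the head shifts the tape.
  The initial state is 0, and a machine halts when its transition function is undefined.
\<close>

type_synonym tape = "int \<Rightarrow> bool option"

datatype direction = Leftwards | Stay | Rightwards

record tm =
  num_tapes :: nat
  num_states :: nat
  delta :: "nat \<Rightarrow> bool option list \<Rightarrow> (nat \<times> (bool option \<times> direction) list) option"

definition wf_tm :: "tm \<Rightarrow> bool" where
  "wf_tm M \<longleftrightarrow> num_tapes M > 0 \<and> num_states M > 0 \<and>
     (\<forall>q ss q' as. q < num_states M \<and> length ss = num_tapes M \<and> delta M q ss = Some (q', as)
        \<longrightarrow> q' < num_states M \<and> length as = num_tapes M)"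

fun move_head :: "direction \<Rightarrow> tape \<Rightarrow> tape" where
  "move_head Leftwards t = (\<lambda>i. t (i - 1))"
| "move_head Stay t = t"
| "move_head Rightwards t = (\<lambda>i. t (i + 1))"

definition act :: "bool option \<times> direction \<Rightarrow> tape \<Rightarrow> tape" where
  "act a t = move_head (snd a) (t(0 := fst a))"

type_synonym config = "nat \<times> tape list"

definition next_action :: "tm \<Rightarrow> config \<Rightarrow> (nat \<times> (bool option \<times> direction) list) option" where
  "next_action M c = delta M (fst c) (map (\<lambda>t. t 0) (snd c))"

definition halted :: "tm \<Rightarrow> config \<Rightarrow> bool" where
  "halted M c \<longleftrightarrow> next_action M c = None"

definition tm_step :: "tm \<Rightarrow> config \<Rightarrow> config" where
  "tm_step M c = (case next_action M c of
      None \<Rightarrow> c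
    | Some (q', as) \<Rightarrow> (q', map2 act as (snd c)))"

definition blank_tape :: tape where
  "blank_tape = (\<lambda>i. None)"

definition input_tape :: "bool list \<Rightarrow> tape" where
  "input_tape x = (\<lambda>i. if 0 \<le> i \<and> i < int (length x) then Some (x ! nat i) else None)"

definition init_config :: "tm \<Rightarrow> bool list \<Rightarrow> config" where
  "init_config M x = (0, input_tape x # replicate (num_tapes M - 1) blank_tape)"

definition tape_reads :: "tape \<Rightarrow> bool list \<Rightarrow> bool" where
  "tape_reads t y \<longleftrightarrow>
     (\<forall>i < length y. t (int i) = Some (y ! i)) \<and> t (int (length y)) = None"

text \<open>
  The output is the word on the first tape from the head up to the next blank. Halted
  configurations are fixed by \<open>tm_step\<close>, so this says that \<open>M\<close> halts within \<open>n\<close> steps.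
\<close>

definition computes_within :: "tm \<Rightarrow> bool list \<Rightarrow> nat \<Rightarrow> bool list \<Rightarrow> bool" where
  "computes_within M x n y \<longleftrightarrow>
     (let c = (tm_step M ^^ n) (init_config M x) in halted M c \<and> tape_reads (hd (snd c)) y)"

section \<open>Complexity classes\<close>

type_synonym language = "bool list set"

definition self_delim :: "bool list \<Rightarrow> bool list" where
  "self_delim x = concat (map (\<lambda>b. [True, b]) x) @ [False]"

definition pair_enc :: "bool list \<Rightarrow> bool list \<Rightarrow> bool list" where
  "pair_enc x y = self_delim x @ y"

definition class_P :: "language set" where
  "class_P = {L. \<exists>M (p :: nat poly). wf_tm M \<and>
     (\<forall>x. computes_within M x (poly p (length x)) [x \<in> L])}"

definition class_NP :: "language set" where
  "class_NP = {L. \<exists>V \<in> class_P. \<exists>q :: nat poly.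
     \<forall>x. x \<in> L \<longleftrightarrow> (\<exists>w. length w \<le> poly q (length x) \<and> pair_enc x w \<in> V)}"

definition class_coNP :: "language set" where
  "class_coNP = {L. - L \<in> class_NP}"

definition with_poly_advice :: "language set \<Rightarrow> language set" where
  "with_poly_advice C = {L. \<exists>L' \<in> C. \<exists>(a :: nat \<Rightarrow> bool list) (q :: nat poly).
     (\<forall>n. length (a n) \<le> poly q n) \<and> (\<forall>x. x \<in> L \<longleftrightarrow> pair_enc x (a (length x)) \<in> L')}"

definition class_coNP_poly :: "language set" where
  "class_coNP_poly = with_poly_advice class_coNP"

text \<open>Binary representation, least significant bit first; 0 is the empty word.\<close>

fun bin :: "nat \<Rightarrow> bool list" where
  "bin n = (if n = 0 then [] else odd n # bin (n div 2))"

declare bin.simps [simp del]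

definition computable_nat :: "(nat \<Rightarrow> nat) \<Rightarrow> bool" where
  "computable_nat g \<longleftrightarrow> (\<exists>M. wf_tm M \<and> (\<forall>k. \<exists>n. computes_within M (bin k) n (bin (g k))))"

section \<open>Kernels\<close>

record 'i param_problem =
  instances :: "'i set"
  yes_instances :: "'i set"
  param :: "'i \<Rightarrow> nat"
  enc :: "'i \<Rightarrow> bool list"

definition poly_time_map :: "'i param_problem \<Rightarrow> ('i \<Rightarrow> 'i) \<Rightarrow> bool" where
  "poly_time_map P K \<longleftrightarrow> (\<exists>M (p :: nat poly). wf_tm M \<and>
     (\<forall>i \<in> instances P. computes_within M (enc P i) (poly p (length (enc P i))) (enc P (K i))))"

definition is_kernel :: "'i param_problem \<Rightarrow> ('i \<Rightarrow> 'i) \<Rightarrow> bool" where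
  "is_kernel P K \<longleftrightarrow>
     poly_time_map P K \<and>
     (\<forall>i \<in> instances P. K i \<in> instances P \<and> (K i \<in> yes_instances P \<longleftrightarrow> i \<in> yes_instances P)) \<and>
     (\<exists>g. computable_nat g \<and> (\<forall>i \<in> instances P. param P (K i) \<le> g (param P i)))"

definition admits_kernel_of_size :: "'i param_problem \<Rightarrow> (nat \<Rightarrow> nat) \<Rightarrow> bool" where
  "admits_kernel_of_size P h \<longleftrightarrow>
     (\<exists>K. is_kernel P K \<and> (\<forall>i \<in> instances P. length (enc P (K i)) \<le> h (param P i)))"

section \<open>Subset feedback vertex set in split graphs\<close>

definition simple_graph :: "'a set \<Rightarrow> 'a set set \<Rightarrow> bool" where
  "simple_graph V E \<longleftrightarrow> finite V \<and> (\<forall>e \<in> E. e \<subseteq> V \<and> card e = 2)"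

definition clique :: "'a set set \<Rightarrow> 'a set \<Rightarrow> bool" where
  "clique E C \<longleftrightarrow> (\<forall>u \<in> C. \<forall>v \<in> C. u \<noteq> v \<longrightarrow> {u, v} \<in> E)"

definition independent :: "'a set set \<Rightarrow> 'a set \<Rightarrow> bool" where
  "independent E I \<longleftrightarrow> (\<forall>u \<in> I. \<forall>v \<in> I. {u, v} \<notin> E)"

definition split_graph :: "'a set \<Rightarrow> 'a set set \<Rightarrow> bool" where
  "split_graph V E \<longleftrightarrow> simple_graph V E \<and>
     (\<exists>C I. C \<union> I = V \<and> C \<inter> I = {} \<and> clique E C \<and> independent E I)"

definition is_cycle :: "'a set \<Rightarrow> 'a set set \<Rightarrow> 'a list \<Rightarrow> bool" where
  "is_cycle V E c \<longleftrightarrow> length c \<ge> 3 \<and> distinct c \<and> set c \<subseteq> V \<and>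
     (\<forall>i < length c. {c ! i, c ! (Suc i mod length c)} \<in> E)"

definition has_T_cycle :: "'a set \<Rightarrow> 'a set set \<Rightarrow> 'a set \<Rightarrow> bool" where
  "has_T_cycle V E T \<longleftrightarrow> (\<exists>c. is_cycle V E c \<and> set c \<inter> T \<noteq> {})"

definition subset_fvs :: "'a set \<Rightarrow> 'a set set \<Rightarrow> 'a set \<Rightarrow> 'a set \<Rightarrow> bool" where
  "subset_fvs V E T S \<longleftrightarrow> S \<subseteq> V \<and> \<not> has_T_cycle (V - S) {e \<in> E. e \<inter> S = {}} T"

text \<open>An instance has vertex set \<open>{0..<n}\<close>, where \<open>n\<close> is \<open>num_vertices\<close>.\<close>

record sfvs_instance =
  num_vertices :: nat
  edges :: "nat set set"
  terminals :: "nat set"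
  budget :: nat

abbreviation vertices :: "sfvs_instance \<Rightarrow> nat set" where
  "vertices i \<equiv> {0..<num_vertices i}"

text \<open>
  An instance is written as the budget in binary, one bit per vertex telling whether it is a
  terminal (which also fixes the number of vertices), and the list of edges, each given by its two
  end vertices in binary. Thus sparse graphs have short encodings, unlike with adjacency matrices.
\<close>

definition edge_list :: "sfvs_instance \<Rightarrow> (nat \<times> nat) list" where
  "edge_list i = filter (\<lambda>(u, v). u < v \<and> {u, v} \<in> edges i)
     (List.product [0..<num_vertices i] [0..<num_vertices i])"

definition enc_sfvs :: "sfvs_instance \<Rightarrow> bool list" where
  "enc_sfvs i =
     self_delim (bin (budget i)) @
     self_delim (map (\<lambda>v. v \<in> terminals i) [0..<num_vertices i]) @
     concat (map (\<lambda>(u, v). self_delim (bin u) @ self_delim (bin v)) (edge_list i))"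

definition sfvs_split_instances :: "sfvs_instance set" where
  "sfvs_split_instances = {i. split_graph (vertices i) (edges i) \<and> terminals i \<subseteq> vertices i}"

definition subset_fvs_split :: "sfvs_instance param_problem" where
  "subset_fvs_split = \<lparr>
     instances = sfvs_split_instances,
     yes_instances = {i \<in> sfvs_split_instances.
       \<exists>S. subset_fvs (vertices i) (edges i) (terminals i) S \<and> card S \<le> budget i},
     param = budget,
     enc = enc_sfvs\<rparr>"

end

theory Submission
  imports Defs
begin

text \<open>
  Suppose that a kernel of size \<open>O(k\<^bsup>2-\<epsilon>\<^esup>)\<close> exists and let \<open>L\<close> be in NP. By Cook's tableau, membership
  of words of length \<open>n\<close> in \<open>L\<close> is the satisfiability of a CNF of size polynomial in \<open>n\<close> with the
  word plugged in. Since NP/poly is nonuniform, it is enough to find such formulas for the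
  complement of \<open>L\<close> as well: formulas are advice, and one fixed machine checks assignments.

  Following Dell and van Melkebeek, pack \<open>t = s\<^sup>2\<close> words into one Vertex Cover instance on only
  \<open>s \<cdot> poly(n)\<close> vertices that is positive iff some word is in \<open>L\<close>. Vertex Cover on \<open>N\<close> vertices is
  Subset FVS in a fixed split graph: a clique on the \<open>N\<close> vertices and, for every pair of them, an
  independent vertex adjacent to both, which is a terminal iff the pair is an edge. So only the
  terminal bits of the encoding depend on the words, and each on at most one bit of them.

  For \<open>s\<close> a large enough polynomial in \<open>n\<close>, the kernel maps a \<open>t\<close>-tuple of words to fewer than \<open>t\<close>
  bits. As in Fortnow and Santhanam, some image \<open>y\<close> of tuples of nonmembers has preimages that
  together contain half of the nonmembers of length \<open>n\<close>; iterating, \<open>n + 1\<close> images suffice for all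
  of them. Then \<open>x\<close> is a nonmember iff some tuple containing \<open>x\<close> is mapped to one of these images,
  and the tableau of the kernel's machine turns this into a CNF.
\<close>

section \<open>Polynomial bounds\<close>

text \<open>The exponent 2 is an information count. The packed graph has \<open>s * poly n\<close>
  clique vertices, which also bounds its budget, and its pairs of a row copy and a column copy carry
  \<open>s * s\<close> independent inputs. A kernel leaves about
  \<open>(s * poly n) powr (2 - \<epsilon>)\<close> bits, which is less than \<open>s * s\<close> as
  soon as \<open>s powr \<epsilon>\<close> exceeds a fixed power of the formula size; so
  \<open>s\<close> can be polynomial, with an exponent of order \<open>1 / \<epsilon>\<close>.

  Complementation is the obstacle: sets given by formulas with auxiliary variables are closed under
  unions and projections, but not visibly under complement. The kernel helps because it preserves
  the answer without revealing it: an output known to come from a tuple of nonmembers clears every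
  tuple with the same output.

  Formulas may be chosen for each length without any computability, so the packing is never run by a
  machine. Only the kernel's machine is unrolled, and the packing enters as a description of its
  input tape. As a tableau constraint may look at boundedly many bits only, each input cell has to
  depend on the words in a very simple way.\<close>

definition poly_bounded :: "(nat \<Rightarrow> nat) \<Rightarrow> bool" where
  "poly_bounded f \<longleftrightarrow> (\<exists>p :: nat poly. \<forall>n. f n \<le> poly p n)"

lemma poly_nat_mono: "a \<le> b \<Longrightarrow> poly (p :: nat poly) a \<le> poly p b"
  by (induction p) (auto intro: add_mono mult_mono)

lemma poly_bounded_const [intro]: "poly_bounded (\<lambda>n. c)"
  unfolding poly_bounded_def by (rule exI[of _ "[:c:]"]) simp

lemma poly_bounded_id [intro]: "poly_bounded (\<lambda>n. n)"
  unfolding poly_bounded_def by (rule exI[of _ "[:0, 1:]"]) simp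

lemma poly_bounded_add [intro]:
  assumes "poly_bounded f" "poly_bounded g"
  shows "poly_bounded (\<lambda>n. f n + g n)"
proof -
  obtain p q where "\<forall>n. f n \<le> poly p n" "\<forall>n. g n \<le> poly q n"
    using assms unfolding poly_bounded_def by blast
  then have "\<forall>n. f n + g n \<le> poly (p + q) n" by (simp add: add_mono)
  then show ?thesis unfolding poly_bounded_def by blast
qed

lemma poly_bounded_mult [intro]:
  assumes "poly_bounded f" "poly_bounded g"
  shows "poly_bounded (\<lambda>n. f n * g n)"
proof -
  obtain p q where "\<forall>n. f n \<le> poly p n" "\<forall>n. g n \<le> poly q n"
    using assms unfolding poly_bounded_def by blast
  then have "\<forall>n. f n * g n \<le> poly (p * q) n" by (simp add: mult_mono)
  then show ?thesis unfolding poly_bounded_def by blast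
qed

lemma poly_bounded_power [intro]: "poly_bounded f \<Longrightarrow> poly_bounded (\<lambda>n. f n ^ d)"
  by (induction d) auto

lemma poly_bounded_Suc [intro]: "poly_bounded f \<Longrightarrow> poly_bounded (\<lambda>n. Suc (f n))"
  using poly_bounded_add[of f "\<lambda>_. 1"] by auto

lemma poly_bounded_poly [intro]:
  assumes "poly_bounded f"
  shows "poly_bounded (\<lambda>n. poly p (f n))"
proof -
  obtain q where q: "\<forall>n. f n \<le> poly q n"
    using assms unfolding poly_bounded_def by blast
  have "\<forall>n. poly p (f n) \<le> poly (pcompose p q) n"
    using q by (simp add: poly_pcompose poly_nat_mono)
  then show ?thesis unfolding poly_bounded_def by blast
qed

section \<open>Nonuniform formulas\<close>

type_synonym 'v clause = "('v \<times> bool) set"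

definition satisfies :: "('v \<Rightarrow> bool) \<Rightarrow> 'v clause set \<Rightarrow> bool" where
  "satisfies \<sigma> F \<longleftrightarrow> (\<forall>c \<in> F. \<exists>(v, b) \<in> c. \<sigma> v = b)"

text \<open>
  The empty formula is excluded because its code below would not determine the number of variables.
\<close>

definition cnf_definable :: "nat \<Rightarrow> nat \<Rightarrow> bool list set \<Rightarrow> bool" where
  "cnf_definable n B A \<longleftrightarrow> n \<le> B \<and> (\<exists>cs :: nat clause list.
     cs \<noteq> [] \<and> length cs \<le> B \<and> (\<forall>c \<in> set cs. fst ` c \<subseteq> {..<B}) \<and>
     A = {x. length x = n \<and> (\<exists>\<sigma>. (\<forall>i < n. \<sigma> i = x ! i) \<and> satisfies \<sigma> (set cs))})"

definition small_cnfs :: "language \<Rightarrow> bool" where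
  "small_cnfs L \<longleftrightarrow> (\<exists>f. poly_bounded f \<and> (\<forall>n. cnf_definable n (f n) {x \<in> L. length x = n}))"

section \<open>A machine evaluating formulas\<close>

definition lookup :: "bool option list \<Rightarrow> nat \<Rightarrow> bool option" where
  "lookup xs k = (if k < length xs then xs ! k else None)"

text \<open>\<open>r\<close> begins at the scanned cell and \<open>l\<close> lists the cells to its
  left, nearest first. Both continue with blanks, so a tape has many representations, which differ
  by trailing \<open>None\<close> entries.\<close>

definition zip_tape :: "bool option list \<Rightarrow> bool option list \<Rightarrow> tape" where
  "zip_tape l r i = (if i \<ge> 0 then lookup r (nat i) else lookup l (nat (- i - 1)))"

definition scanned :: "bool option list \<Rightarrow> bool option" where
  "scanned r = (case r of [] \<Rightarrow> None | a # _ \<Rightarrow> a)"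

lemma scanned_simps [simp]: "scanned [] = None" "scanned (a # r) = a"
  by (simp_all add: scanned_def)

lemma lookup_simps [simp]:
  "lookup [] k = None" "lookup (a # r) 0 = a" "lookup (a # r) (Suc k) = lookup r k"
  "lookup r 0 = scanned r" "lookup (tl r) k = lookup r (Suc k)"
  by (cases r; auto simp: lookup_def)+

lemma zip_tape_0 [simp]: "zip_tape l r 0 = scanned r"
  by (simp add: zip_tape_def)

lemma act_zip_tape [simp]:
  "act (a, Stay) (zip_tape l r) = zip_tape l (a # tl r)"
  "act (a, Rightwards) (zip_tape l r) = zip_tape (a # l) (tl r)"
  "act (a, Leftwards) (zip_tape l r) = zip_tape (tl l) (scanned l # a # tl r)"
proof -
  show "act (a, Stay) (zip_tape l r) = zip_tape l (a # tl r)"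
  proof
    fix i :: int
    show "act (a, Stay) (zip_tape l r) i = zip_tape l (a # tl r) i"
      by (cases "nat i") (auto simp: act_def zip_tape_def simp flip: nat_0_iff)
  qed
  show "act (a, Rightwards) (zip_tape l r) = zip_tape (a # l) (tl r)"
  proof
    fix i :: int
    consider "i \<ge> 0" | "i = -1" | "i < -1" by linarith
    then show "act (a, Rightwards) (zip_tape l r) i = zip_tape (a # l) (tl r) i"
    proof cases
      case 1
      then have "nat (i + 1) = Suc (nat i)" by simp
      with 1 show ?thesis by (simp add: act_def zip_tape_def)
    next
      case 3
      then have "nat (- i - 1) = Suc (nat (- (i + 1) - 1))" by simp
      with 3 show ?thesis by (simp add: act_def zip_tape_def)
    qed (simp add: act_def zip_tape_def)
  qed
  show "act (a, Leftwards) (zip_tape l r) = zip_tape (tl l) (scanned l # a # tl r)"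
  proof
    fix i :: int
    consider "i \<ge> 2" | "i = 1" | "i = 0" | "i < 0" by linarith
    then show "act (a, Leftwards) (zip_tape l r) i = zip_tape (tl l) (scanned l # a # tl r) i"
    proof cases
      case 1
      then have "nat i = Suc (Suc (nat (i - 2)))" "nat (i - 1) = Suc (nat (i - 2))" by simp_all
      with 1 show ?thesis by (simp add: act_def zip_tape_def)
    next
      case 4
      then have "nat (- (i - 1) - 1) = Suc (nat (- i - 1))" by simp
      with 4 show ?thesis by (simp add: act_def zip_tape_def)
    qed (simp_all add: act_def zip_tape_def)
  qed
qed

lemma lookup_snoc_None [simp]: "lookup (r @ [None]) = lookup r"
  by (auto simp: lookup_def fun_eq_iff nth_append)

lemma zip_tape_snoc_None [simp]:
  "zip_tape (l @ [None]) r = zip_tape l r" "zip_tape l (r @ [None]) = zip_tape l r"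
  by (auto simp: zip_tape_def fun_eq_iff)

lemma zip_tape_None [simp]:
  "zip_tape [None] r = zip_tape [] r" "zip_tape l [None] = zip_tape l []"
  using zip_tape_snoc_None(1)[of "[]" r] zip_tape_snoc_None(2)[of l "[]"] by simp_all

lemma input_tape_eq: "input_tape x = zip_tape [] (map Some x)"
  by (auto simp: input_tape_def zip_tape_def lookup_def fun_eq_iff)

lemma blank_tape_eq: "blank_tape = zip_tape [] []"
  by (auto simp: blank_tape_def zip_tape_def fun_eq_iff)

text \<open>
  The input is \<open>pair_enc (pair_enc x \<psi>) w\<close>. States 0 to 3 copy \<open>x\<close> to tape 1, states 4 and 5 copy \<open>\<psi>\<close>
  to tape 2, state 6 appends \<open>w\<close> to tape 1, and states 7 and 8 rewind tapes 2 and 1. For each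
  variable, \<open>\<psi>\<close> has a marker and one bit for each of its two literals, which are read in states
  9/10, 11/12 and 13/14; the second state of each pair records that the clause is already
  satisfied. States 16 and 17 are entered after blanking the scanned cell of tape 0 and moving
  left, so that the verdict is followed by a blank even when the input is malformed.
\<close>

definition sat_delta ::
    "nat \<Rightarrow> bool option list \<Rightarrow> (nat \<times> (bool option \<times> direction) list) option" where
  "sat_delta q ss = (let a = ss ! 0; b = ss ! 1; c = ss ! 2;
      reject = Some (16, [(None, Leftwards), (b, Stay), (c, Stay)]);
      accept = Some (17, [(None, Leftwards), (b, Stay), (c, Stay)]);
      advance = (\<lambda>q'. Some (q', [(a, Rightwards), (b, Stay), (c, Stay)]))
    in
      if q = 0 then (if a = Some True then advance 1 else reject)
      else if q = 1 then (if a = Some True then advance 2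
        else if a = Some False then advance 4 else reject)
      else if q = 2 then (if a = Some True then advance 3 else reject)
      else if q = 3 then (if a = None then reject
        else Some (0, [(a, Rightwards), (a, Rightwards), (c, Stay)]))
      else if q = 4 then (if a = Some True then advance 5
        else if a = Some False then advance 6 else reject)
      else if q = 5 then (if a = None then reject
        else Some (4, [(a, Rightwards), (b, Stay), (a, Rightwards)]))
      else if q = 6 then (if a = None then Some (7, [(a, Stay), (b, Leftwards), (c, Leftwards)])
        else Some (6, [(a, Rightwards), (a, Rightwards), (c, Stay)]))
      else if q = 7 then (if c = None then Some (8, [(a, Stay), (b, Stay), (c, Rightwards)])
        else Some (7, [(a, Stay), (b, Stay), (c, Leftwards)]))
      else if q = 8 then (if b = None then Some (9, [(a, Stay), (b, Rightwards), (c, Stay)])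
        else Some (8, [(a, Stay), (b, Leftwards), (c, Stay)]))
      else if q = 9 \<or> q = 10 then (if c = None then accept
        else if c = Some True \<and> b \<noteq> None then
          Some (q + 2, [(a, Stay), (b, Stay), (c, Rightwards)])
        else if c = Some False \<and> b = None \<and> q = 10 then
          Some (8, [(a, Stay), (b, Leftwards), (c, Rightwards)])
        else reject)
      else if q = 11 \<or> q = 12 then (if c = None then reject
        else Some (if q = 12 \<or> (c = Some True \<and> b = Some True) then 14 else 13,
          [(a, Stay), (b, Stay), (c, Rightwards)]))
      else if q = 13 \<or> q = 14 then (if c = None then reject
        else Some (if q = 14 \<or> (c = Some True \<and> b = Some False) then 10 else 9,
          [(a, Stay), (b, Rightwards), (c, Rightwards)]))
      else if q = 16 \<or> q = 17 then Some (15, [(Some (q = 17), Stay), (b, Stay), (c, Stay)])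
      else None)"

definition sat_tm :: tm where
  "sat_tm = \<lparr>num_tapes = 3, num_states = 18, delta = sat_delta\<rparr>"

lemma sat_delta_simps [simp]:
  defines "reject \<equiv> \<lambda>b c. Some (16, [(None, Leftwards), (b, Stay), (c, Stay)])"
    and "accept \<equiv> \<lambda>b c. Some (17, [(None, Leftwards), (b, Stay), (c, Stay)])"
    and "advance \<equiv> \<lambda>q' a b c. Some (q', [(a, Rightwards), (b, Stay), (c, Stay)])"
  shows
    "sat_delta 0 [a, b, c] = (if a = Some True then advance 1 a b c else reject b c)"
    "sat_delta 1 [a, b, c] = (if a = Some True then advance 2 a b c
        else if a = Some False then advance 4 a b c else reject b c)"
    "sat_delta (Suc 0) [a, b, c] = (if a = Some True then advance 2 a b c
        else if a = Some False then advance 4 a b c else reject b c)"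
    "sat_delta 2 [a, b, c] = (if a = Some True then advance 3 a b c else reject b c)"
    "sat_delta 3 [a, b, c] = (if a = None then reject b c
        else Some (0, [(a, Rightwards), (a, Rightwards), (c, Stay)]))"
    "sat_delta 4 [a, b, c] = (if a = Some True then advance 5 a b c
        else if a = Some False then advance 6 a b c else reject b c)"
    "sat_delta 5 [a, b, c] = (if a = None then reject b c
        else Some (4, [(a, Rightwards), (b, Stay), (a, Rightwards)]))"
    "sat_delta 6 [a, b, c] =
       (if a = None then Some (7, [(a, Stay), (b, Leftwards), (c, Leftwards)])
        else Some (6, [(a, Rightwards), (a, Rightwards), (c, Stay)]))"
    "sat_delta 7 [a, b, c] =
       (if c = None then Some (8, [(a, Stay), (b, Stay), (c, Rightwards)])
        else Some (7, [(a, Stay), (b, Stay), (c, Leftwards)]))"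
    "sat_delta 8 [a, b, c] =
       (if b = None then Some (9, [(a, Stay), (b, Rightwards), (c, Stay)])
        else Some (8, [(a, Stay), (b, Leftwards), (c, Stay)]))"
    "sat_delta 9 [a, b, c] = (if c = None then accept b c
        else if c = Some True \<and> b \<noteq> None then
          Some (11, [(a, Stay), (b, Stay), (c, Rightwards)])
        else reject b c)"
    "sat_delta 10 [a, b, c] = (if c = None then accept b c
        else if c = Some True \<and> b \<noteq> None then
          Some (12, [(a, Stay), (b, Stay), (c, Rightwards)])
        else if c = Some False \<and> b = None then
          Some (8, [(a, Stay), (b, Leftwards), (c, Rightwards)])
        else reject b c)"
    "sat_delta 11 [a, b, c] = (if c = None then reject b c
        else Some (if c = Some True \<and> b = Some True then 14 else 13,
          [(a, Stay), (b, Stay), (c, Rightwards)]))"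
    "sat_delta 12 [a, b, c] = (if c = None then reject b c
        else Some (14, [(a, Stay), (b, Stay), (c, Rightwards)]))"
    "sat_delta 13 [a, b, c] = (if c = None then reject b c
        else Some (if c = Some True \<and> b = Some False then 10 else 9,
          [(a, Stay), (b, Rightwards), (c, Rightwards)]))"
    "sat_delta 14 [a, b, c] = (if c = None then reject b c
        else Some (10, [(a, Stay), (b, Rightwards), (c, Rightwards)]))"
    "sat_delta 15 [a, b, c] = None"
    "sat_delta 16 [a, b, c] = Some (15, [(Some False, Stay), (b, Stay), (c, Stay)])"
    "sat_delta 17 [a, b, c] = Some (15, [(Some True, Stay), (b, Stay), (c, Stay)])"
  unfolding reject_def accept_def advance_def by (simp_all add: sat_delta_def)

lemma wf_sat_tm: "wf_tm sat_tm"
proof -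
  have "q' < 18 \<and> length as = 3"
    if H: "q < 18" "length ss = 3" "sat_delta q ss = Some (q', as)" for q q' ss as
  proof -
    obtain a b c where ss: "ss = [a, b, c]"
      using H(2) by (auto simp: numeral_3_eq_3 length_Suc_conv)
    have "q \<in> {0, 1, 2, 3, 4, 5, 6, 7, 8, 9, 10, 11, 12, 13, 14, 15, 16, 17}"
      using H(1) by (auto simp: numeral_eq_Suc less_Suc_eq)
    then show ?thesis
      using H(3) unfolding ss by (elim insertE emptyE; simp split: if_split_asm; force)
  qed
  then show ?thesis unfolding wf_tm_def sat_tm_def by simp blast
qed

text \<open>A version of \<open>computes_within\<close> for an arbitrary starting configuration and
  a one-bit output. Runs are analysed backwards with it: a bound for the later configuration yields
  one for its predecessor.\<close>

definition halts_with :: "config \<Rightarrow> nat \<Rightarrow> bool \<Rightarrow> bool" where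
  "halts_with c n v \<longleftrightarrow> (let c' = (tm_step sat_tm ^^ n) c in
     halted sat_tm c' \<and> tape_reads (hd (snd c')) [v])"

lemma sat_tm_step:
  "tm_step sat_tm (q, [t0, t1, t2]) = (case sat_delta q [t0 0, t1 0, t2 0] of
      None \<Rightarrow> (q, [t0, t1, t2]) | Some (q', as) \<Rightarrow> (q', map2 act as [t0, t1, t2]))"
  by (auto simp: tm_step_def next_action_def sat_tm_def split: option.split)

lemma halted_fixed: "halted M c \<Longrightarrow> (tm_step M ^^ n) c = c"
  by (induction n) (auto simp: halted_def tm_step_def)

lemma halts_with_mono: "halts_with c n v \<Longrightarrow> n \<le> m \<Longrightarrow> halts_with c m v"
proof -
  assume *: "halts_with c n v" "n \<le> m"
  have "(tm_step sat_tm ^^ m) c = (tm_step sat_tm ^^ (m - n)) ((tm_step sat_tm ^^ n) c)"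
    using *(2) by (metis funpow_add le_add_diff_inverse2 o_apply)
  then show ?thesis
    using * by (simp add: halts_with_def Let_def halted_fixed)
qed

lemma act_Stay_same [simp]: "act (t 0, Stay) t = t"
  by (simp add: act_def)

lemma act_Stay_apply [simp]: "act (a, Stay) t 0 = a" "act (a, Stay) t 1 = t 1"
  by (simp_all add: act_def)

lemma zip_tape_1 [simp]: "zip_tape l r 1 = scanned (tl r)"
  by (cases r) (auto simp: zip_tape_def lookup_def scanned_def split: list.split)

lemma act_erase [simp]: "act (None, Leftwards) t 1 = None"
  by (simp add: act_def)

lemma zip_tape_scanned [simp]: "zip_tape l (scanned r # tl r) = zip_tape l r"
  by (cases r) auto

lemma halts_with_Suc: "halts_with c (Suc n) v \<longleftrightarrow> halts_with (tm_step sat_tm c) n v"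
  by (simp add: halts_with_def funpow_Suc_right del: funpow.simps(2))

lemma halts_with_final: "halts_with (15, [t0, t1, t2]) n v \<longleftrightarrow> t0 0 = Some v \<and> t0 1 = None"
proof -
  have "halted sat_tm (15, [t0, t1, t2])"
    by (simp add: halted_def next_action_def sat_tm_def)
  then show ?thesis by (simp add: halts_with_def halted_fixed tape_reads_def)
qed

lemma halts_with_verdict:
  assumes "t0 1 = None"
  shows "halts_with (16, [t0, t1, t2]) (Suc 0) False" "halts_with (17, [t0, t1, t2]) (Suc 0) True"
  using assms by (simp_all add: halts_with_Suc halts_with_final sat_tm_step)

lemma halts_with_stepI:
  assumes "tm_step sat_tm c = c'" "halts_with c' n v"
  shows "halts_with c (Suc n) v"
  using assms by (simp add: halts_with_Suc)

lemma halts_with_reject: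
  assumes "tm_step sat_tm c = (16, [act (None, Leftwards) t0, t1, t2])" "2 \<le> n"
  shows "halts_with c n False"
  by (rule halts_with_mono[OF halts_with_stepI[OF assms(1) halts_with_verdict(1)]])
    (use assms(2) in auto)

lemma halts_with_accept:
  assumes "tm_step sat_tm c = (17, [act (None, Leftwards) t0, t1, t2])" "2 \<le> n"
  shows "halts_with c n True"
  by (rule halts_with_mono[OF halts_with_stepI[OF assms(1) halts_with_verdict(2)]])
    (use assms(2) in auto)

text \<open>The behaviour of states 9 to 14 on the unread assignment \<open>r\<close> and the unread
  formula; \<open>f\<close> tells the two states of each pair apart. Running out of formula accepts
  even in the middle of a clause, which does no harm since formulas come from the advice and end
  every clause properly.\<close>

fun check_clauses :: "bool list \<Rightarrow> bool \<Rightarrow> bool list \<Rightarrow> bool list \<Rightarrow> bool" where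
  "check_clauses \<sigma> f r [] = True"
| "check_clauses \<sigma> f (s # r) (True # p # g # \<psi>) =
     check_clauses \<sigma> (f \<or> p \<and> s \<or> g \<and> \<not> s) r \<psi>"
| "check_clauses \<sigma> f [] (False # \<psi>) = (f \<and> check_clauses \<sigma> False \<sigma> \<psi>)"
| "check_clauses \<sigma> f r \<psi> = False"

text \<open>The tape in the conclusion is \<open>zip_tape (map Some l) (map Some r)\<close> after
  one move to the left. For \<open>l = []\<close> the head scans the blank in front of the word,
  which ends the loop.\<close>

lemma halts_with_rewind_assignment:
  assumes "halts_with (9, [t0, zip_tape [] (map Some (rev l @ r)), t2]) n v"
  shows "halts_with (8, [t0, zip_tape (map Some (tl l)) (scanned (map Some l) # map Some r), t2])
    (Suc (length l) + n) v"
  using assms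
proof (induction l arbitrary: r)
  case Nil
  then show ?case
    by (auto intro!: halts_with_stepI simp: sat_tm_step)
next
  case (Cons a l)
  have "Suc (length (a # l)) + n = Suc (Suc (length l) + n)" by simp
  then show ?case
    using Cons.IH[of "a # r"] Cons.prems
    by (simp only:) (rule halts_with_stepI[OF sat_tm_step], simp add: map_tl)
qed

lemma halts_with_rewind_formula:
  assumes "halts_with (8, [t0, t1, zip_tape [] (map Some (rev l @ r))]) n v"
  shows "halts_with (7, [t0, t1, zip_tape (map Some (tl l)) (scanned (map Some l) # map Some r)])
    (Suc (length l) + n) v"
  using assms
proof (induction l arbitrary: r)
  case Nil
  then show ?case
    by (auto intro!: halts_with_stepI simp: sat_tm_step)
next
  case (Cons a l)
  have "Suc (length (a # l)) + n = Suc (Suc (length l) + n)" by simp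
  then show ?case
    using Cons.IH[of "a # r"] Cons.prems
    by (simp only:) (rule halts_with_stepI[OF sat_tm_step], simp add: map_tl)
qed

text \<open>Each formula symbol is charged \<open>length \<sigma> + 4\<close> steps: a separator may
  cause a rewind over the whole assignment, any other symbol takes one step. The slack also pays for
  the at most five steps after which malformed input gets its verdict.\<close>

lemma halts_with_check_clauses:
  assumes "\<sigma> = rev l @ r"
  shows "halts_with
    (if f then 10 else 9, [t0, zip_tape (map Some l) (map Some r), zip_tape l2 (map Some \<psi>)])
    (length \<psi> * (length \<sigma> + 4) + 2) (check_clauses \<sigma> f r \<psi>)"
  using assms
proof (induction \<sigma> f r \<psi> arbitrary: l l2 rule: check_clauses.induct)
  case (1 \<sigma> f r)
  show ?case
    by (auto intro!: halts_with_accept simp: sat_tm_step)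
next
  case (2 \<sigma> f s r p g \<psi>)
  let ?f = "f \<or> p \<and> s \<or> g \<and> \<not> s"
  let ?n = "length \<psi> * (length \<sigma> + 4) + 2"
  have "halts_with (if ?f then 10 else 9, [t0, zip_tape (map Some (s # l)) (map Some r),
      zip_tape (Some g # Some p # Some True # l2) (map Some \<psi>)]) ?n
      (check_clauses \<sigma> ?f r \<psi>)"
    by (rule 2(1)) (simp add: 2(2))
  then have "halts_with (if f \<or> p \<and> s then 14 else 13,
      [t0, zip_tape (map Some l) (map Some (s # r)),
       zip_tape (Some p # Some True # l2) (map Some (g # \<psi>))])
      (Suc ?n) (check_clauses \<sigma> ?f r \<psi>)"
    by (cases "f \<or> p \<and> s"; cases s; cases g)
      (rule halts_with_stepI, rule sat_tm_step, simp)+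
  then have "halts_with (if f then 12 else 11,
      [t0, zip_tape (map Some l) (map Some (s # r)),
       zip_tape (Some True # l2) (map Some (p # g # \<psi>))])
      (Suc (Suc ?n)) (check_clauses \<sigma> ?f r \<psi>)"
    by (cases f; cases p; cases s) (rule halts_with_stepI, rule sat_tm_step, simp)+
  then have "halts_with (if f then 10 else 9,
      [t0, zip_tape (map Some l) (map Some (s # r)),
       zip_tape l2 (map Some (True # p # g # \<psi>))])
      (Suc (Suc (Suc ?n))) (check_clauses \<sigma> ?f r \<psi>)"
    by (cases f) (rule halts_with_stepI, rule sat_tm_step, simp)+
  then show ?case
    unfolding check_clauses.simps by (rule halts_with_mono) (simp add: algebra_simps)
next
  case (3 \<sigma> f \<psi>)
  show ?case
  proof (cases f)
    case True
    have "halts_with (9, [t0, zip_tape [] (map Some (rev l @ [])), zip_tape (Some False # l2) (map Some \<psi>)])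
        (length \<psi> * (length \<sigma> + 4) + 2) (check_clauses \<sigma> False \<sigma> \<psi>)"
      using 3(1)[of "[]"] 3(2) by simp
    from halts_with_rewind_assignment[OF this]
    have "halts_with (if f then 10 else 9,
      [t0, zip_tape (map Some l) (map Some []), zip_tape l2 (map Some (False # \<psi>))])
      (Suc (Suc (length l) + (length \<psi> * (length \<sigma> + 4) + 2))) (check_clauses \<sigma> False \<sigma> \<psi>)"
      using True zip_tape_snoc_None(2)[of "tl (map Some l)" "[scanned (map Some l)]"]
      by (intro halts_with_stepI[OF sat_tm_step]) (simp add: map_tl)
    then show ?thesis
      using True unfolding check_clauses.simps by simp (rule halts_with_mono, assumption, use 3(2) in simp)
  next
    case False
    then show ?thesis
      by (auto intro!: halts_with_reject simp: sat_tm_step)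
  qed
next
  case ("4_1" \<sigma> f va)
  show ?case
    by (cases f; rule halts_with_mono[where n = "Suc (Suc (Suc (Suc (Suc 0))))"],
     simp_all add: halts_with_Suc halts_with_final sat_tm_step)
next
  case ("4_2" \<sigma> f v vb va)
  show ?case
    by (cases f; rule halts_with_mono[where n = "Suc (Suc (Suc (Suc (Suc 0))))"],
     simp_all add: halts_with_Suc halts_with_final sat_tm_step)
next
  case ("4_3" \<sigma> f va vb v)
  show ?case
    by (cases f; cases v; rule halts_with_mono[where n = "Suc (Suc (Suc (Suc (Suc 0))))"],
     simp_all add: halts_with_Suc halts_with_final sat_tm_step)
next
  case ("4_4" \<sigma> f r)
  show ?case
    by (cases f; cases r; rule halts_with_mono[where n = "Suc (Suc (Suc (Suc (Suc 0))))"],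
     simp_all add: halts_with_Suc halts_with_final sat_tm_step)
next
  case ("4_5" \<sigma> f va vc v vb)
  show ?case
    by (cases f; cases v; rule halts_with_mono[where n = "Suc (Suc (Suc (Suc (Suc 0))))"],
     simp_all add: halts_with_Suc halts_with_final sat_tm_step)
next
  case ("4_6" \<sigma> f r vb)
  show ?case
    by (cases f; cases r; rule halts_with_mono[where n = "Suc (Suc (Suc (Suc (Suc 0))))"],
     simp_all add: halts_with_Suc halts_with_final sat_tm_step)
qed

fun parse_formula :: "bool list \<Rightarrow> bool list \<Rightarrow> bool list \<Rightarrow> bool" where
  "parse_formula xs ps (True # b # z) = parse_formula xs (b # ps) z"
| "parse_formula xs ps (False # z) = check_clauses (rev xs @ z) False (rev xs @ z) (rev ps)"
| "parse_formula xs ps z = False"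

text \<open>In \<open>pair_enc (pair_enc x \<psi>) w\<close> the word \<open>x\<close> is delimited
  twice: a bit \<open>b\<close> of it appears as three \<open>True\<close> followed by
  \<open>b\<close>, and its terminator as \<open>True\<close>, \<open>False\<close>. The
  accumulators are reversed because they are the left halves of the work tapes.\<close>

fun parse_input :: "bool list \<Rightarrow> bool list \<Rightarrow> bool" where
  "parse_input xs (True # True # True # b # z) = parse_input (b # xs) z"
| "parse_input xs (True # False # z) = parse_formula xs [] z"
| "parse_input xs z = False"

lemma zip_tape_None2 [simp]: "zip_tape l [a, None] = zip_tape l [a]"
  using zip_tape_snoc_None(2)[of l "[a]"] by simp

text \<open>\<open>C\<close> pays for all that follows the copying, namely the two rewinds and the
  check on words of length at most \<open>L\<close>; copying costs one step per symbol.\<close>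

lemma halts_with_copy_witness:
  assumes "length xs + length ps + length w \<le> L" and C: "L * (L + 4) + 2 * L + 5 \<le> C"
  shows "halts_with (6, [zip_tape l0 (map Some w), zip_tape (map Some xs) [], zip_tape (map Some ps) []])
    (length w + C) (check_clauses (rev xs @ w) False (rev xs @ w) (rev ps))"
  using assms(1)
proof (induction w arbitrary: l0 xs)
  case Nil
  let ?v = "check_clauses (rev xs) False (rev xs) (rev ps)"
  let ?n = "length ps * (length xs + 4) + 2"
  let ?t0 = "zip_tape l0 []"
  have "halts_with (9, [?t0, zip_tape [] (map Some (rev xs @ [])), zip_tape [] (map Some (rev ps @ []))]) ?n ?v"
    using halts_with_check_clauses[of "rev xs" "[]" "rev xs" False ?t0 "[]" "rev ps"] by simp
  then have "halts_with (7, [?t0, zip_tape (map Some (tl xs)) (scanned (map Some xs) # map Some []),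
      zip_tape (map Some (tl ps)) (scanned (map Some ps) # map Some [])])
      (Suc (length ps) + (Suc (length xs) + ?n)) ?v"
    by (intro halts_with_rewind_formula halts_with_rewind_assignment)
  then have "halts_with (6, [?t0, zip_tape (map Some xs) [], zip_tape (map Some ps) []])
      (Suc (Suc (length ps) + (Suc (length xs) + ?n))) ?v"
    by (intro halts_with_stepI[OF sat_tm_step]) (simp add: map_tl)
  moreover have "length ps * (length xs + 4) \<le> L * (L + 4)"
    using Nil by (intro mult_mono) auto
  ultimately show ?case
    using Nil C by simp (rule halts_with_mono, assumption, simp)
next
  case (Cons b w)
  from Cons.IH[of "b # xs" "Some b # l0"] Cons.prems show ?case
    by simp (rule halts_with_stepI[OF sat_tm_step], simp)
qed

lemma halts_with_parse_formula:
  assumes "length xs + length ps + length z \<le> L" and C: "L * (L + 4) + 2 * L + 5 \<le> C"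
    and C5: "Suc (Suc (Suc (Suc (Suc 0)))) \<le> C"
  shows "halts_with (4, [zip_tape l0 (map Some z), zip_tape (map Some xs) [], zip_tape (map Some ps) []])
    (length z + C) (parse_formula xs ps z)"
  using assms(1)
proof (induction xs ps z arbitrary: l0 rule: parse_formula.induct)
  case (1 xs ps b z)
  have "halts_with (4, [zip_tape (Some b # Some True # l0) (map Some z), zip_tape (map Some xs) [],
      zip_tape (map Some (b # ps)) []]) (length z + C) (parse_formula xs (b # ps) z)"
    using 1 by simp
  then have "halts_with (5, [zip_tape (Some True # l0) (map Some (b # z)), zip_tape (map Some xs) [],
      zip_tape (map Some ps) []]) (Suc (length z + C)) (parse_formula xs (b # ps) z)"
    by (intro halts_with_stepI[OF sat_tm_step]) simp
  then show ?case
    by simp (rule halts_with_stepI[OF sat_tm_step], simp)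
next
  case (2 xs ps z)
  with halts_with_copy_witness[OF _ C, of xs ps z "Some False # l0"] show ?case
    by simp (rule halts_with_stepI[OF sat_tm_step], simp)
next
  case ("3_1" xs ps)
  show ?case
    by (rule halts_with_mono[OF _ trans_le_add2[OF C5]])
      (simp_all add: halts_with_Suc halts_with_final sat_tm_step)
next
  case ("3_2" xs ps)
  show ?case
    by (rule halts_with_mono[OF _ trans_le_add2[OF C5]])
      (simp_all add: halts_with_Suc halts_with_final sat_tm_step)
qed

lemma halts_with_parse_input:
  assumes "length xs + length z \<le> L" and C: "L * (L + 4) + 2 * L + 5 \<le> C"
    and C5: "Suc (Suc (Suc (Suc (Suc 0)))) \<le> C"
  shows "halts_with (0, [zip_tape l0 (map Some z), zip_tape (map Some xs) [], zip_tape [] []])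
    (length z + C) (parse_input xs z)"
  using assms(1)
proof (induction xs z arbitrary: l0 rule: parse_input.induct)
  case (1 xs b z)
  have "halts_with (0, [zip_tape (Some b # Some True # Some True # Some True # l0) (map Some z),
      zip_tape (map Some (b # xs)) [], zip_tape [] []]) (length z + C) (parse_input (b # xs) z)"
    using 1 by simp
  then have "halts_with (3, [zip_tape (Some True # Some True # Some True # l0) (map Some (b # z)),
      zip_tape (map Some xs) [], zip_tape [] []]) (Suc (length z + C)) (parse_input (b # xs) z)"
    by (intro halts_with_stepI[OF sat_tm_step]) simp
  then have "halts_with (2, [zip_tape (Some True # Some True # l0) (map Some (True # b # z)),
      zip_tape (map Some xs) [], zip_tape [] []]) (Suc (Suc (length z + C))) (parse_input (b # xs) z)"
    by (intro halts_with_stepI[OF sat_tm_step]) simp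
  then have "halts_with (1, [zip_tape (Some True # l0) (map Some (True # True # b # z)),
      zip_tape (map Some xs) [], zip_tape [] []]) (Suc (Suc (Suc (length z + C)))) (parse_input (b # xs) z)"
    by (intro halts_with_stepI[OF sat_tm_step]) simp
  then show ?case
    by simp (rule halts_with_stepI[OF sat_tm_step], simp)
next
  case (2 xs z)
  then have "halts_with (4, [zip_tape (Some False # Some True # l0) (map Some z),
      zip_tape (map Some xs) [], zip_tape (map Some []) []]) (length z + C) (parse_formula xs [] z)"
    by (intro halts_with_parse_formula[OF _ C C5]) simp
  then have "halts_with (1, [zip_tape (Some True # l0) (map Some (False # z)),
      zip_tape (map Some xs) [], zip_tape [] []]) (Suc (length z + C)) (parse_formula xs [] z)"
    by (intro halts_with_stepI[OF sat_tm_step]) simp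
  then show ?case
    by simp (rule halts_with_stepI[OF sat_tm_step], simp)
next
  case ("3_1" xs)
  show ?case
    by (rule halts_with_mono[OF _ trans_le_add2[OF C5]])
      (simp_all add: halts_with_Suc halts_with_final sat_tm_step)
next
  case ("3_2" xs va)
  show ?case
    by (rule halts_with_mono[OF _ trans_le_add2[OF C5]])
      (simp_all add: halts_with_Suc halts_with_final sat_tm_step)
next
  case ("3_3" xs v)
  show ?case
    by (cases v; rule halts_with_mono[OF _ trans_le_add2[OF C5]])
      (simp_all add: halts_with_Suc halts_with_final sat_tm_step)
next
  case ("3_4" xs vc)
  show ?case
    by (rule halts_with_mono[OF _ trans_le_add2[OF C5]])
      (simp_all add: halts_with_Suc halts_with_final sat_tm_step)
next
  case ("3_5" xs vb)
  show ?case
    by (rule halts_with_mono[OF _ trans_le_add2[OF C5]])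
      (simp_all add: halts_with_Suc halts_with_final sat_tm_step)
next
  case ("3_6" xs v)
  show ?case
    by (cases v; rule halts_with_mono[OF _ trans_le_add2[OF C5]])
      (simp_all add: halts_with_Suc halts_with_final sat_tm_step)
next
  case ("3_7" xs vb ve)
  show ?case
    by (rule halts_with_mono[OF _ trans_le_add2[OF C5]])
      (simp_all add: halts_with_Suc halts_with_final sat_tm_step)
next
  case ("3_8" xs v ve)
  show ?case
    by (cases v; rule halts_with_mono[OF _ trans_le_add2[OF C5]])
      (simp_all add: halts_with_Suc halts_with_final sat_tm_step)
next
  case ("3_9" xs vb vd)
  show ?case
    by (rule halts_with_mono[OF _ trans_le_add2[OF C5]])
      (simp_all add: halts_with_Suc halts_with_final sat_tm_step)
next
  case ("3_10" xs v vd)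
  show ?case
    by (cases v; rule halts_with_mono[OF _ trans_le_add2[OF C5]])
      (simp_all add: halts_with_Suc halts_with_final sat_tm_step)
qed

lemma sat_language_in_P: "{z. parse_input [] z} \<in> class_P"
proof -
  \<comment> \<open>The polynomial is \<open>n * (n + 4) + 2 * n + 5\<close> from the analysis
    above, plus \<open>n\<close> for reading the input.\<close>
  define p :: "nat poly" where "p = [:5, 7, 1:]"
  have "computes_within sat_tm z (poly p (length z)) [z \<in> {z. parse_input [] z}]" for z
  proof -
    have "init_config sat_tm z = (0, [zip_tape [] (map Some z), zip_tape (map Some []) [], zip_tape [] []])"
      by (simp add: init_config_def sat_tm_def input_tape_eq blank_tape_eq numeral_2_eq_2)
    then have "halts_with (init_config sat_tm z)
        (length z + (length z * (length z + 4) + 2 * length z + 5)) (parse_input [] z)"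
      using halts_with_parse_input[of "[]" z "length z" "length z * (length z + 4) + 2 * length z + 5" "[]"]
      by (simp only:) simp
    also have "length z + (length z * (length z + 4) + 2 * length z + 5) = poly p (length z)"
      by (simp add: p_def algebra_simps)
    finally show ?thesis
      by (simp add: halts_with_def computes_within_def Let_def)
  qed
  then show ?thesis
    unfolding class_P_def using wf_sat_tm by blast
qed

section \<open>Codes of formulas as advice\<close>

definition clause_code :: "nat list \<Rightarrow> nat clause \<Rightarrow> bool list" where
  "clause_code vs c = concat (map (\<lambda>v. [True, (v, True) \<in> c, (v, False) \<in> c]) vs) @ [False]"

text \<open>Markers are consumed together with assignment bits, and the separator demands that none
  be left. So one clause already forces the assignment to have one bit per variable, although the
  machine is told neither number.\<close>

lemma check_clauses_clause_code:
  "check_clauses \<sigma> f r (clause_code vs c @ \<psi>) \<longleftrightarrow>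
     length r = length vs \<and> (f \<or> (\<exists>p \<in> set (zip vs r). p \<in> c)) \<and> check_clauses \<sigma> False \<sigma> \<psi>"
proof (induction vs arbitrary: f r)
  case Nil
  show ?case by (cases r) (auto simp: clause_code_def)
next
  case (Cons v vs)
  show ?case
  proof (cases r)
    case Nil
    then show ?thesis by (simp add: clause_code_def)
  next
    case (Cons s r')
    show ?thesis
      using Cons.IH[of "f \<or> (v, True) \<in> c \<and> s \<or> (v, False) \<in> c \<and> \<not> s" r']
      unfolding Cons by (cases s) (auto simp: clause_code_def)
  qed
qed

lemma check_clauses_cnf:
  assumes "cs \<noteq> []"
  shows "check_clauses \<sigma> False \<sigma> (concat (map (clause_code [0..<B]) cs)) \<longleftrightarrow>
    length \<sigma> = B \<and> (\<forall>c \<in> set cs. \<exists>(v, b) \<in> c. v < B \<and> \<sigma> ! v = b)"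
proof -
  have zip: "(\<exists>p \<in> set (zip [0..<B] \<sigma>). p \<in> c) \<longleftrightarrow> (\<exists>(v, b) \<in> c. v < B \<and> \<sigma> ! v = b)"
    if "length \<sigma> = B" for c
  proof -
    have "p \<in> set (zip [0..<B] \<sigma>) \<longleftrightarrow> fst p < B \<and> \<sigma> ! fst p = snd p" for p
      using that by (auto simp: in_set_zip intro: exI[of _ "fst p"])
    then show ?thesis unfolding case_prod_unfold by blast
  qed
  have "check_clauses \<sigma> False \<sigma> (concat (map (clause_code [0..<B]) cs)) \<longleftrightarrow>
    cs = [] \<or> length \<sigma> = B \<and> (\<forall>c \<in> set cs. \<exists>p \<in> set (zip [0..<B] \<sigma>). p \<in> c)"
    by (induction cs) (auto simp: check_clauses_clause_code)
  with assms zip show ?thesis by (cases "length \<sigma> = B") simp_all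
qed

lemma parse_formula_code:
  "parse_formula xs ps (self_delim \<psi> @ w) =
    check_clauses (rev xs @ w) False (rev xs @ w) (rev ps @ \<psi>)"
  by (induction \<psi> arbitrary: ps) (auto simp: self_delim_def)

lemma parse_input_code:
  "parse_input xs (pair_enc (pair_enc x \<psi>) w) =
    check_clauses (rev xs @ x @ w) False (rev xs @ x @ w) \<psi>"
proof (induction x arbitrary: xs)
  case Nil
  then show ?case
    using parse_formula_code[of xs "[]" \<psi> w] by (simp add: pair_enc_def self_delim_def)
next
  case (Cons b x)
  from Cons[of "b # xs"] show ?case by (simp add: pair_enc_def self_delim_def)
qed

lemma length_clause_code: "length (clause_code vs c) = 3 * length vs + 1"
  by (induction vs) (auto simp: clause_code_def)

lemma length_cnf_code: "length (concat (map (clause_code vs) cs)) = length cs * (3 * length vs + 1)"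
  by (induction cs) (auto simp: length_clause_code)

lemma length_self_delim: "length (self_delim x) = 2 * length x + 1"
  by (induction x) (auto simp: self_delim_def)

text \<open>The advice is the code of the formula for the nonmembers of that length. Membership in
  \<open>L\<close> is then unsatisfiability of this formula with its first variables fixed to
  \<open>x\<close>, and a witness against it lists the values of the remaining variables.\<close>

lemma coNP_poly_if_small_cnfs:
  assumes "small_cnfs (- L)"
  shows "L \<in> class_coNP_poly"
proof -
  obtain f where f: "poly_bounded f" "\<And>n. cnf_definable n (f n) {x \<in> - L. length x = n}"
    using assms unfolding small_cnfs_def by blast
  define good where "good n cs \<longleftrightarrow> cs \<noteq> [] \<and> length cs \<le> f n \<and> (\<forall>c \<in> set cs. fst ` c \<subseteq> {..<f n}) \<and>
    {x \<in> - L. length x = n} =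
      {x. length x = n \<and> (\<exists>\<sigma>. (\<forall>i < n. \<sigma> i = x ! i) \<and> satisfies \<sigma> (set cs))}" for n cs
  have "\<exists>cs. good n cs" for n
    using f(2)[of n] unfolding cnf_definable_def good_def by (rule conjunct2)
  then obtain cs where good: "\<And>n. good n (cs n)" by metis
  have cs: "n \<le> f n" "cs n \<noteq> []" "length (cs n) \<le> f n" "\<forall>c \<in> set (cs n). fst ` c \<subseteq> {..<f n}"
      "{x \<in> - L. length x = n} =
        {x. length x = n \<and> (\<exists>\<sigma>. (\<forall>i < n. \<sigma> i = x ! i) \<and> satisfies \<sigma> (set (cs n)))}" for n
    using good[of n, unfolded good_def] f(2)[of n, unfolded cnf_definable_def]
    by - (elim conjE; assumption)+
  define a where "a n = concat (map (clause_code [0..<f n]) (cs n))" for n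
  define V where "V = {z. parse_input [] z}"
  define L' where "L' = {z. \<not> (\<exists>w. length w \<le> length z \<and> pair_enc z w \<in> V)}"
  have "V \<in> class_P" unfolding V_def by (rule sat_language_in_P)
  moreover have "\<forall>z. z \<in> - L' \<longleftrightarrow> (\<exists>w. length w \<le> poly [:0, 1:] (length z) \<and> pair_enc z w \<in> V)"
    by (simp add: L'_def)
  ultimately have "- L' \<in> class_NP"
    unfolding class_NP_def by blast
  then have L': "L' \<in> class_coNP" by (simp add: class_coNP_def)
  have "poly_bounded (\<lambda>n. f n * (3 * f n + 1))"
    by (intro poly_bounded_mult poly_bounded_add poly_bounded_const f(1))
  then obtain q :: "nat poly" where q: "\<And>n. f n * (3 * f n + 1) \<le> poly q n"
    unfolding poly_bounded_def by blast
  have len: "length (a n) \<le> poly q n" for n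
  proof -
    have "length (a n) \<le> f n * (3 * f n + 1)"
      using cs(3)[of n] unfolding a_def length_cnf_code length_upt by (intro mult_le_mono) auto
    with q[of n] show ?thesis by linarith
  qed
  have accept: "pair_enc (pair_enc x (a n)) w \<in> V \<longleftrightarrow> length (x @ w) = f n \<and>
      (\<forall>c \<in> set (cs n). \<exists>(v, b) \<in> c. v < f n \<and> (x @ w) ! v = b)" for x n w
    using check_clauses_cnf[OF cs(2)[of n], of "x @ w" "f n"] parse_input_code[of "[]" x "a n" w]
    unfolding V_def a_def by (simp only: mem_Collect_eq rev.simps append_Nil)
  have "x \<in> L \<longleftrightarrow> pair_enc x (a (length x)) \<in> L'" for x
  proof -
    let ?n = "length x" and ?z = "pair_enc x (a (length x))"
    have "x \<in> - L \<longleftrightarrow> (\<exists>\<sigma>. (\<forall>i < ?n. \<sigma> i = x ! i) \<and> satisfies \<sigma> (set (cs ?n)))"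
      using cs(5)[of ?n, unfolded set_eq_iff, rule_format, of x] by simp
    also have "\<dots> \<longleftrightarrow> (\<exists>w. length w \<le> length ?z \<and> pair_enc ?z w \<in> V)"
    proof
      assume "\<exists>\<sigma>. (\<forall>i < ?n. \<sigma> i = x ! i) \<and> satisfies \<sigma> (set (cs ?n))"
      then obtain \<sigma> where \<sigma>: "\<forall>i < ?n. \<sigma> i = x ! i" "satisfies \<sigma> (set (cs ?n))" by blast
      define w where "w = map \<sigma> [?n..<f ?n]"
      have xw: "x @ w = map \<sigma> [0..<f ?n]"
        using \<sigma>(1) cs(1)[of ?n] by (intro nth_equalityI) (auto simp: w_def nth_append)
      \<comment> \<open>\<open>L'\<close> bounds witnesses by the length of its own input, so the
        advice must be at least as long as the number of variables. It is, as a single clause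
        already has more than three symbols per variable.\<close>
      have "f ?n \<le> length (a ?n)"
        using cs(2)[of ?n] mult_le_mono[of 1 "length (cs ?n)" "f ?n" "3 * f ?n + 1"]
        unfolding a_def length_cnf_code by (simp add: Suc_le_eq)
      then have "length w \<le> length ?z"
        by (simp add: w_def pair_enc_def)
      moreover have "pair_enc ?z w \<in> V"
        unfolding accept xw
      proof (intro conjI ballI)
        fix c assume c: "c \<in> set (cs ?n)"
        then obtain v b where vb: "(v, b) \<in> c" "\<sigma> v = b"
          using \<sigma>(2) unfolding satisfies_def by blast
        then have "v < f ?n"
          using cs(4)[of ?n] c by force
        with vb show "\<exists>(v, b) \<in> c. v < f ?n \<and> map \<sigma> [0..<f ?n] ! v = b"
          by (intro bexI[of _ "(v, b)"]) auto
      qed simp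
      ultimately show "\<exists>w. length w \<le> length ?z \<and> pair_enc ?z w \<in> V" by blast
    next
      assume "\<exists>w. length w \<le> length ?z \<and> pair_enc ?z w \<in> V"
      then obtain w where "pair_enc ?z w \<in> V" by blast
      then have "satisfies (\<lambda>i. (x @ w) ! i) (set (cs ?n))"
        unfolding accept satisfies_def case_prod_unfold by blast
      then show "\<exists>\<sigma>. (\<forall>i < ?n. \<sigma> i = x ! i) \<and> satisfies \<sigma> (set (cs ?n))"
        by (intro exI[of _ "\<lambda>i. (x @ w) ! i"]) (auto simp: nth_append)
    qed
    finally show ?thesis unfolding L'_def by blast
  qed
  with len show ?thesis
    unfolding class_coNP_poly_def with_poly_advice_def
    by (intro CollectI bexI[OF _ L'] exI[of _ a] exI[of _ q] conjI allI)
qed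

section \<open>The tableau of a machine\<close>

lemma cnf_definable_mono:
  assumes "cnf_definable n B A" "B \<le> B'"
  shows "cnf_definable n B' A"
proof -
  obtain cs where cs: "cs \<noteq> []" "length cs \<le> B" "\<forall>c \<in> set cs. fst ` c \<subseteq> {..<B}"
    and A: "A = {x. length x = n \<and> (\<exists>\<sigma>. (\<forall>i < n. \<sigma> i = x ! i) \<and> satisfies \<sigma> (set cs))}"
    and n: "n \<le> B"
    using assms(1) unfolding cnf_definable_def by blast
  show ?thesis
    unfolding cnf_definable_def
  proof (intro conjI exI)
    show "\<forall>c \<in> set cs. fst ` c \<subseteq> {..<B'}" using cs(3) assms(2) by fastforce
  qed (use assms(2) cs n A in auto)
qed

text \<open>A selector variable \<open>B + h r\<close> for every \<open>r\<close>: one clause asks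
  for some true selector, and each clause of the formula for \<open>r\<close> is guarded by the
  negated selector. The formulas can share their auxiliary variables below \<open>B\<close> because
  only a selected one has to hold.\<close>

lemma cnf_definable_Union:
  assumes def: "\<And>r. r \<in> R \<Longrightarrow> cnf_definable n B (A r)" and "finite R" "n \<le> B"
  shows "cnf_definable n (B + card R * B + card R + 1) (\<Union>r \<in> R. A r)"
proof -
  obtain h where h: "bij_betw h R {..<card R}"
    using ex_bij_betw_finite_nat[OF \<open>finite R\<close>] by (auto simp: atLeast0LessThan)
  define good where "good r cs \<longleftrightarrow> length cs \<le> B \<and> (\<forall>c \<in> set cs. fst ` c \<subseteq> {..<B}) \<and>
      A r = {x. length x = n \<and> (\<exists>\<sigma>. (\<forall>i < n. \<sigma> i = x ! i) \<and> satisfies \<sigma> (set cs))}" for r cs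
  have "\<exists>cs. good r cs" if "r \<in> R" for r
    using def[OF that] unfolding cnf_definable_def good_def by (elim conjE exE) (intro exI conjI)
  then obtain cs where good: "\<And>r. r \<in> R \<Longrightarrow> good r (cs r)" by metis
  have cs: "length (cs r) \<le> B" "\<And>c. c \<in> set (cs r) \<Longrightarrow> fst ` c \<subseteq> {..<B}"
      "A r = {x. length x = n \<and> (\<exists>\<sigma>. (\<forall>i < n. \<sigma> i = x ! i) \<and> satisfies \<sigma> (set (cs r)))}"
    if "r \<in> R" for r
    using good[OF that, unfolded good_def] by - (elim conjE; (assumption | erule bspec; assumption))+
  \<comment> \<open>For empty \<open>R\<close> the first clause is empty, so the formula is
    unsatisfiable, as it should be, and still has a clause.\<close>
  define F where "F = insert ((\<lambda>r. (B + h r, True)) ` R)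
    (\<Union>r \<in> R. (\<lambda>c. insert (B + h r, False) c) ` set (cs r))"
  have "finite F" using \<open>finite R\<close> by (simp add: F_def)
  have "card (\<Union>r \<in> R. (\<lambda>c. insert (B + h r, False) c) ` set (cs r)) \<le> (\<Sum>r \<in> R. B)"
  proof (rule order_trans[OF card_UN_le[OF \<open>finite R\<close>]], rule sum_mono)
    fix r assume "r \<in> R"
    have "card ((\<lambda>c. insert (B + h r, False) c) ` set (cs r)) \<le> length (cs r)"
      by (meson card_image_le card_length finite_set order_trans)
    also have "\<dots> \<le> B" using cs(1) \<open>r \<in> R\<close> .
    finally show "card ((\<lambda>c. insert (B + h r, False) c) ` set (cs r)) \<le> B" .
  qed
  then have "card F \<le> Suc (card R * B)"
    unfolding F_def using \<open>finite R\<close> by (simp add: card_insert_if)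
  obtain fs where fs: "set fs = F" "distinct fs"
    using finite_distinct_list[OF \<open>finite F\<close>] by blast
  have "length fs \<le> B + card R * B + card R + 1"
    using \<open>card F \<le> Suc (card R * B)\<close> distinct_card[OF fs(2)] fs(1) by simp
  moreover have "fs \<noteq> []" using fs(1) by (auto simp: F_def)
  moreover have "\<forall>c \<in> set fs. fst ` c \<subseteq> {..<B + card R * B + card R + 1}"
  proof
    fix c assume "c \<in> set fs"
    have hr: "h r < card R" if "r \<in> R" for r using h that by (auto simp: bij_betw_def)
    have "fst ` c \<subseteq> {..<B + card R}"
      using \<open>c \<in> set fs\<close> unfolding fs(1) F_def
    proof
      assume "c = (\<lambda>r. (B + h r, True)) ` R"
      then show ?thesis using hr by auto
    next
      assume "c \<in> (\<Union>r \<in> R. (\<lambda>c. insert (B + h r, False) c) ` set (cs r))"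
      then obtain r c' where "r \<in> R" "c' \<in> set (cs r)" "c = insert (B + h r, False) c'" by blast
      then show ?thesis using hr[of r] cs(2)[of r c'] by fastforce
    qed
    then show "fst ` c \<subseteq> {..<B + card R * B + card R + 1}" by fastforce
  qed
  moreover have "(\<Union>r \<in> R. A r) =
      {x. length x = n \<and> (\<exists>\<sigma>. (\<forall>i < n. \<sigma> i = x ! i) \<and> satisfies \<sigma> (set fs))}" (is "_ = ?X")
  proof (intro equalityI subsetI)
    fix x assume "x \<in> (\<Union>r \<in> R. A r)"
    then obtain r \<sigma> where r: "r \<in> R" "length x = n" "\<forall>i < n. \<sigma> i = x ! i" "satisfies \<sigma> (set (cs r))"
      using cs(3) by blast
    define \<tau> where "\<tau> v = (if v < B then \<sigma> v else v = B + h r)" for v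
    have "\<exists>(v, b) \<in> c. \<tau> v = b" if c: "c \<in> F" for c
      using c unfolding F_def
    proof
      assume "c = (\<lambda>r. (B + h r, True)) ` R"
      then show ?thesis using r(1) by (auto simp: \<tau>_def)
    next
      assume "c \<in> (\<Union>r \<in> R. (\<lambda>c. insert (B + h r, False) c) ` set (cs r))"
      then obtain r' c' where r': "r' \<in> R" "c' \<in> set (cs r')" "c = insert (B + h r', False) c'" by blast
      show ?thesis
      proof (cases "r' = r")
        case True
        then obtain v b where vb: "(v, b) \<in> c'" "\<sigma> v = b"
          using r(4) r' unfolding satisfies_def by blast
        then have "v < B" using cs(2)[OF r'(1,2)] by force
        with vb r'(3) show ?thesis by (intro bexI[of _ "(v, b)"]) (auto simp: \<tau>_def)
      next
        case False
        then have "h r' \<noteq> h r"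
          using h r(1) r'(1) by (auto simp: bij_betw_def inj_on_def)
        then show ?thesis
          using r'(3) by (intro bexI[of _ "(B + h r', False)"]) (auto simp: \<tau>_def)
      qed
    qed
    then have "satisfies \<tau> (set fs)" unfolding satisfies_def fs(1) by blast
    moreover have "\<forall>i < n. \<tau> i = x ! i" using r(3) \<open>n \<le> B\<close> by (auto simp: \<tau>_def)
    ultimately show "x \<in> ?X" using r(2) by blast
  next
    fix x assume "x \<in> ?X"
    then obtain \<sigma> where \<sigma>: "length x = n" "\<forall>i < n. \<sigma> i = x ! i" "satisfies \<sigma> F"
      unfolding fs(1) by blast
    then obtain r where r: "r \<in> R" "\<sigma> (B + h r)"
      unfolding satisfies_def F_def by auto
    have "satisfies \<sigma> (set (cs r))"
      unfolding satisfies_def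
    proof
      fix c assume "c \<in> set (cs r)"
      then have "insert (B + h r, False) c \<in> F" using r(1) unfolding F_def by blast
      with \<sigma>(3) have "\<exists>(v, b) \<in> insert (B + h r, False) c. \<sigma> v = b"
        unfolding satisfies_def by blast
      with r(2) show "\<exists>(v, b) \<in> c. \<sigma> v = b" by auto
    qed
    with \<sigma> r(1) show "x \<in> (\<Union>r \<in> R. A r)" using cs(3)[OF r(1)] by blast
  qed
  ultimately show ?thesis
    unfolding cnf_definable_def using \<open>n \<le> B\<close> by (intro conjI exI[of _ fs]) auto
qed

section \<open>From local constraints to formulas\<close>

definition depends_on :: "(('v \<Rightarrow> bool) \<Rightarrow> bool) \<Rightarrow> 'v set \<Rightarrow> bool" where
  "depends_on P X \<longleftrightarrow> (\<forall>\<sigma> \<tau>. (\<forall>v \<in> X. \<sigma> v = \<tau> v) \<longrightarrow> P \<sigma> = P \<tau>)"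

lemma depends_onD: "depends_on P X \<Longrightarrow> (\<And>v. v \<in> X \<Longrightarrow> \<sigma> v = \<tau> v) \<Longrightarrow> P \<sigma> = P \<tau>"
  unfolding depends_on_def by blast

text \<open>The canonical CNF: each falsifying assignment on \<open>X\<close>, given by its set
  \<open>Y\<close> of true variables, is excluded by one clause. The exponential size is harmless
  because tableau constraints have a number of variables that depends on the machine only.\<close>

lemma cnf_of_local_predicate:
  assumes "finite X" "depends_on P X"
  obtains F where "finite F" "card F \<le> 2 ^ card X" "\<forall>c \<in> F. fst ` c \<subseteq> X"
    "\<And>\<sigma>. satisfies \<sigma> F \<longleftrightarrow> P \<sigma>"
proof -
  define clause where "clause Y = (\<lambda>v. (v, v \<notin> Y)) ` X" for Y
  define F where "F = clause ` {Y. Y \<subseteq> X \<and> \<not> P (\<lambda>v. v \<in> Y)}"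
  have sub: "{Y. Y \<subseteq> X \<and> \<not> P (\<lambda>v. v \<in> Y)} \<subseteq> Pow X" by blast
  have fin: "finite {Y. Y \<subseteq> X \<and> \<not> P (\<lambda>v. v \<in> Y)}"
    using sub \<open>finite X\<close> finite_subset by blast
  show thesis
  proof
    show "finite F" using fin by (simp add: F_def)
    have "card F \<le> card {Y. Y \<subseteq> X \<and> \<not> P (\<lambda>v. v \<in> Y)}"
      unfolding F_def by (rule card_image_le[OF fin])
    also have "\<dots> \<le> card (Pow X)" by (rule card_mono) (use sub \<open>finite X\<close> in auto)
    finally show "card F \<le> 2 ^ card X" using \<open>finite X\<close> by (simp add: card_Pow)
    show "\<forall>c \<in> F. fst ` c \<subseteq> X" by (auto simp: F_def clause_def)
    show "satisfies \<sigma> F \<longleftrightarrow> P \<sigma>" for \<sigma>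
    proof
      assume sat: "satisfies \<sigma> F"
      show "P \<sigma>"
      proof (rule ccontr)
        assume "\<not> P \<sigma>"
        define Y where "Y = {v \<in> X. \<sigma> v}"
        have "P (\<lambda>v. v \<in> Y) = P \<sigma>"
          by (rule depends_onD[OF assms(2)]) (simp add: Y_def)
        with \<open>\<not> P \<sigma>\<close> have "clause Y \<in> F" by (auto simp: F_def Y_def)
        with sat have "\<exists>(v, b) \<in> clause Y. \<sigma> v = b" unfolding satisfies_def by blast
        then show False by (auto simp: clause_def Y_def)
      qed
    next
      assume "P \<sigma>"
      show "satisfies \<sigma> F"
        unfolding satisfies_def
      proof
        fix c assume "c \<in> F"
        then obtain Y where Y: "Y \<subseteq> X" "\<not> P (\<lambda>v. v \<in> Y)" "c = clause Y" by (auto simp: F_def)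
        have "\<exists>v \<in> X. \<sigma> v \<noteq> (v \<in> Y)"
          using depends_onD[OF assms(2), of \<sigma> "\<lambda>v. v \<in> Y"] \<open>P \<sigma>\<close> Y(2) by blast
        then show "\<exists>(v, b) \<in> c. \<sigma> v = b" by (auto simp: Y(3) clause_def)
      qed
    qed
  qed
qed

text \<open>\<open>Inl i\<close> are the numbered bits, the first \<open>n\<close> of which form the
  word, and \<open>Inr z\<close> are auxiliary bits named by a structured type. Each constraint is
  replaced by its canonical CNF, and \<open>g\<close> renumbers all variables as an initial
  segment.\<close>

lemma cnf_definable_of_constraints:
  fixes P :: "'k \<Rightarrow> (nat + 'w \<Rightarrow> bool) \<Rightarrow> bool" and Z :: "'w set"
  assumes fin: "finite I" "finite Z"
    and loc: "\<And>k. k \<in> I \<Longrightarrow> depends_on (P k) (S k)"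
    and S: "\<And>k. k \<in> I \<Longrightarrow> S k \<subseteq> Inl ` {..<D} \<union> Inr ` Z" "\<And>k. k \<in> I \<Longrightarrow> card (S k) \<le> r"
    and "n \<le> D"
  shows "cnf_definable n (D + card Z + card I * 2 ^ r + 1)
    {x. length x = n \<and> (\<exists>\<sigma>. (\<forall>i < n. \<sigma> (Inl i) = x ! i) \<and> (\<forall>k \<in> I. P k \<sigma>))}"
proof -
  define X where "X = (Inl ` {..<D} \<union> Inr ` Z :: (nat + 'w) set)"
  have "finite X" using fin by (simp add: X_def)
  have finS: "finite (S k)" if "k \<in> I" for k
    using S(1)[OF that] \<open>finite X\<close> unfolding X_def by (rule finite_subset)
  define good where "good k F \<longleftrightarrow> finite F \<and> card F \<le> 2 ^ r \<and> (\<forall>c \<in> F. fst ` c \<subseteq> X) \<and>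
      (\<forall>\<sigma>. satisfies \<sigma> F = P k \<sigma>)" for k F
  have "\<exists>F. good k F" if k: "k \<in> I" for k
  proof -
    obtain F where F: "finite F" "card F \<le> 2 ^ card (S k)" "\<forall>c \<in> F. fst ` c \<subseteq> S k"
        "\<And>\<sigma>. satisfies \<sigma> F \<longleftrightarrow> P k \<sigma>"
      using cnf_of_local_predicate[OF finS[OF k] loc[OF k]] by blast
    have "card F \<le> 2 ^ r"
      using F(2) S(2)[OF k] order_trans power_increasing[of "card (S k)" r "2::nat"] by fastforce
    moreover have "\<forall>c \<in> F. fst ` c \<subseteq> X" using F(3) S(1)[OF k] unfolding X_def by blast
    ultimately have "good k F" using F(1,4) unfolding good_def by auto
    then show ?thesis by blast
  qed
  then obtain F where good: "\<And>k. k \<in> I \<Longrightarrow> good k (F k)" by metis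
  have F: "finite (F k)" "card (F k) \<le> 2 ^ r" "\<And>c. c \<in> F k \<Longrightarrow> fst ` c \<subseteq> X"
      "\<And>\<sigma>. satisfies \<sigma> (F k) = P k \<sigma>" if "k \<in> I" for k
    using good[OF that] unfolding good_def by auto
  obtain h where h: "bij_betw h Z {..<card Z}"
    using ex_bij_betw_finite_nat[OF \<open>finite Z\<close>] by (auto simp: atLeast0LessThan)
  define g where "g v = (case v of Inl i \<Rightarrow> i | Inr z \<Rightarrow> D + h z)" for v
  define g' where "g' i = (if i < D then Inl i else Inr (inv_into Z h (i - D)))" for i
  have g'g: "g' (g v) = v" if "v \<in> X" for v
    using that h by (auto simp: X_def g_def g'_def bij_betw_def inv_into_f_f)
  have gX: "g v < D + card Z" if "v \<in> X" for v
    using that h by (auto simp: X_def g_def bij_betw_def)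
  define ren where "ren c = (\<lambda>(v, b). (g v, b)) ` c" for c :: "(nat + 'w) clause"
  \<comment> \<open>The tautology on a fresh variable keeps the clause list nonempty even if no
    constraint yields a clause.\<close>
  define G where "G = insert {(D + card Z, True), (D + card Z, False)} (\<Union>k \<in> I. ren ` F k)"
  have "finite G" using fin(1) F(1) by (simp add: G_def)
  have "card (\<Union>k \<in> I. ren ` F k) \<le> (\<Sum>k \<in> I. 2 ^ r)"
  proof (rule order_trans[OF card_UN_le[OF fin(1)]], rule sum_mono)
    fix k assume "k \<in> I"
    then show "card (ren ` F k) \<le> 2 ^ r"
      using F(1,2) card_image_le order_trans by metis
  qed
  then have cardG: "card G \<le> Suc (card I * 2 ^ r)"
    unfolding G_def using fin(1) F(1) by (simp add: card_insert_if)
  obtain fs where fs: "set fs = G" "distinct fs"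
    using finite_distinct_list[OF \<open>finite G\<close>] by blast
  have satren: "satisfies \<tau> (ren ` F k) \<longleftrightarrow> satisfies (\<lambda>v. \<tau> (g v)) (F k)" for \<tau> k
    unfolding satisfies_def ren_def by (simp add: case_prod_unfold)
  have satG: "satisfies \<tau> G \<longleftrightarrow> (\<forall>k \<in> I. P k (\<lambda>v. \<tau> (g v)))" for \<tau>
  proof -
    have "satisfies \<tau> G \<longleftrightarrow> (\<forall>k \<in> I. satisfies \<tau> (ren ` F k))"
      unfolding G_def satisfies_def by auto
    then show ?thesis using satren F(4) by simp
  qed
  show ?thesis
    unfolding cnf_definable_def
  proof (intro conjI exI[of _ fs])
    show "n \<le> D + card Z + card I * 2 ^ r + 1" using \<open>n \<le> D\<close> by simp
    show "fs \<noteq> []" using fs(1) by (auto simp: G_def)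
    show "length fs \<le> D + card Z + card I * 2 ^ r + 1"
      using cardG distinct_card[OF fs(2)] fs(1) by simp
    have "fst ` ren c \<subseteq> {..<D + card Z}" if "k \<in> I" "c \<in> F k" for c k
      using F(3)[OF that] gX by (force simp: ren_def)
    then show "\<forall>c \<in> set fs. fst ` c \<subseteq> {..<D + card Z + card I * 2 ^ r + 1}"
      unfolding fs(1) G_def by fastforce
    show "{x. length x = n \<and> (\<exists>\<sigma>. (\<forall>i < n. \<sigma> (Inl i) = x ! i) \<and> (\<forall>k \<in> I. P k \<sigma>))} =
      {x. length x = n \<and> (\<exists>\<tau>. (\<forall>i < n. \<tau> i = x ! i) \<and> satisfies \<tau> (set fs))}" (is "?A = ?B")
    proof (intro equalityI subsetI)
      fix x assume "x \<in> ?A"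
      then obtain \<sigma> where \<sigma>: "length x = n" "\<forall>i < n. \<sigma> (Inl i) = x ! i" "\<forall>k \<in> I. P k \<sigma>" by blast
      define \<tau> where "\<tau> i = \<sigma> (g' i)" for i
      have "P k (\<lambda>v. \<tau> (g v)) = P k \<sigma>" if "k \<in> I" for k
        by (rule depends_onD[OF loc[OF that]]) (use S(1)[OF that] g'g in \<open>auto simp: \<tau>_def X_def\<close>)
      then have "satisfies \<tau> (set fs)" using \<sigma>(3) unfolding fs(1) satG by simp
      moreover have "\<forall>i < n. \<tau> i = x ! i" using \<sigma>(2) \<open>n \<le> D\<close> by (simp add: \<tau>_def g'_def)
      ultimately show "x \<in> ?B" using \<sigma>(1) by blast
    next
      fix x assume "x \<in> ?B"
      then obtain \<tau> where \<tau>: "length x = n" "\<forall>i < n. \<tau> i = x ! i" "satisfies \<tau> G"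
        unfolding fs(1) by blast
      then have "(\<forall>i < n. \<tau> (g (Inl i)) = x ! i) \<and> (\<forall>k \<in> I. P k (\<lambda>v. \<tau> (g v)))"
        unfolding satG by (simp add: g_def)
      with \<tau>(1) show "x \<in> ?A"
        by (intro CollectI conjI exI[of _ "\<lambda>v. \<tau> (g v)"]) (elim conjE, assumption)+
    qed
  qed
qed

text \<open>
  \<open>Cell j i True\<close> tells whether cell \<open>i\<close> of tape \<open>j\<close> is nonblank, \<open>Cell j i False\<close> whether it holds 1.
\<close>

datatype config_bit = State nat | Cell nat int bool

fun config_bits :: "config \<Rightarrow> config_bit \<Rightarrow> bool" where
  "config_bits (q, ts) (State p) = (p = q)"
| "config_bits (q, ts) (Cell j i True) = ((ts ! j) i \<noteq> None)"
| "config_bits (q, ts) (Cell j i False) = ((ts ! j) i = Some True)"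

section \<open>Locality of a machine step\<close>

definition valid_config :: "tm \<Rightarrow> config \<Rightarrow> bool" where
  "valid_config M c \<longleftrightarrow> fst c < num_states M \<and> length (snd c) = num_tapes M"

text \<open>What determines bit \<open>v\<close> after one step: state and scanned symbols select
  the action, and since index 0 follows the head, that action may shift a cell of the tape by one
  position either way.\<close>

definition neighbourhood :: "tm \<Rightarrow> config_bit \<Rightarrow> config_bit set" where
  "neighbourhood M v = State ` {..<num_states M} \<union> (\<lambda>(j, b). Cell j 0 b) ` ({..<num_tapes M} \<times> UNIV) \<union>
     (case v of State p \<Rightarrow> {} | Cell j i b \<Rightarrow> (\<lambda>(i', b'). Cell j i' b') ` ({i - 1, i, i + 1} \<times> UNIV))"

lemma valid_init_config: "wf_tm M \<Longrightarrow> valid_config M (init_config M x)"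
  by (simp add: wf_tm_def valid_config_def init_config_def)

lemma valid_tm_step:
  assumes "wf_tm M" "valid_config M c"
  shows "valid_config M (tm_step M c)"
proof (cases "next_action M c")
  case None
  then show ?thesis using assms(2) by (simp add: tm_step_def)
next
  case (Some a)
  then obtain q as where a: "next_action M c = Some (q, as)" by (cases a) auto
  then have "q < num_states M \<and> length as = num_tapes M"
    using assms unfolding wf_tm_def next_action_def valid_config_def
    by (metis length_map)
  with a show ?thesis using assms(2) by (simp add: tm_step_def valid_config_def)
qed

lemma valid_tm_steps: "wf_tm M \<Longrightarrow> valid_config M c \<Longrightarrow> valid_config M ((tm_step M ^^ n) c)"
  by (induction n) (auto intro: valid_tm_step)

lemma finite_neighbourhood: "finite (neighbourhood M v)"
  unfolding neighbourhood_def by (cases v) auto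

lemma card_neighbourhood: "card (neighbourhood M v) \<le> num_states M + 2 * num_tapes M + 6"
proof -
  have 1: "card (State ` {..<num_states M}) \<le> num_states M"
    using card_image_le[of "{..<num_states M}" State] by simp
  have 2: "card ((\<lambda>(j, b). Cell j 0 b) ` ({..<num_tapes M} \<times> (UNIV :: bool set))) \<le> 2 * num_tapes M"
    using card_image_le[of "{..<num_tapes M} \<times> (UNIV :: bool set)" "\<lambda>(j, b). Cell j 0 b"]
    by (simp add: card_cartesian_product)
  have 3: "card (case v of State p \<Rightarrow> {} | Cell j i b \<Rightarrow> (\<lambda>(i', b'). Cell j i' b') ` ({i - 1, i, i + 1} \<times> (UNIV :: bool set))) \<le> 6"
  proof (cases v)
    case (Cell j i b)
    have "card ((\<lambda>(i', b'). Cell j i' b') ` ({i - 1, i, i + 1} \<times> (UNIV :: bool set))) \<le> card ({i - 1, i, i + 1} \<times> (UNIV :: bool set))"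
      by (rule card_image_le) simp
    then show ?thesis by (simp add: Cell card_cartesian_product)
  qed simp
  show ?thesis
    unfolding neighbourhood_def
    using 1 2 3 by (intro order_trans[OF card_Un_le] add_mono) auto
qed

lemma config_bits_cell:
  assumes "\<And>b. config_bits c (Cell j i b) = config_bits c' (Cell j i b)"
  shows "(snd c ! j) i = (snd c' ! j) i"
proof -
  obtain q ts q' ts' where "c = (q, ts)" "c' = (q', ts')" by fastforce
  then show ?thesis
    using assms[of True] assms[of False]
    by (cases "(ts ! j) i"; cases "(ts' ! j) i") auto
qed

lemma in_neighbourhood:
  "State p \<in> neighbourhood M v \<longleftrightarrow> p < num_states M"
  "Cell j i b \<in> neighbourhood M v \<longleftrightarrow> j < num_tapes M \<and> i = 0 \<or>
     (\<exists>i' b'. v = Cell j i' b' \<and> \<bar>i - i'\<bar> \<le> 1)"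
  by (cases v; auto simp: neighbourhood_def image_iff)+

lemma tm_step_local:
  assumes valid: "valid_config M c" "valid_config M c'" and M: "wf_tm M"
    and eq: "\<And>u. u \<in> neighbourhood M v \<Longrightarrow> config_bits c u = config_bits c' u"
    and v: "\<And>j i b. v = Cell j i b \<Longrightarrow> j < num_tapes M"
  shows "config_bits (tm_step M c) v = config_bits (tm_step M c') v"
proof -
  obtain q ts q' ts' where c: "c = (q, ts)" "c' = (q', ts')" by fastforce
  have len: "length ts = num_tapes M" "length ts' = num_tapes M" and q: "q < num_states M"
    using valid by (auto simp: c valid_config_def)
  have "config_bits c (State q) = config_bits c' (State q)"
    by (rule eq) (use q in \<open>auto simp: neighbourhood_def\<close>)
  then have [simp]: "q' = q" by (simp add: c)
  have scan: "(ts ! j) 0 = (ts' ! j) 0" if "j < num_tapes M" for j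
  proof -
    have "(snd c ! j) 0 = (snd c' ! j) 0"
      by (rule config_bits_cell, rule eq) (use that in \<open>simp add: in_neighbourhood\<close>)
    then show ?thesis by (simp add: c)
  qed
  have "map (\<lambda>t. t 0) ts = map (\<lambda>t. t 0) ts'"
    by (rule nth_equalityI) (auto simp: len scan)
  then have act: "next_action M c = next_action M c'"
    by (simp add: next_action_def c)
  show ?thesis
  proof (cases v)
    case (State p)
    then show ?thesis
      using act by (auto simp: tm_step_def c split: option.split)
  next
    case (Cell j i b)
    have j: "j < num_tapes M" using v Cell by blast
    have near: "(ts ! j) i' = (ts' ! j) i'" if "i' \<in> {i - 1, i, i + 1}" for i'
    proof -
      have "(snd c ! j) i' = (snd c' ! j) i'"
        by (rule config_bits_cell, rule eq) (use that in \<open>auto simp: in_neighbourhood Cell\<close>)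
      then show ?thesis by (simp add: c)
    qed
    have "(snd (tm_step M c) ! j) i = (snd (tm_step M c') ! j) i"
    proof (cases "next_action M c")
      case None
      then show ?thesis using act near by (simp add: tm_step_def c)
    next
      case (Some a)
      then obtain q2 as where a: "next_action M c = Some (q2, as)" by (cases a) auto
      have "length as = num_tapes M"
        using valid_tm_step[OF M valid(1)] a len M valid(1)
        unfolding wf_tm_def next_action_def valid_config_def by (metis length_map)
      moreover have "act (as ! j) (ts ! j) i = act (as ! j) (ts' ! j) i"
        using near by (cases "snd (as ! j)") (auto simp: act_def)
      ultimately show ?thesis
        using act a j len by (simp add: tm_step_def c)
    qed
    then show ?thesis
      by (cases "tm_step M c"; cases "tm_step M c'"; cases b) (auto simp: Cell)
  qed
qed

definition cone :: "tm \<Rightarrow> nat \<Rightarrow> config_bit set" where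
  "cone M W = State ` {..<num_states M} \<union>
     (\<lambda>(j, i, b). Cell j i b) ` ({..<num_tapes M} \<times> {- int W..int W} \<times> UNIV)"

lemma finite_cone: "finite (cone M W)"
  by (simp add: cone_def)

lemma card_cone: "card (cone M W) \<le> num_states M + num_tapes M * ((2 * W + 1) * 2)"
proof -
  have "card (State ` {..<num_states M}) \<le> num_states M"
    using card_image_le[of "{..<num_states M}" State] by simp
  moreover have "card ((\<lambda>(j, i, b). Cell j i b) ` ({..<num_tapes M} \<times> {- int W..int W} \<times> (UNIV :: bool set)))
      \<le> card ({..<num_tapes M} \<times> {- int W..int W} \<times> (UNIV :: bool set))"
    by (rule card_image_le) simp
  moreover have "card ({..<num_tapes M} \<times> {- int W..int W} \<times> (UNIV :: bool set)) =
      num_tapes M * ((2 * W + 1) * 2)"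
  proof -
    have "card {- int W..int W} = 2 * W + 1" by simp
    then show ?thesis by (simp only: card_cartesian_product card_lessThan card_UNIV_bool)
  qed
  ultimately show ?thesis
    unfolding cone_def by (intro order_trans[OF card_Un_le] add_mono) auto
qed

lemma in_cone [simp]:
  "State p \<in> cone M W \<longleftrightarrow> p < num_states M"
  "Cell j i b \<in> cone M W \<longleftrightarrow> j < num_tapes M \<and> \<bar>i\<bar> \<le> int W"
  by (auto simp: cone_def image_iff)

lemma neighbourhood_subset_cone: "v \<in> cone M W \<Longrightarrow> neighbourhood M v \<subseteq> cone M (Suc W)"
proof
  fix u assume "v \<in> cone M W" "u \<in> neighbourhood M v"
  then show "u \<in> cone M (Suc W)"
    by (cases u) (auto simp: in_neighbourhood)
qed

lemma cone_mono: "W \<le> W' \<Longrightarrow> cone M W \<subseteq> cone M W'"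
  unfolding cone_def by (intro Un_mono image_mono Sigma_mono) auto


text \<open>Describes a word each bit of which is a function of a single free bit; constants are
  functions that ignore their argument. Inputs of this form keep the first row of a tableau
  local.\<close>

type_synonym template = "(nat \<times> (bool \<Rightarrow> bool)) list"

definition fill :: "template \<Rightarrow> (nat \<Rightarrow> bool) \<Rightarrow> bool list" where
  "fill ts \<rho> = map (\<lambda>(d, g). g (\<rho> d)) ts"

text \<open>An input cell holds one template entry and hence depends on one free bit. The rest of
  the initial configuration is fixed, including the blanks behind the input, whose length is that of
  \<open>ts\<close>.\<close>

lemma input_bit_local:
  assumes "wf_tm M" "\<forall>(d, g) \<in> set ts. d < D" "v \<in> cone M W"
  obtains d where "finite d" "card d \<le> 1" "d \<subseteq> {..<D}"
    "\<And>\<rho> \<rho>'. (\<And>i. i \<in> d \<Longrightarrow> \<rho> i = \<rho>' i) \<Longrightarrow>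
       config_bits (init_config M (fill ts \<rho>)) v = config_bits (init_config M (fill ts \<rho>')) v"
proof (cases "\<exists>i b. v = Cell 0 i b \<and> 0 \<le> i \<and> nat i < length ts")
  case True
  then obtain i b where v: "v = Cell 0 i b" "0 \<le> i" "nat i < length ts" by blast
  obtain d g where dg: "ts ! nat i = (d, g)" by fastforce
  have "d < D" using assms(2) v(3) dg nth_mem by fastforce
  have cell: "input_tape (fill ts \<rho>) i = Some (g (\<rho> d))" for \<rho>
    using v dg by (simp add: input_tape_def fill_def zless_nat_conj)
  show thesis
  proof (rule that[of "{d}"])
    fix \<rho> \<rho>' :: "nat \<Rightarrow> bool" assume "\<And>i. i \<in> {d} \<Longrightarrow> \<rho> i = \<rho>' i"
    then have "input_tape (fill ts \<rho>) i = input_tape (fill ts \<rho>') i" by (simp add: cell)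
    then show "config_bits (init_config M (fill ts \<rho>)) v = config_bits (init_config M (fill ts \<rho>')) v"
      by (cases b) (simp_all add: v(1) init_config_def)
  qed (use \<open>d < D\<close> in auto)
next
  case False
  show thesis
  proof (rule that[of "{}"])
    fix \<rho> \<rho>' :: "nat \<Rightarrow> bool"
    show "config_bits (init_config M (fill ts \<rho>)) v = config_bits (init_config M (fill ts \<rho>')) v"
    proof (cases v)
      case (State p)
      then show ?thesis by (simp add: init_config_def)
    next
      case (Cell j i b)
      have "(snd (init_config M (fill ts \<rho>)) ! j) i = (snd (init_config M (fill ts \<rho>')) ! j) i"
      proof (cases j)
        case 0
        then show ?thesis
          using False Cell by (auto simp: init_config_def input_tape_def fill_def)
      qed (simp add: init_config_def)
      then show ?thesis
        by (cases "init_config M (fill ts \<rho>)"; cases "init_config M (fill ts \<rho>')"; cases b) (auto simp: Cell)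
    qed
  qed auto
qed

lemma valid_config_tapes: "wf_tm M \<Longrightarrow> valid_config M c \<Longrightarrow> snd c \<noteq> []"
  by (auto simp: wf_tm_def valid_config_def)

text \<open>The bound is \<open>\<le>\<close> because the blank after the word belongs to the
  reading; there \<open>lookup\<close> gives its default \<open>None\<close>.\<close>

lemma tape_reads_iff: "tape_reads t y \<longleftrightarrow> (\<forall>i \<le> length y. t (int i) = lookup (map Some y) i)"
  by (auto simp: tape_reads_def lookup_def le_eq_less_or_eq)

fun target_bit :: "bool list \<Rightarrow> nat \<Rightarrow> bool \<Rightarrow> bool" where
  "target_bit y i True = (lookup (map Some y) i \<noteq> None)"
| "target_bit y i False = (lookup (map Some y) i = Some True)"

lemma target_bits_iff:
  assumes "snd c \<noteq> []"
  shows "(\<forall>b. config_bits c (Cell 0 (int i) b) = target_bit y i b) \<longleftrightarrow>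
    hd (snd c) (int i) = lookup (map Some y) i"
proof -
  obtain q ts where c: "c = (q, ts)" by fastforce
  have "hd ts = ts ! 0" using assms by (simp add: c hd_conv_nth)
  then show ?thesis
    by (cases "(ts ! 0) (int i)"; cases "lookup (map Some y) i")
      (auto simp: c all_bool_eq)
qed

text \<open>
  Cook's tableau. Row \<open>\<tau>\<close> only records cells at distance at most \<open>length y + (T - \<tau>)\<close> from the
  head, which is all that can influence the output after \<open>T\<close> steps; so no row needs a boundary
  condition.
\<close>

definition tableau_size :: "tm \<Rightarrow> nat \<Rightarrow> nat \<Rightarrow> nat \<Rightarrow> nat" where
  "tableau_size M D T l = (let K = num_states M + num_tapes M * ((2 * (l + T) + 1) * 2) in
     D + Suc T * K + (Suc T * K + Suc l * 2) * 2 ^ (num_states M + 2 * num_tapes M + 7) + 1)"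

lemma tableau_size_mono:
  "D \<le> D' \<Longrightarrow> T \<le> T' \<Longrightarrow> l \<le> l' \<Longrightarrow> tableau_size M D T l \<le> tableau_size M D' T' l'"
  unfolding tableau_size_def Let_def by (intro add_mono mult_le_mono) auto

lemma poly_bounded_tableau_size:
  assumes "poly_bounded D" "poly_bounded T" "poly_bounded l"
  shows "poly_bounded (\<lambda>n. tableau_size M (D n) (T n) (l n))"
  unfolding tableau_size_def Let_def
  by (intro poly_bounded_add poly_bounded_mult poly_bounded_Suc poly_bounded_const assms)

text \<open>The bits \<open>\<rho>\<close> beyond the first \<open>n\<close> are guessed, so the set
  consists of the words that can be completed to an input on which the output is \<open>y\<close>.
  Constraints tie row 0 to the template, each further row to the one before, and the cells of row
  \<open>T\<close> to \<open>y\<close>; by locality each involves at most \<open>r\<close>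
  bits.\<close>

lemma cook_levin:
  fixes ts :: template and D n T :: nat and y :: "bool list"
  assumes M: "wf_tm M" and ts: "\<forall>(d, g) \<in> set ts. d < D" and "n \<le> D"
  shows "cnf_definable n (tableau_size M D T (length y))
    {x. length x = n \<and> (\<exists>\<rho>. (\<forall>i < n. \<rho> i = x ! i) \<and>
       tape_reads (hd (snd ((tm_step M ^^ T) (init_config M (fill ts \<rho>))))) y)}"
proof -
  define K where "K = num_states M + num_tapes M * ((2 * (length y + T) + 1) * 2)"
  \<comment> \<open>The bound of \<open>card_neighbourhood\<close>, increased by one for the
    constrained bit of the next row.\<close>
  define r where "r = num_states M + 2 * num_tapes M + 7"
  define C where "C \<tau> = cone M (length y + (T - \<tau>))" for \<tau>
  define Z where "Z = Sigma {..T} C"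
  define I where "I = Inl ` Z \<union> Inr ` ({..length y} \<times> (UNIV :: bool set))"
  have k0: "num_tapes M > 0" using M by (simp add: wf_tm_def)
  have Csub: "C \<tau> \<subseteq> cone M (length y + T)" for \<tau>
    unfolding C_def by (rule cone_mono) simp
  have "finite Z" unfolding Z_def C_def using finite_cone by blast
  have cardZ: "card Z \<le> Suc T * K"
  proof -
    have "card Z = (\<Sum>\<tau> \<le> T. card (C \<tau>))"
      unfolding Z_def C_def by (rule card_SigmaI) (auto simp: finite_cone)
    also have "\<dots> \<le> (\<Sum>\<tau> \<le> T. K)"
    proof (rule sum_mono)
      fix \<tau>
      have "card (C \<tau>) \<le> card (cone M (length y + T))"
        by (rule card_mono[OF finite_cone Csub])
      also have "\<dots> \<le> K" unfolding K_def by (rule card_cone)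
      finally show "card (C \<tau>) \<le> K" .
    qed
    finally show ?thesis by simp
  qed
  have "finite I" using \<open>finite Z\<close> by (simp add: I_def)
  have cardI: "card I \<le> Suc T * K + Suc (length y) * 2"
  proof -
    have "card I \<le> card (Inl ` Z :: (nat \<times> config_bit + nat \<times> bool) set) +
        card (Inr ` ({..length y} \<times> (UNIV :: bool set)) :: (nat \<times> config_bit + nat \<times> bool) set)"
      unfolding I_def by (rule card_Un_le)
    also have "\<dots> = card Z + Suc (length y) * 2"
      by (subst (1 2) card_image) (auto simp: card_cartesian_product)
    finally show ?thesis using cardZ by linarith
  qed
  define good where "good v d \<longleftrightarrow> finite d \<and> card d \<le> 1 \<and> d \<subseteq> {..<D} \<and>
      (\<forall>\<rho> \<rho>'. (\<forall>i \<in> d. \<rho> i = \<rho>' i) \<longrightarrow>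
        config_bits (init_config M (fill ts \<rho>)) v = config_bits (init_config M (fill ts \<rho>')) v)" for v d
  have "\<exists>d. good v d" if "v \<in> C 0" for v
  proof (rule input_bit_local[OF M ts that[unfolded C_def]])
    fix d assume d: "finite d" "card d \<le> 1" "d \<subseteq> {..<D}"
      and loc: "\<And>\<rho> \<rho>'. (\<And>i. i \<in> d \<Longrightarrow> \<rho> i = \<rho>' i) \<Longrightarrow>
        config_bits (init_config M (fill ts \<rho>)) v = config_bits (init_config M (fill ts \<rho>')) v"
    have "good v d"
      unfolding good_def by (intro conjI allI impI d loc) (erule bspec)
    then show ?thesis ..
  qed
  then obtain d where good: "\<And>v. v \<in> C 0 \<Longrightarrow> good v (d v)" by metis
  have d: "finite (d v)" "card (d v) \<le> 1" "d v \<subseteq> {..<D}"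
      "\<And>\<rho> \<rho>'. (\<forall>i \<in> d v. \<rho> i = \<rho>' i) \<Longrightarrow>
        config_bits (init_config M (fill ts \<rho>)) v = config_bits (init_config M (fill ts \<rho>')) v"
    if "v \<in> C 0" for v
    using good[OF that] unfolding good_def by blast+
  define S :: "nat \<times> config_bit + nat \<times> bool \<Rightarrow> (nat + nat \<times> config_bit) set" where
    "S k = (case k of
        Inl (0, v) \<Rightarrow> insert (Inr (0, v)) (Inl ` d v)
      | Inl (Suc \<tau>, v) \<Rightarrow> insert (Inr (Suc \<tau>, v)) ((\<lambda>u. Inr (\<tau>, u)) ` neighbourhood M v)
      | Inr (i, b) \<Rightarrow> {Inr (T, Cell 0 (int i) b)})" for k
  \<comment> \<open>The transition constraint speaks of some valid configuration that agrees with
    row \<open>\<tau>\<close> on the neighbourhood. By \<open>tm_step_local\<close> all such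
    configurations give the same bit \<open>v\<close>, so no transition table has to be spelled
    out.\<close>
  define P :: "nat \<times> config_bit + nat \<times> bool \<Rightarrow> (nat + nat \<times> config_bit \<Rightarrow> bool) \<Rightarrow> bool" where
    "P k \<sigma> = (case k of
        Inl (0, v) \<Rightarrow> \<sigma> (Inr (0, v)) = config_bits (init_config M (fill ts (\<lambda>i. \<sigma> (Inl i)))) v
      | Inl (Suc \<tau>, v) \<Rightarrow> (\<exists>c. valid_config M c \<and>
          (\<forall>u \<in> neighbourhood M v. \<sigma> (Inr (\<tau>, u)) = config_bits c u) \<and>
          \<sigma> (Inr (Suc \<tau>, v)) = config_bits (tm_step M c) v)
      | Inr (i, b) \<Rightarrow> \<sigma> (Inr (T, Cell 0 (int i) b)) = target_bit y i b)" for k \<sigma>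
  have nb: "neighbourhood M v \<subseteq> C \<tau>" if "v \<in> C (Suc \<tau>)" "Suc \<tau> \<le> T" for v \<tau>
  proof -
    have "Suc (length y + (T - Suc \<tau>)) = length y + (T - \<tau>)" using that(2) by simp
    then show ?thesis using neighbourhood_subset_cone that(1) unfolding C_def by metis
  qed
  have out: "Cell 0 (int i) b \<in> C T" if "i \<le> length y" for i b
    using that k0 by (simp add: C_def)
  have I_cases: "(\<exists>v. k = Inl (0, v) \<and> v \<in> C 0) \<or>
      (\<exists>\<tau> v. k = Inl (Suc \<tau>, v) \<and> Suc \<tau> \<le> T \<and> v \<in> C (Suc \<tau>)) \<or>
      (\<exists>i b. k = Inr (i, b) \<and> i \<le> length y)" if "k \<in> I" for k
  proof -
    from that consider \<tau> v where "k = Inl (\<tau>, v)" "\<tau> \<le> T" "v \<in> C \<tau>"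
      | i b where "k = Inr (i, b)" "i \<le> length y"
      unfolding I_def Z_def by blast
    then show ?thesis
    proof cases
      case 1
      then show ?thesis by (cases \<tau>) auto
    qed blast
  qed
  have loc: "depends_on (P k) (S k) \<and> S k \<subseteq> Inl ` {..<D} \<union> Inr ` Z \<and> card (S k) \<le> r"
    if "k \<in> I" for k
    using I_cases[OF that]
  proof (elim disjE exE conjE)
    fix v assume k: "k = Inl (0, v)" and v: "v \<in> C 0"
    have "depends_on (P k) (S k)"
      unfolding depends_on_def
    proof (intro allI impI)
      fix \<sigma> \<tau> :: "nat + nat \<times> config_bit \<Rightarrow> bool" assume eq: "\<forall>v \<in> S k. \<sigma> v = \<tau> v"
      have "config_bits (init_config M (fill ts (\<lambda>i. \<sigma> (Inl i)))) v =
          config_bits (init_config M (fill ts (\<lambda>i. \<tau> (Inl i)))) v"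
        by (rule d(4)[OF v]) (use eq in \<open>simp add: S_def k\<close>)
      then show "P k \<sigma> = P k \<tau>" using eq by (simp add: P_def S_def k)
    qed
    moreover have "S k \<subseteq> Inl ` {..<D} \<union> Inr ` Z"
      using d(3)[OF v] v by (auto simp: S_def k Z_def)
    moreover have "card (S k) \<le> r"
    proof -
      have "card (S k) \<le> Suc (card (Inl ` d v :: (nat + nat \<times> config_bit) set))"
        unfolding S_def k by (simp add: card_insert_le_m1)
      also have "\<dots> \<le> Suc (card (d v))" using card_image_le[OF d(1)[OF v]] by simp
      finally show ?thesis using d(2)[OF v] by (simp add: r_def)
    qed
    ultimately show ?thesis by blast
  next
    fix \<tau> v assume k: "k = Inl (Suc \<tau>, v)" and v: "Suc \<tau> \<le> T" "v \<in> C (Suc \<tau>)"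
    have "depends_on (P k) (S k)"
      by (simp add: depends_on_def P_def S_def k)
    moreover have "S k \<subseteq> Inl ` {..<D} \<union> Inr ` Z"
      using nb[OF v(2,1)] v by (auto simp: S_def k Z_def)
    moreover have "card (S k) \<le> r"
    proof -
      have "card (S k) \<le> Suc (card ((\<lambda>u. Inr (\<tau>, u)) ` neighbourhood M v :: (nat + nat \<times> config_bit) set))"
        unfolding S_def k by (simp add: card_insert_le_m1)
      also have "\<dots> \<le> Suc (card (neighbourhood M v))"
        using card_image_le[OF finite_neighbourhood] by simp
      finally show ?thesis using card_neighbourhood[of M v] by (simp add: r_def)
    qed
    ultimately show ?thesis by blast
  next
    fix i b assume k: "k = Inr (i, b)" and i: "i \<le> length y"
    show ?thesis
      using out[OF i] by (auto simp: depends_on_def P_def S_def k r_def Z_def)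
  qed
  have "cnf_definable n (D + card Z + card I * 2 ^ r + 1)
      {x. length x = n \<and> (\<exists>\<sigma>. (\<forall>i < n. \<sigma> (Inl i) = x ! i) \<and> (\<forall>k \<in> I. P k \<sigma>))}"
    by (rule cnf_definable_of_constraints[where S = S]) (use loc \<open>finite I\<close> \<open>finite Z\<close> \<open>n \<le> D\<close> in auto)
  moreover have "(\<exists>\<sigma>. (\<forall>i < n. \<sigma> (Inl i) = x ! i) \<and> (\<forall>k \<in> I. P k \<sigma>)) \<longleftrightarrow>
      (\<exists>\<rho>. (\<forall>i < n. \<rho> i = x ! i) \<and>
       tape_reads (hd (snd ((tm_step M ^^ T) (init_config M (fill ts \<rho>))))) y)" for x
  proof
    assume "\<exists>\<sigma>. (\<forall>i < n. \<sigma> (Inl i) = x ! i) \<and> (\<forall>k \<in> I. P k \<sigma>)"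
    then obtain \<sigma> where \<sigma>: "\<forall>i < n. \<sigma> (Inl i) = x ! i" and P: "\<forall>k \<in> I. P k \<sigma>" by blast
    define c0 where "c0 = init_config M (fill ts (\<lambda>i. \<sigma> (Inl i)))"
    have row: "\<sigma> (Inr (\<tau>, v)) = config_bits ((tm_step M ^^ \<tau>) c0) v" if "\<tau> \<le> T" "v \<in> C \<tau>" for \<tau> v
      using that
    proof (induction \<tau> arbitrary: v)
      case 0
      then have "P (Inl (0, v)) \<sigma>" using P by (simp add: I_def Z_def)
      then show ?case by (simp add: P_def c0_def)
    next
      case (Suc \<tau>)
      then have "P (Inl (Suc \<tau>, v)) \<sigma>" using P by (simp add: I_def Z_def)
      then obtain c where c: "valid_config M c"
          "\<And>u. u \<in> neighbourhood M v \<Longrightarrow> \<sigma> (Inr (\<tau>, u)) = config_bits c u"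
          "\<sigma> (Inr (Suc \<tau>, v)) = config_bits (tm_step M c) v"
        by (auto simp: P_def)
      have "config_bits (tm_step M c) v = config_bits (tm_step M ((tm_step M ^^ \<tau>) c0)) v"
      proof (rule tm_step_local[OF c(1) _ M])
        show "valid_config M ((tm_step M ^^ \<tau>) c0)"
          unfolding c0_def using M by (intro valid_tm_steps valid_init_config)
        show "config_bits c u = config_bits ((tm_step M ^^ \<tau>) c0) u" if "u \<in> neighbourhood M v" for u
          using Suc.IH[of u] nb[OF Suc.prems(2,1)] that c(2)[OF that] Suc.prems(1) by auto
        show "j < num_tapes M" if "v = Cell j i b" for j i b
          using Suc.prems(2) that by (simp add: C_def)
      qed
      with c(3) show ?case by simp
    qed
    have "snd ((tm_step M ^^ T) c0) \<noteq> []"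
      unfolding c0_def by (rule valid_config_tapes[OF M valid_tm_steps[OF M valid_init_config[OF M]]])
    moreover have "config_bits ((tm_step M ^^ T) c0) (Cell 0 (int i) b) = target_bit y i b"
      if "i \<le> length y" for i b
    proof -
      have "P (Inr (i, b)) \<sigma>" using P that by (simp add: I_def)
      then show ?thesis using row[OF _ out[OF that]] by (simp add: P_def)
    qed
    ultimately have "tape_reads (hd (snd ((tm_step M ^^ T) c0))) y"
      unfolding tape_reads_iff using target_bits_iff by blast
    then show "\<exists>\<rho>. (\<forall>i < n. \<rho> i = x ! i) \<and>
       tape_reads (hd (snd ((tm_step M ^^ T) (init_config M (fill ts \<rho>))))) y"
      using \<sigma> unfolding c0_def by (intro exI[of _ "\<lambda>i. \<sigma> (Inl i)"] conjI)
  next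
    assume "\<exists>\<rho>. (\<forall>i < n. \<rho> i = x ! i) \<and>
       tape_reads (hd (snd ((tm_step M ^^ T) (init_config M (fill ts \<rho>))))) y"
    then obtain \<rho> where \<rho>: "\<forall>i < n. \<rho> i = x ! i"
      and reads: "tape_reads (hd (snd ((tm_step M ^^ T) (init_config M (fill ts \<rho>))))) y" by blast
    define c0 where "c0 = init_config M (fill ts \<rho>)"
    define \<sigma> where "\<sigma> v = (case v of Inl i \<Rightarrow> \<rho> i | Inr (\<tau>, u) \<Rightarrow> config_bits ((tm_step M ^^ \<tau>) c0) u)" for v
    have valid: "valid_config M ((tm_step M ^^ \<tau>) c0)" for \<tau>
      unfolding c0_def using M by (intro valid_tm_steps valid_init_config)
    then have "snd ((tm_step M ^^ T) c0) \<noteq> []"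
      using valid_config_tapes[OF M] by blast
    then have final: "config_bits ((tm_step M ^^ T) c0) (Cell 0 (int i) b) = target_bit y i b"
      if "i \<le> length y" for i b
      using reads that target_bits_iff unfolding tape_reads_iff c0_def by blast
    have "P k \<sigma>" if "k \<in> I" for k
      using I_cases[OF that]
    proof (elim disjE exE conjE)
      fix v assume "k = Inl (0, v)"
      then show ?thesis by (simp add: P_def \<sigma>_def c0_def)
    next
      fix \<tau> v assume "k = Inl (Suc \<tau>, v)"
      then have "P k \<sigma> \<longleftrightarrow> (\<exists>c. valid_config M c \<and>
          (\<forall>u \<in> neighbourhood M v. config_bits ((tm_step M ^^ \<tau>) c0) u = config_bits c u) \<and>
          config_bits (tm_step M ((tm_step M ^^ \<tau>) c0)) v = config_bits (tm_step M c) v)"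
        by (simp add: P_def \<sigma>_def)
      then show ?thesis using valid[of \<tau>] by blast
    next
      fix i b assume "k = Inr (i, b)" "i \<le> length y"
      then show ?thesis using final by (simp add: P_def \<sigma>_def)
    qed
    then show "\<exists>\<sigma>. (\<forall>i < n. \<sigma> (Inl i) = x ! i) \<and> (\<forall>k \<in> I. P k \<sigma>)"
      using \<rho> by (intro exI[of _ \<sigma>]) (simp add: \<sigma>_def)
  qed
  moreover have "D + card Z + card I * 2 ^ r + 1 \<le>
      D + Suc T * K + (Suc T * K + Suc (length y) * 2) * 2 ^ r + 1"
    using cardZ cardI by (intro add_mono mult_le_mono) auto
  ultimately show ?thesis
    unfolding tableau_size_def Let_def K_def[symmetric] r_def[symmetric] using cnf_definable_mono by simp
qed

section \<open>Formulas for languages in NP\<close>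

lemma tape_reads_unique:
  assumes "tape_reads t y" "tape_reads t z"
  shows "y = z"
proof -
  have "length z \<le> length y" if "tape_reads t y" "tape_reads t z" for y z
  proof (rule ccontr)
    assume "\<not> length z \<le> length y"
    with that show False unfolding tape_reads_def by (metis linorder_not_le option.distinct(1))
  qed
  then have "length y = length z" using assms by (meson le_antisym)
  moreover have "y ! i = z ! i" if "i < length y" for i
    using assms that calculation unfolding tape_reads_def by (metis option.inject)
  ultimately show ?thesis by (rule nth_equalityI)
qed

lemma fill_append: "fill (ts @ us) \<rho> = fill ts \<rho> @ fill us \<rho>"
  by (simp add: fill_def)

text \<open>A tableau has a fixed number of rows and a fixed input length, so every witness length
  \<open>l\<close> gets its own formula, and these polynomially many formulas are united.\<close>

lemma small_cnfs_NP:
  assumes "L \<in> class_NP"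
  shows "small_cnfs L"
proof -
  obtain V q where "V \<in> class_P"
    and L: "\<And>x. x \<in> L \<longleftrightarrow> (\<exists>w. length w \<le> poly q (length x) \<and> pair_enc x w \<in> V)"
    using assms unfolding class_NP_def by blast
  then obtain M p where M: "wf_tm M" and run: "\<And>x. computes_within M x (poly p (length x)) [x \<in> V]"
    unfolding class_P_def by blast
  define ts :: "nat \<Rightarrow> nat \<Rightarrow> template" where
    "ts n l = concat (map (\<lambda>i. [(0, \<lambda>_. True), (i, \<lambda>b. b)]) [0..<n]) @ [(0, \<lambda>_. False)] @
      map (\<lambda>j. (n + j, \<lambda>b. b)) [0..<l]" for n l
  have fill_ts: "fill (ts n l) \<rho> = pair_enc (map \<rho> [0..<n]) (map (\<lambda>j. \<rho> (n + j)) [0..<l])" for n l \<rho>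
    by (simp add: ts_def fill_def pair_enc_def self_delim_def map_concat comp_def)
  \<comment> \<open>Constant entries refer to bit 0, which the bound \<open>Suc (n + l)\<close>
    makes legal even for \<open>n = l = 0\<close>.\<close>
  have ts_dom: "\<forall>(d, g) \<in> set (ts n l). d < Suc (n + l)" for n l
    by (auto simp: ts_def)
  have accepts: "tape_reads (hd (snd ((tm_step M ^^ poly p (length z)) (init_config M z)))) [True] \<longleftrightarrow> z \<in> V" for z
    using run[of z] tape_reads_unique unfolding computes_within_def Let_def by fastforce
  define A where "A n l = {x. length x = n \<and> (\<exists>\<rho>. (\<forall>i < n. \<rho> i = x ! i) \<and>
       tape_reads (hd (snd ((tm_step M ^^ poly p (2 * n + 1 + l)) (init_config M (fill (ts n l) \<rho>))))) [True])}" for n l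
  have A_iff: "x \<in> A n l \<longleftrightarrow> length x = n \<and> (\<exists>w. length w = l \<and> pair_enc x w \<in> V)" for x n l
  proof -
    have "tape_reads (hd (snd ((tm_step M ^^ poly p (2 * n + 1 + l)) (init_config M (fill (ts n l) \<rho>))))) [True]
        \<longleftrightarrow> pair_enc (map \<rho> [0..<n]) (map (\<lambda>j. \<rho> (n + j)) [0..<l]) \<in> V" for \<rho>
      using accepts[of "fill (ts n l) \<rho>"] by (simp add: fill_ts pair_enc_def length_self_delim)
    then have "x \<in> A n l \<longleftrightarrow> length x = n \<and> (\<exists>\<rho>. (\<forall>i < n. \<rho> i = x ! i) \<and>
        pair_enc (map \<rho> [0..<n]) (map (\<lambda>j. \<rho> (n + j)) [0..<l]) \<in> V)"
      by (simp add: A_def)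
    also have "\<dots> \<longleftrightarrow> length x = n \<and> (\<exists>w. length w = l \<and> pair_enc x w \<in> V)"
    proof (intro conj_cong refl iffI)
      assume n: "length x = n" and "\<exists>\<rho>. (\<forall>i < n. \<rho> i = x ! i) \<and>
        pair_enc (map \<rho> [0..<n]) (map (\<lambda>j. \<rho> (n + j)) [0..<l]) \<in> V"
      then obtain \<rho> where \<rho>: "\<forall>i < n. \<rho> i = x ! i"
        "pair_enc (map \<rho> [0..<n]) (map (\<lambda>j. \<rho> (n + j)) [0..<l]) \<in> V" by blast
      have "map \<rho> [0..<n] = x" using n \<rho>(1) by (intro nth_equalityI) auto
      with \<rho>(2) show "\<exists>w. length w = l \<and> pair_enc x w \<in> V"
        by (intro exI[of _ "map (\<lambda>j. \<rho> (n + j)) [0..<l]"]) simp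
    next
      assume n: "length x = n" and "\<exists>w. length w = l \<and> pair_enc x w \<in> V"
      then obtain w where w: "length w = l" "pair_enc x w \<in> V" by blast
      have "map (\<lambda>i. (x @ w) ! i) [0..<n] = x" "map (\<lambda>j. (x @ w) ! (n + j)) [0..<l] = w"
        using n w(1) by (auto intro!: nth_equalityI simp: nth_append)
      with w(2) show "\<exists>\<rho>. (\<forall>i < n. \<rho> i = x ! i) \<and>
        pair_enc (map \<rho> [0..<n]) (map (\<lambda>j. \<rho> (n + j)) [0..<l]) \<in> V"
        using n by (intro exI[of _ "\<lambda>i. (x @ w) ! i"]) (auto simp: nth_append)
    qed
    finally show ?thesis .
  qed
  define B where "B n = tableau_size M (Suc (n + poly q n)) (poly p (2 * n + 1 + poly q n)) 1" for n
  have def_A: "cnf_definable n (B n) (A n l)" if "l \<le> poly q n" for n l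
  proof -
    have "cnf_definable n (tableau_size M (Suc (n + l)) (poly p (2 * n + 1 + l)) 1) (A n l)"
      unfolding A_def using cook_levin[OF M ts_dom, of n n l "poly p (2 * n + 1 + l)" "[True]"] by simp
    moreover have "tableau_size M (Suc (n + l)) (poly p (2 * n + 1 + l)) 1 \<le> B n"
      unfolding B_def using that by (intro tableau_size_mono poly_nat_mono) auto
    ultimately show ?thesis by (rule cnf_definable_mono)
  qed
  define f where "f n = B n + Suc (poly q n) * B n + Suc (poly q n) + 1" for n
  have "poly_bounded B"
    unfolding B_def
    by (intro poly_bounded_tableau_size poly_bounded_Suc poly_bounded_add poly_bounded_poly
        poly_bounded_mult poly_bounded_const poly_bounded_id)
  then have "poly_bounded f"
    unfolding f_def
    by (intro poly_bounded_Suc poly_bounded_add poly_bounded_poly poly_bounded_mult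
        poly_bounded_const poly_bounded_id)
  moreover have "cnf_definable n (f n) {x \<in> L. length x = n}" for n
  proof -
    have "n \<le> B n" using def_A[of 0 n] unfolding cnf_definable_def by simp
    then have "cnf_definable n (f n) (\<Union>l \<in> {..poly q n}. A n l)"
      unfolding f_def using cnf_definable_Union[of "{..poly q n}" n "B n" "A n"] def_A by simp
    also have "(\<Union>l \<in> {..poly q n}. A n l) = {x \<in> L. length x = n}"
      by (auto simp: A_iff L Bex_def) blast
    finally show ?thesis .
  qed
  ultimately show ?thesis unfolding small_cnfs_def by blast
qed

section \<open>Vertex cover as subset feedback vertex set\<close>

lemma self_delim_append_inject:
  "self_delim x @ u = self_delim y @ v \<Longrightarrow> x = y \<and> u = v"
proof (induction x arbitrary: y)
  case Nil
  then show ?case by (cases y) (auto simp: self_delim_def)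
next
  case (Cons a x)
  then show ?case by (cases y) (auto simp: self_delim_def)
qed

lemma bin_inject: "bin m = bin n \<Longrightarrow> m = n"
proof (induction m arbitrary: n rule: less_induct)
  case (less m)
  show ?case
  proof (cases "m = 0 \<or> n = 0")
    case True
    then show ?thesis using less.prems by (auto simp: bin.simps[of m] bin.simps[of n] split: if_splits)
  next
    case False
    then have "odd m = odd n" "bin (m div 2) = bin (n div 2)"
      using less.prems by (auto simp: bin.simps[of m] bin.simps[of n])
    moreover have "m div 2 = n div 2"
      using False calculation(2) by (intro less.IH) auto
    ultimately show ?thesis by (metis odd_two_times_div_two_succ even_two_times_div_two)
  qed
qed

lemma edge_code_inject:
  "concat (map (\<lambda>(u, v). self_delim (bin u) @ self_delim (bin v)) xs) =
   concat (map (\<lambda>(u, v). self_delim (bin u) @ self_delim (bin v)) ys) \<Longrightarrow> xs = ys"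
proof (induction xs arbitrary: ys)
  case Nil
  then show ?case by (cases ys) (auto simp: self_delim_def)
next
  case (Cons e xs)
  show ?case
  proof (cases ys)
    case Nil
    then show ?thesis using Cons.prems by (cases e) (simp add: self_delim_def)
  next
    case (Cons e' ys')
    obtain u v u' v' where e: "e = (u, v)" "e' = (u', v')" by fastforce
    from Cons.prems have eq: "self_delim (bin u) @ (self_delim (bin v) @ concat (map (\<lambda>(u, v). self_delim (bin u) @ self_delim (bin v)) xs)) =
      self_delim (bin u') @ (self_delim (bin v') @ concat (map (\<lambda>(u, v). self_delim (bin u) @ self_delim (bin v)) ys'))"
      by (simp add: Cons e)
    note 1 = self_delim_append_inject[OF eq]
    note 2 = self_delim_append_inject[OF conjunct2[OF 1]]
    from 1 2 show ?thesis using Cons.IH[of ys'] by (auto simp: Cons e dest: bin_inject)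
  qed
qed

lemma set_edge_list:
  "(u, v) \<in> set (edge_list i) \<longleftrightarrow> u < num_vertices i \<and> v < num_vertices i \<and> u < v \<and> {u, v} \<in> edges i"
  by (auto simp: edge_list_def)

lemma edges_eq_edge_list:
  assumes "i \<in> sfvs_split_instances"
  shows "edges i = (\<lambda>(u, v). {u, v}) ` set (edge_list i)"
proof (intro equalityI subsetI)
  fix e assume e: "e \<in> edges i"
  then have "e \<subseteq> vertices i" "card e = 2"
    using assms by (auto simp: sfvs_split_instances_def split_graph_def simple_graph_def)
  then obtain u v where "e = {u, v}" "u \<noteq> v" by (auto simp: card_2_iff)
  then obtain u v where "e = {u, v}" "u < v" by (metis insert_commute nat_neq_iff)
  moreover have "(u, v) \<in> set (edge_list i)"
    using e \<open>e \<subseteq> vertices i\<close> calculation by (auto simp: set_edge_list)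
  ultimately show "e \<in> (\<lambda>(u, v). {u, v}) ` set (edge_list i)" by force
qed (auto simp: set_edge_list)

text \<open>Fibres will be formed by encoded kernel outputs; injectivity turns equal codes into
  equal instances and thus equal answers. Validity matters: edges that are not pairs of vertices, or
  terminals out of range, would leave no trace in the code.\<close>

lemma enc_sfvs_inject:
  assumes i: "i \<in> sfvs_split_instances" and j: "j \<in> sfvs_split_instances"
    and eq: "enc_sfvs i = enc_sfvs j"
  shows "i = j"
proof -
  note 1 = self_delim_append_inject[OF eq[unfolded enc_sfvs_def]]
  note 2 = self_delim_append_inject[OF conjunct2[OF 1]]
  have "budget i = budget j" using 1 bin_inject by blast
  moreover have nv: "num_vertices i = num_vertices j"
    using conjunct1[OF 2, THEN arg_cong[where f = length]] by simp
  moreover have "terminals i = terminals j"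
  proof -
    have "v \<in> terminals i \<longleftrightarrow> v \<in> terminals j" if "v < num_vertices i" for v
      using conjunct1[OF 2] that nv by (auto simp: map_eq_conv)
    then show ?thesis
      using i j nv by (auto simp: sfvs_split_instances_def)
  qed
  moreover have "edges i = edges j"
    using edge_code_inject[OF conjunct2[OF 2]] by (simp add: edges_eq_edge_list[OF i] edges_eq_edge_list[OF j])
  ultimately show ?thesis by (cases i; cases j) simp
qed

lemma length_bin: "length (bin n) \<le> n"
proof (induction n rule: less_induct)
  case (less n)
  show ?case
  proof (cases "n = 0")
    case False
    then have "length (bin n) \<le> Suc (n div 2)"
      using less.IH[of "n div 2"] by (simp add: bin.simps[of n])
    with False show ?thesis by linarith
  qed (simp add: bin.simps)
qed

section \<open>The split graph for vertex cover\<close>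

definition pair_vertex :: "nat \<Rightarrow> nat \<Rightarrow> nat \<Rightarrow> nat" where
  "pair_vertex N u v = N + (u * N + v)"

definition vc_edges :: "nat \<Rightarrow> nat set set" where
  "vc_edges N = {{u, v} |u v. u < v \<and> v < N} \<union> {{u, pair_vertex N u v} |u v. u < v \<and> v < N} \<union>
     {{v, pair_vertex N u v} |u v. u < v \<and> v < N}"

text \<open>A number is reserved for every ordered pair, row by row behind the clique; those with
  \<open>u \<ge> v\<close> stay isolated, which avoids numbering unordered pairs. \<open>R\<close>
  affects the terminals only.\<close>

definition vc_instance :: "nat \<Rightarrow> (nat \<Rightarrow> nat \<Rightarrow> bool) \<Rightarrow> nat \<Rightarrow> sfvs_instance" where
  "vc_instance N R k = \<lparr>num_vertices = N + N * N, edges = vc_edges N,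
     terminals = {pair_vertex N u v |u v. u < v \<and> v < N \<and> R u v}, budget = k\<rparr>"

lemma pair_vertex_inject: "v < N \<Longrightarrow> v' < N \<Longrightarrow> pair_vertex N u v = pair_vertex N u' v' \<longleftrightarrow> u = u' \<and> v = v'"
proof
  assume "v < N" "v' < N" "pair_vertex N u v = pair_vertex N u' v'"
  then have eq: "u * N + v = u' * N + v'" by (simp add: pair_vertex_def)
  have "(u * N + v) div N = u" "(u' * N + v') div N = u'" "(u * N + v) mod N = v" "(u' * N + v') mod N = v'"
    using \<open>v < N\<close> \<open>v' < N\<close> by auto
  with eq show "u = u' \<and> v = v'" by metis
qed simp

lemma pair_vertex_ge: "N \<le> pair_vertex N u v"
  by (simp add: pair_vertex_def)

lemma pair_vertex_less: "u < N \<Longrightarrow> v < N \<Longrightarrow> pair_vertex N u v < N + N * N"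
proof -
  assume *: "u < N" "v < N"
  then have "u * N + v < Suc u * N" by simp
  also have "\<dots> \<le> N * N" using * by (intro mult_le_mono1) simp
  finally show ?thesis by (simp add: pair_vertex_def)
qed

lemma pair_vertex_neighbour:
  assumes "{a, pair_vertex N u v} \<in> vc_edges N" "u < v" "v < N"
  shows "a = u \<or> a = v"
  using assms pair_vertex_ge[of N u v] unfolding vc_edges_def
  by (auto simp: doubleton_eq_iff pair_vertex_inject)

lemma vc_edgesI:
  assumes "u < v" "v < N"
  shows "{u, v} \<in> vc_edges N" "{u, pair_vertex N u v} \<in> vc_edges N" "{v, pair_vertex N u v} \<in> vc_edges N"
  using assms unfolding vc_edges_def by blast+

lemma vc_instance_split: "vc_instance N R k \<in> sfvs_split_instances"
proof -
  have "simple_graph {0..<N + N * N} (vc_edges N)"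
    unfolding simple_graph_def
  proof (intro conjI ballI)
    fix e assume "e \<in> vc_edges N"
    then obtain u v where uv: "u < v" "v < N"
      and "e = {u, v} \<or> e = {u, pair_vertex N u v} \<or> e = {v, pair_vertex N u v}"
      unfolding vc_edges_def by blast
    moreover have "N \<le> pair_vertex N u v" "pair_vertex N u v < N + N * N"
      using uv by (auto intro: pair_vertex_ge pair_vertex_less)
    ultimately obtain a b where "e = {a, b}" "a < b" "b < N + N * N"
      by (metis less_le_trans less_trans trans_less_add1)
    then show "e \<subseteq> {0..<N + N * N}" "card e = 2" by auto
  qed simp
  moreover have "clique (vc_edges N) {0..<N}"
    unfolding clique_def
  proof (intro ballI impI)
    fix u v assume "u \<in> {0..<N}" "v \<in> {0..<N}" "u \<noteq> v"
    then show "{u, v} \<in> vc_edges N"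
      using vc_edgesI(1)[of u v N] vc_edgesI(1)[of v u N] by (cases "u < v") (auto simp: insert_commute)
  qed
  moreover have "independent (vc_edges N) {N..<N + N * N}"
    unfolding independent_def vc_edges_def by (auto simp: doubleton_eq_iff)
  ultimately have "split_graph {0..<N + N * N} (vc_edges N)"
    unfolding split_graph_def by (intro conjI exI[of _ "{0..<N}"] exI[of _ "{N..<N + N * N}"]) auto
  then show ?thesis
    using pair_vertex_less by (auto simp: sfvs_split_instances_def vc_instance_def)
qed

lemma is_cycle_triangle:
  assumes "distinct [a, b, c]" "{a, b, c} \<subseteq> V" "{a, b} \<in> E" "{b, c} \<in> E" "{c, a} \<in> E"
  shows "is_cycle V E [a, b, c]"
proof -
  have "{[a, b, c] ! i, [a, b, c] ! (Suc i mod 3)} \<in> E" if i: "i < 3" for i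
  proof -
    consider "i = 0" | "i = 1" | "i = 2" using i by linarith
    then show ?thesis using assms(3-5) by cases simp_all
  qed
  then show ?thesis using assms(1,2) by (simp add: is_cycle_def)
qed

text \<open>The predecessor and the successor of \<open>z\<close>; they differ because a cycle has
  at least three vertices.\<close>

lemma cycle_neighbours:
  assumes "is_cycle V E c" "z \<in> set c"
  obtains a b where "a \<noteq> b" "a \<in> set c" "b \<in> set c" "{a, z} \<in> E" "{z, b} \<in> E"
proof -
  let ?l = "length c"
  obtain i where i: "i < ?l" "z = c ! i" using assms(2) by (auto simp: in_set_conv_nth)
  have c: "?l \<ge> 3" "distinct c" "\<And>i. i < ?l \<Longrightarrow> {c ! i, c ! (Suc i mod ?l)} \<in> E"
    using assms(1) by (auto simp: is_cycle_def)
  define p where "p = (if i = 0 then ?l - 1 else i - 1)"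
  have p: "p < ?l" "Suc p mod ?l = i" using i(1) c(1) by (auto simp: p_def)
  have s: "Suc i mod ?l < ?l" using i(1) by (intro mod_less_divisor) auto
  have "p \<noteq> Suc i mod ?l"
    using i(1) c(1) by (cases "Suc i = ?l") (auto simp: p_def)
  then have "c ! p \<noteq> c ! (Suc i mod ?l)"
    using c(2) p(1) s by (simp add: nth_eq_iff_index_eq)
  then show thesis
    using that[of "c ! p" "c ! (Suc i mod ?l)"] c(3)[OF p(1)] c(3)[OF i(1)] p s i by simp
qed

definition vertex_cover :: "nat \<Rightarrow> (nat \<Rightarrow> nat \<Rightarrow> bool) \<Rightarrow> nat set \<Rightarrow> bool" where
  "vertex_cover N R C \<longleftrightarrow> C \<subseteq> {..<N} \<and> (\<forall>u v. u < v \<and> v < N \<and> R u v \<longrightarrow> u \<in> C \<or> v \<in> C)"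

text \<open>A terminal has only the neighbours \<open>u\<close> and \<open>v\<close>, so every cycle
  through it passes both, and a vertex cover contains one of them. Conversely, the terminal,
  \<open>u\<close> and \<open>v\<close> form a triangle that a solution must hit, and a deleted
  independent vertex can be exchanged for an endpoint of its pair.\<close>

lemma vc_instance_yes_iff:
  "vc_instance N R k \<in> yes_instances subset_fvs_split \<longleftrightarrow> (\<exists>C. vertex_cover N R C \<and> card C \<le> k)"
proof -
  let ?V = "{0..<N + N * N}" and ?T = "{pair_vertex N u v |u v. u < v \<and> v < N \<and> R u v}"
  have "vc_instance N R k \<in> yes_instances subset_fvs_split \<longleftrightarrow>
      (\<exists>S. subset_fvs ?V (vc_edges N) ?T S \<and> card S \<le> k)"
    using vc_instance_split[of N R k] by (simp add: subset_fvs_split_def) (simp add: vc_instance_def)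
  also have "\<dots> \<longleftrightarrow> (\<exists>C. vertex_cover N R C \<and> card C \<le> k)"
  proof
    assume "\<exists>S. subset_fvs ?V (vc_edges N) ?T S \<and> card S \<le> k"
    then obtain S where S: "S \<subseteq> ?V" "\<not> has_T_cycle (?V - S) {e \<in> vc_edges N. e \<inter> S = {}} ?T" "card S \<le> k"
      unfolding subset_fvs_def by blast
    \<comment> \<open>The exchange: the division recovers the first coordinate of a pair
      vertex.\<close>
    define f where "f z = (if z < N then z else (z - N) div N)" for z
    have fin: "finite S" using S(1) finite_subset by blast
    have "vertex_cover N R (f ` S)"
      unfolding vertex_cover_def
    proof (intro conjI allI impI)
      show "f ` S \<subseteq> {..<N}"
      proof
        fix y assume "y \<in> f ` S"
        then obtain z where z: "z \<in> S" "y = f z" by blast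
        show "y \<in> {..<N}"
        proof (cases "z < N")
          case False
          then have "z - N < N * N" using z(1) S(1) by auto
          then show ?thesis using False z(2) by (simp add: f_def less_mult_imp_div_less)
        qed (simp add: z(2) f_def)
      qed
      fix u v assume uv: "u < v \<and> v < N \<and> R u v"
      let ?z = "pair_vertex N u v"
      have "u \<in> S \<or> v \<in> S \<or> ?z \<in> S"
      proof (rule ccontr)
        assume no: "\<not> (u \<in> S \<or> v \<in> S \<or> ?z \<in> S)"
        have "{u, v} \<in> vc_edges N" "{v, ?z} \<in> vc_edges N" "{?z, u} \<in> vc_edges N"
          using uv vc_edgesI by (auto simp: insert_commute)
        then have "is_cycle (?V - S) {e \<in> vc_edges N. e \<inter> S = {}} [u, v, ?z]"
          using uv no pair_vertex_ge[of N u v] pair_vertex_less[of u N v]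
          by (intro is_cycle_triangle) auto
        moreover have "set [u, v, ?z] \<inter> ?T \<noteq> {}" using uv by auto
        ultimately show False using S(2) unfolding has_T_cycle_def by blast
      qed
      moreover have "f u = u" "f v = v" "f ?z = u"
        using uv by (auto simp: f_def pair_vertex_def)
      ultimately show "u \<in> f ` S \<or> v \<in> f ` S" by (metis imageI)
    qed
    moreover have "card (f ` S) \<le> k" using card_image_le[OF fin, of f] S(3) by linarith
    ultimately show "\<exists>C. vertex_cover N R C \<and> card C \<le> k" by blast
  next
    assume "\<exists>C. vertex_cover N R C \<and> card C \<le> k"
    then obtain C where C: "C \<subseteq> {..<N}" "\<And>u v. u < v \<Longrightarrow> v < N \<Longrightarrow> R u v \<Longrightarrow> u \<in> C \<or> v \<in> C" "card C \<le> k"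
      unfolding vertex_cover_def by blast
    have "\<not> has_T_cycle (?V - C) {e \<in> vc_edges N. e \<inter> C = {}} ?T"
    proof
      assume "has_T_cycle (?V - C) {e \<in> vc_edges N. e \<inter> C = {}} ?T"
      then obtain c u v where c: "is_cycle (?V - C) {e \<in> vc_edges N. e \<inter> C = {}} c"
          "pair_vertex N u v \<in> set c" and uv: "u < v" "v < N" "R u v"
        unfolding has_T_cycle_def by blast
      obtain a b where ab: "a \<noteq> b" "a \<in> set c" "b \<in> set c"
          "{a, pair_vertex N u v} \<in> {e \<in> vc_edges N. e \<inter> C = {}}"
          "{pair_vertex N u v, b} \<in> {e \<in> vc_edges N. e \<inter> C = {}}"
        by (rule cycle_neighbours[OF c])
      have "a = u \<or> a = v" "b = u \<or> b = v"
        using ab(4,5) uv pair_vertex_neighbour[of _ N u v] by (auto simp: insert_commute)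
      with ab(1-3) have "u \<in> set c" "v \<in> set c" by auto
      with c(1) have "u \<notin> C" "v \<notin> C" by (auto simp: is_cycle_def)
      with C(2) uv show False by blast
    qed
    moreover have "C \<subseteq> ?V" using C(1) by auto
    ultimately show "\<exists>S. subset_fvs ?V (vc_edges N) ?T S \<and> card S \<le> k"
      using C(3) unfolding subset_fvs_def by blast
  qed
  finally show ?thesis .
qed

section \<open>Covering by fibres\<close>

lemma card_short_words: "card {y :: bool list. length y < t} \<le> 2 ^ t" "finite {y :: bool list. length y < t}"
proof -
  have "finite {y :: bool list. length y < t} \<and> card {y :: bool list. length y < t} \<le> 2 ^ t"
  proof (induction t)
    case (Suc t)
    have eq: "{y :: bool list. length y < Suc t} = {y. length y < t} \<union> {y. set y \<subseteq> UNIV \<and> length y = t}"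
      by auto
    have "card {y :: bool list. set y \<subseteq> UNIV \<and> length y = t} = 2 ^ t"
      by (subst card_lists_length_eq) auto
    moreover have "finite {y :: bool list. set y \<subseteq> UNIV \<and> length y = t}"
      by (rule finite_lists_length_eq) simp
    ultimately show ?case
      unfolding eq using Suc card_Un_le[of "{y :: bool list. length y < t}" "{y. set y \<subseteq> UNIV \<and> length y = t}"]
      by (intro conjI finite_UnI) auto
  qed simp
  then show "card {y :: bool list. length y < t} \<le> 2 ^ t" "finite {y :: bool list. length y < t}" by auto
qed

definition tuples :: "'a set \<Rightarrow> nat \<Rightarrow> 'a list set" where
  "tuples A t = {xs. set xs \<subseteq> A \<and> length xs = t}"

lemma tuples_mono: "A \<subseteq> B \<Longrightarrow> tuples A t \<subseteq> tuples B t"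
  by (auto simp: tuples_def)

lemma finite_tuples: "finite A \<Longrightarrow> finite (tuples A t)"
  by (simp add: tuples_def finite_lists_length_eq)

lemma card_tuples: "finite A \<Longrightarrow> card (tuples A t) = card A ^ t"
  by (simp add: tuples_def card_lists_length_eq)

text \<open>
  Were every fibre supported on fewer than half of the elements, each would contain fewer than a
  \<open>2\<^sup>-\<^sup>t\<close> fraction of the tuples.
\<close>

lemma large_fibre_support:
  assumes "finite A" "A \<noteq> {}" "t > 0" "card (f ` tuples A t) \<le> 2 ^ t"
  obtains y where "y \<in> f ` tuples A t"
    "card A \<le> 2 * card {x \<in> A. \<exists>xs \<in> tuples A t. f xs = y \<and> x \<in> set xs}"
proof (rule ccontr)
  assume no: "\<not> thesis"
  define Y where "Y = f ` tuples A t"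
  define S where "S y = {x \<in> A. \<exists>xs \<in> tuples A t. f xs = y \<and> x \<in> set xs}" for y
  have small: "2 * card (S y) < card A" if "y \<in> Y" for y
    using no that \<open>\<And>y. y \<in> f ` tuples A t \<Longrightarrow> card A \<le> 2 * card {x \<in> A. \<exists>xs \<in> tuples A t. f xs = y \<and> x \<in> set xs} \<Longrightarrow> thesis\<close>
    unfolding S_def Y_def by (meson not_le)
  have finY: "finite Y" unfolding Y_def using finite_tuples[OF assms(1)] by simp
  have fib: "card {xs \<in> tuples A t. f xs = y} \<le> card (S y) ^ t" for y
  proof -
    have "finite (S y)" using assms(1) by (simp add: S_def)
    moreover have "{xs \<in> tuples A t. f xs = y} \<subseteq> tuples (S y) t"
      by (auto simp: tuples_def S_def)
    ultimately show ?thesis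
      using card_mono[OF finite_tuples] card_tuples by metis
  qed
  have "tuples A t \<noteq> {}"
  proof -
    obtain a where "a \<in> A" using assms(2) by blast
    then have "replicate t a \<in> tuples A t" by (auto simp: tuples_def)
    then show ?thesis by blast
  qed
  then have "Y \<noteq> {}" by (simp add: Y_def)
  have "tuples A t = (\<Union>y \<in> Y. {xs \<in> tuples A t. f xs = y})" by (auto simp: Y_def)
  then have "card A ^ t \<le> (\<Sum>y \<in> Y. card {xs \<in> tuples A t. f xs = y})"
    using card_UN_le[OF finY, of "\<lambda>y. {xs \<in> tuples A t. f xs = y}"] card_tuples[OF assms(1), of t] by metis
  also have "\<dots> \<le> (\<Sum>y \<in> Y. card (S y) ^ t)" by (rule sum_mono) (rule fib)
  finally have "2 ^ t * card A ^ t \<le> (\<Sum>y \<in> Y. (2 * card (S y)) ^ t)"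
    by (simp add: power_mult_distrib flip: sum_distrib_left)
  also have "\<dots> < (\<Sum>y \<in> Y. card A ^ t)"
    using finY \<open>Y \<noteq> {}\<close> small \<open>t > 0\<close> by (intro sum_strict_mono power_strict_mono) auto
  also have "\<dots> \<le> 2 ^ t * card A ^ t"
    using assms(4) by (simp add: Y_def)
  finally show False by simp
qed

text \<open>Each image disposes of at least half of what remains, so \<open>r\<close> of them
  exhaust fewer than \<open>2 ^ r\<close> elements. The next image is sought among tuples over the
  remainder only, where the bound on the number of images is inherited from
  \<open>A\<close>.\<close>

lemma tuple_covering:
  assumes "finite A" "t > 0" "card (f ` tuples A t) \<le> 2 ^ t"
    and "A' \<subseteq> A" "card A' < 2 ^ r"
  shows "\<exists>Y. finite Y \<and> card Y \<le> r \<and> Y \<subseteq> f ` tuples A t \<and>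
    (\<forall>x \<in> A'. \<exists>y \<in> Y. \<exists>xs \<in> tuples A t. f xs = y \<and> x \<in> set xs)"
  using assms(4,5)
proof (induction r arbitrary: A')
  case 0
  then have "A' = {}" using assms(1) finite_subset by fastforce
  then show ?case by (intro exI[of _ "{}"]) auto
next
  case (Suc r)
  have fin: "finite A'" using Suc.prems(1) assms(1) finite_subset by blast
  show ?case
  proof (cases "A' = {}")
    case False
    have sub: "tuples A' t \<subseteq> tuples A t" by (rule tuples_mono[OF Suc.prems(1)])
    have "card (f ` tuples A' t) \<le> card (f ` tuples A t)"
      by (rule card_mono) (use sub finite_tuples[OF assms(1)] in auto)
    then have le: "card (f ` tuples A' t) \<le> 2 ^ t" using assms(3) by linarith
    obtain y where y: "y \<in> f ` tuples A' t"
      "card A' \<le> 2 * card {x \<in> A'. \<exists>xs \<in> tuples A' t. f xs = y \<and> x \<in> set xs}"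
      using large_fibre_support[OF fin False assms(2) le] .
    define S where "S = {x \<in> A'. \<exists>xs \<in> tuples A' t. f xs = y \<and> x \<in> set xs}"
    have "card (A' - S) = card A' - card S"
      by (rule card_Diff_subset) (use fin in \<open>auto simp: S_def\<close>)
    then have "card (A' - S) < 2 ^ r" using y(2) Suc.prems(2) unfolding S_def[symmetric] by simp
    then obtain Y where Y: "finite Y" "card Y \<le> r" "Y \<subseteq> f ` tuples A t"
        "\<forall>x \<in> A' - S. \<exists>y \<in> Y. \<exists>xs \<in> tuples A t. f xs = y \<and> x \<in> set xs"
      using Suc.IH[of "A' - S"] Suc.prems(1) by blast
    show ?thesis
    proof (intro exI[of _ "insert y Y"] conjI ballI)
      show "card (insert y Y) \<le> Suc r" using Y(1,2) by (simp add: card_insert_if)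
      show "insert y Y \<subseteq> f ` tuples A t" using Y(3) y(1) sub by blast
      fix x assume "x \<in> A'"
      show "\<exists>y \<in> insert y Y. \<exists>xs \<in> tuples A t. f xs = y \<and> x \<in> set xs"
      proof (cases "x \<in> S")
        case True
        then show ?thesis using sub unfolding S_def by blast
      next
        case False
        then show ?thesis using Y(4) \<open>x \<in> A'\<close> by blast
      qed
    qed (use Y in auto)
  qed (intro exI[of _ "{}"], auto)
qed

section \<open>Packing many inputs into one graph\<close>

text \<open>
  There are \<open>s\<close> row copies (first component \<open>False\<close>) and \<open>s\<close> column copies (\<open>True\<close>) of the literal
  occurrences \<open>(i, l)\<close> of the formula. A set of twice as many pairwise compatible vertices as there
  are clauses consists of one literal per clause in one row copy \<open>p\<close> and of the same choice in one
  column copy \<open>q\<close>. All constraints, including the one by the input \<open>X p q\<close>, are put between rows and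
  columns, so that \<open>s\<^sup>2\<close> inputs share \<open>2 s\<close> copies.
\<close>

type_synonym choice_vertex = "bool \<times> nat \<times> nat \<times> (nat \<times> bool)"

text \<open>Consistency between different clauses is tested across the sides as well: both copies
  make the same choice, so comparing clause \<open>i\<close> in the row with clause
  \<open>i'\<close> in the column suffices. \<open>X\<close> takes the row first, whence the swap if
  \<open>a\<close> holds.\<close>

fun compatible :: "nat \<Rightarrow> nat clause list \<Rightarrow> (nat \<Rightarrow> nat \<Rightarrow> bool list) \<Rightarrow>
    choice_vertex \<Rightarrow> choice_vertex \<Rightarrow> bool" where
  "compatible n cs X (a, p, i, l) (a', p', i', l') =
     (if a = a' then p = p' \<and> i \<noteq> i'
      else l \<in> cs ! i \<and> l' \<in> cs ! i' \<and>
        (if i = i' then l = l' \<and> (fst l < n \<longrightarrow> (if a then X p' p else X p p') ! fst l = snd l)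
         else fst l = fst l' \<longrightarrow> snd l = snd l'))"

lemma compatible_sym: "compatible n cs X v w = compatible n cs X w v"
  by (cases v; cases w) auto

definition choice_vertices :: "nat \<Rightarrow> nat \<Rightarrow> nat \<Rightarrow> choice_vertex set" where
  "choice_vertices s m B = UNIV \<times> {..<s} \<times> {..<m} \<times> ({..<B} \<times> UNIV)"

lemma card_choice_vertices: "card (choice_vertices s m B) = 4 * s * m * B"
  by (simp add: choice_vertices_def card_cartesian_product)

lemma finite_choice_vertices: "finite (choice_vertices s m B)"
  by (simp add: choice_vertices_def)

definition compatible_set :: "nat \<Rightarrow> nat clause list \<Rightarrow> (nat \<Rightarrow> nat \<Rightarrow> bool list) \<Rightarrow>
    choice_vertex set \<Rightarrow> bool" where
  "compatible_set n cs X J \<longleftrightarrow> (\<forall>v \<in> J. \<forall>w \<in> J. v \<noteq> w \<longrightarrow> compatible n cs X v w)"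

lemma satisfiable_imp_compatible_set:
  assumes vars: "\<forall>c \<in> set cs. fst ` c \<subseteq> {..<B}" and pq: "p < s" "q < s"
    and \<sigma>: "\<forall>i < n. \<sigma> i = X p q ! i" "satisfies \<sigma> (set cs)"
  shows "\<exists>J \<subseteq> choice_vertices s (length cs) B. card J = 2 * length cs \<and> compatible_set n cs X J"
proof -
  have "\<exists>l. l \<in> cs ! i \<and> \<sigma> (fst l) = snd l" if "i < length cs" for i
    using \<sigma>(2) nth_mem[OF that] unfolding satisfies_def by fastforce
  then obtain lit where lit: "\<And>i. i < length cs \<Longrightarrow> lit i \<in> cs ! i"
      "\<And>i. i < length cs \<Longrightarrow> \<sigma> (fst (lit i)) = snd (lit i)"
    by metis
  define g :: "bool \<times> nat \<Rightarrow> choice_vertex" where "g = (\<lambda>(a, i). (a, if a then q else p, i, lit i))"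
  define J where "J = g ` (UNIV \<times> {..<length cs})"
  have "inj g" by (auto simp: g_def inj_on_def)
  then have "card J = card ((UNIV :: bool set) \<times> {..<length cs})"
    unfolding J_def by (intro card_image) (auto simp: inj_on_def)
  then have "card J = 2 * length cs" by (simp add: card_cartesian_product)
  moreover have "J \<subseteq> choice_vertices s (length cs) B"
  proof
    fix v assume "v \<in> J"
    then obtain a i where v: "v = (a, if a then q else p, i, lit i)" "i < length cs"
      by (auto simp: J_def g_def)
    have "fst (lit i) < B" using vars lit(1)[OF v(2)] nth_mem[OF v(2)] by fastforce
    with v pq show "v \<in> choice_vertices s (length cs) B"
      by (cases "lit i") (simp add: choice_vertices_def)
  qed
  moreover have "compatible_set n cs X J"
    unfolding compatible_set_def
  proof (intro ballI impI)
    fix v w assume "v \<in> J" "w \<in> J" and ne: "v \<noteq> w"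
    then obtain a i b j where v: "v = (a, if a then q else p, i, lit i)" "i < length cs"
      and w: "w = (b, if b then q else p, j, lit j)" "j < length cs"
      by (auto simp: J_def g_def)
    show "compatible n cs X v w"
    proof (cases "a = b")
      case True
      then show ?thesis using ne v w by auto
    next
      case False
      have "(if a then X (if b then q else p) (if a then q else p)
          else X (if a then q else p) (if b then q else p)) = X p q" using False by auto
      moreover have "fst (lit i) = fst (lit j) \<Longrightarrow> snd (lit i) = snd (lit j)"
        using lit(2)[OF v(2)] lit(2)[OF w(2)] by metis
      moreover have "fst (lit i) < n \<Longrightarrow> X p q ! fst (lit i) = snd (lit i)"
        using lit(2)[OF v(2)] \<sigma>(1) by metis
      ultimately show ?thesis using False v w lit(1) by (cases b) auto
    qed
  qed
  ultimately show ?thesis by blast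
qed

text \<open>Vertices of one side share their copy and have distinct clauses, so a side has at most
  \<open>length cs\<close> of them. Hence both sides have exactly one per clause, and the cross
  constraints make the two choices equal, consistent and in accordance with the word
  \<open>X p q\<close>.\<close>

lemma compatible_set_imp_satisfiable:
  assumes J: "J \<subseteq> choice_vertices s (length cs) B" "2 * length cs \<le> card J" "compatible_set n cs X J"
    and "cs \<noteq> []"
  shows "\<exists>p < s. \<exists>q < s. \<exists>\<sigma>. (\<forall>i < n. \<sigma> i = X p q ! i) \<and> satisfies \<sigma> (set cs)"
proof -
  let ?m = "length cs"
  define side where "side a = {v \<in> J. fst v = a}" for a
  define clause_of :: "choice_vertex \<Rightarrow> nat" where "clause_of v = fst (snd (snd v))" for v
  have "finite J" using J(1) finite_choice_vertices finite_subset by blast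
  have comp: "compatible n cs X v w" if "v \<in> J" "w \<in> J" "v \<noteq> w" for v w
    using J(3) that unfolding compatible_set_def by blast
  have inj: "inj_on clause_of (side a)" for a
  proof (rule inj_onI, rule ccontr)
    fix v w assume "v \<in> side a" "w \<in> side a" "clause_of v = clause_of w" "v \<noteq> w"
    moreover from this obtain p i l p' l' where "v = (a, p, i, l)" "w = (a, p', i, l')"
      by (cases v; cases w) (simp add: side_def clause_of_def)
    ultimately show False using comp[of v w] by (simp add: side_def)
  qed
  have img: "clause_of ` side a \<subseteq> {..<?m}" for a
    using J(1) by (auto simp: side_def clause_of_def choice_vertices_def)
  have le: "card (side a) \<le> ?m" for a
    using card_mono[OF finite_lessThan img[of a]] card_image[OF inj[of a]] by simp
  have "J = side True \<union> side False" by (auto simp: side_def)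
  then have "card J \<le> card (side True) + card (side False)" by (metis card_Un_le)
  with J(2) le[of True] le[of False] have "card (side a) = ?m" for a by (cases a) auto
  then have onto: "clause_of ` side a = {..<?m}" for a
    using card_subset_eq[OF finite_lessThan img[of a]] card_image[OF inj[of a]] by simp
  have ex: "\<exists>p l. (a, p, i, l) \<in> J" if i: "i < ?m" for a i
  proof -
    have "i \<in> clause_of ` side a" using onto[of a] i by simp
    then obtain v where "v \<in> side a" "i = clause_of v" by blast
    moreover from this have "v = (a, fst (snd v), i, snd (snd (snd v)))"
      by (simp add: side_def clause_of_def prod_eq_iff)
    ultimately have "(a, fst (snd v), i, snd (snd (snd v))) \<in> J"
      by (metis (mono_tags, lifting) mem_Collect_eq side_def)
    then show ?thesis by blast
  qed
  have same: "p = p'" if "(a, p, i, l) \<in> J" "(a, p', i', l') \<in> J" for a p i l p' i' l'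
    using comp[OF that] by auto
  \<comment> \<open>Clause 0 exists, and its two vertices determine the copies \<open>p\<close> and
    \<open>q\<close>.\<close>
  have "0 < ?m" using \<open>cs \<noteq> []\<close> by simp
  then obtain p l0 q l1 where p0: "(False, p, 0, l0) \<in> J" and q0: "(True, q, 0, l1) \<in> J"
    using ex by metis
  have "p < s" "q < s" using p0 q0 J(1) by (auto simp: choice_vertices_def)
  have "\<exists>l. (False, p, i, l) \<in> J" if "i < ?m" for i
    using ex[OF that, of False] same[OF p0] by blast
  then obtain lit where lit: "\<And>i. i < ?m \<Longrightarrow> (False, p, i, lit i) \<in> J" by metis
  have "\<exists>l. (True, q, i, l) \<in> J" if "i < ?m" for i
    using ex[OF that, of True] same[OF q0] by blast
  then obtain lit' where lit': "\<And>i. i < ?m \<Longrightarrow> (True, q, i, lit' i) \<in> J" by metis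
  have eq: "lit i = lit' i" "lit i \<in> cs ! i" "fst (lit i) < n \<longrightarrow> X p q ! fst (lit i) = snd (lit i)"
    if "i < ?m" for i
    using comp[OF lit[OF that] lit'[OF that]] by auto
  have consistent: "snd (lit i) = snd (lit j)" if "i < ?m" "j < ?m" "fst (lit i) = fst (lit j)" for i j
    using comp[OF lit[OF that(1)] lit'[OF that(2)]] eq(1)[OF that(2)] that(3) by (cases "i = j") auto
  \<comment> \<open>Variables of the word take their values from it; any other variable is false
    unless it was chosen positively.\<close>
  define \<sigma> where "\<sigma> v = (if v < n then X p q ! v else \<exists>i < ?m. lit i = (v, True))" for v
  have true_lit: "\<sigma> (fst (lit i)) = snd (lit i)" if i: "i < ?m" for i
  proof (cases "fst (lit i) < n")
    case True
    then show ?thesis using eq(3)[OF i] by (simp add: \<sigma>_def)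
  next
    case False
    have "(\<exists>j < ?m. lit j = (fst (lit i), True)) \<longleftrightarrow> snd (lit i)"
    proof
      assume "\<exists>j < ?m. lit j = (fst (lit i), True)"
      then obtain j where j: "j < ?m" "lit j = (fst (lit i), True)" by blast
      then show "snd (lit i)" using consistent[OF i j(1)] by simp
    next
      assume "snd (lit i)"
      then have "lit i = (fst (lit i), True)" by (simp add: prod_eq_iff)
      then show "\<exists>j < ?m. lit j = (fst (lit i), True)" using i by blast
    qed
    with False show ?thesis by (simp add: \<sigma>_def)
  qed
  have "satisfies \<sigma> (set cs)"
    unfolding satisfies_def
  proof
    fix c assume "c \<in> set cs"
    then obtain i where "i < ?m" "c = cs ! i" by (auto simp: in_set_conv_nth)
    then show "\<exists>(v, b) \<in> c. \<sigma> v = b"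
      using eq(2) true_lit by (intro bexI[of _ "lit i"]) (simp_all add: case_prod_unfold)
  qed
  moreover have "\<forall>i < n. \<sigma> i = X p q ! i" by (simp add: \<sigma>_def)
  ultimately show ?thesis using \<open>p < s\<close> \<open>q < s\<close> by blast
qed

text \<open>Complements of vertex covers are independent in the incompatibility graph.
  \<open>k \<le> N\<close> keeps the truncated subtraction exact.\<close>

lemma vertex_cover_iff_compatible_set:
  assumes h: "bij_betw h {..<N} VT" and "k \<le> N"
  shows "(\<exists>C. vertex_cover N (\<lambda>u v. \<not> compatible n cs X (h u) (h v)) C \<and> card C \<le> N - k) \<longleftrightarrow>
    (\<exists>J \<subseteq> VT. k \<le> card J \<and> compatible_set n cs X J)"
proof
  assume "\<exists>C. vertex_cover N (\<lambda>u v. \<not> compatible n cs X (h u) (h v)) C \<and> card C \<le> N - k"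
  then obtain C where C: "C \<subseteq> {..<N}" "card C \<le> N - k"
      "\<And>u v. u < v \<Longrightarrow> v < N \<Longrightarrow> u \<notin> C \<Longrightarrow> v \<notin> C \<Longrightarrow> compatible n cs X (h u) (h v)"
    unfolding vertex_cover_def by blast
  define J where "J = h ` ({..<N} - C)"
  have "inj_on h ({..<N} - C)" using h by (auto simp: bij_betw_def inj_on_def)
  then have "card J = card ({..<N} - C)" unfolding J_def by (rule card_image)
  also have "\<dots> = N - card C" using C(1) by (simp add: card_Diff_subset finite_subset)
  finally have "k \<le> card J" using C(2) \<open>k \<le> N\<close> by simp
  moreover have "J \<subseteq> VT" using h by (auto simp: J_def bij_betw_def)
  moreover have "compatible_set n cs X J"
    unfolding compatible_set_def
  proof (intro ballI impI)
    fix x y assume "x \<in> J" "y \<in> J" "x \<noteq> y"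
    then obtain u v where uv: "u < N" "v < N" "u \<notin> C" "v \<notin> C" "x = h u" "y = h v" "u \<noteq> v"
      by (auto simp: J_def)
    then show "compatible n cs X x y"
      using C(3)[of u v] C(3)[of v u] compatible_sym by (cases "u < v") auto
  qed
  ultimately show "\<exists>J \<subseteq> VT. k \<le> card J \<and> compatible_set n cs X J" by blast
next
  assume "\<exists>J \<subseteq> VT. k \<le> card J \<and> compatible_set n cs X J"
  then obtain J where J: "J \<subseteq> VT" "k \<le> card J" "compatible_set n cs X J" by blast
  define C where "C = {u. u < N \<and> h u \<notin> J}"
  have "{..<N} - C = {u. u < N \<and> h u \<in> J}" by (auto simp: C_def)
  moreover have "h ` {u. u < N \<and> h u \<in> J} = J"
  proof -
    have "h ` {u. u < N \<and> h u \<in> J} = h ` {..<N} \<inter> J" by blast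
    also have "\<dots> = J" using h J(1) unfolding bij_betw_def by blast
    finally show ?thesis .
  qed
  moreover have "inj_on h {u. u < N \<and> h u \<in> J}" using h by (auto simp: bij_betw_def inj_on_def)
  ultimately have "card ({..<N} - C) = card J" by (metis card_image)
  moreover have "C \<subseteq> {..<N}" by (auto simp: C_def)
  ultimately have "card C \<le> N - k"
    using J(2) card_Diff_subset[of C "{..<N}"] card_mono[of "{..<N}" C] finite_subset[of C "{..<N}"] by simp
  moreover have "vertex_cover N (\<lambda>u v. \<not> compatible n cs X (h u) (h v)) C"
    unfolding vertex_cover_def
  proof (intro conjI allI impI)
    fix u v assume uv: "u < v \<and> v < N \<and> \<not> compatible n cs X (h u) (h v)"
    then have "h u \<noteq> h v" using h by (auto simp: bij_betw_def inj_on_def)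
    then show "u \<in> C \<or> v \<in> C" using uv J(3) unfolding compatible_set_def C_def by auto
  qed fact
  ultimately show "\<exists>C. vertex_cover N (\<lambda>u v. \<not> compatible n cs X (h u) (h v)) C \<and> card C \<le> N - k"
    by blast
qed

section \<open>The packed instance as a template\<close>

lemma fill_const: "fill (map (\<lambda>b. (0, \<lambda>_. b)) w) \<rho> = w"
  by (simp add: fill_def comp_def)

lemma fill_self_delim:
  "fill (concat (map (\<lambda>t. [(0, \<lambda>_. True), t]) ts) @ [(0, \<lambda>_. False)]) \<rho> = self_delim (fill ts \<rho>)"
  by (simp add: fill_def self_delim_def map_concat comp_def case_prod_unfold)

lemma length_fill: "length (fill ts \<rho>) = length ts"
  by (simp add: fill_def)

text \<open>Budget and graph are the same for all relations, so their code consists of constants,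
  computed here from the empty relation. A terminal bit is one value of \<open>R \<rho>\<close>, and
  \<open>self_delim\<close> only interleaves it with constant markers.\<close>

lemma enc_template:
  fixes R :: "(nat \<Rightarrow> bool) \<Rightarrow> nat \<Rightarrow> nat \<Rightarrow> bool"
  assumes "0 < D" and loc: "\<And>u v. u < N \<Longrightarrow> v < N \<Longrightarrow> \<exists>d < D. \<exists>g. \<forall>\<rho>. R \<rho> u v = g (\<rho> d)"
  obtains ts where "\<forall>(d, g) \<in> set ts. d < D"
    "\<And>\<rho>. fill ts \<rho> = enc_sfvs (vc_instance N (R \<rho>) k)"
proof -
  let ?n = "N + N * N"
  define bit where "bit z \<rho> \<longleftrightarrow> z \<in> terminals (vc_instance N (R \<rho>) k)" for z \<rho>
  define good where "good z d g \<longleftrightarrow> d < D \<and> (\<forall>\<rho>. bit z \<rho> = g (\<rho> d))" for z d g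
  have "\<exists>d g. good z d g" for z
  proof (cases "\<exists>u v. z = pair_vertex N u v \<and> u < v \<and> v < N")
    case True
    then obtain u v where z: "z = pair_vertex N u v" "u < v" "v < N" by blast
    then have "u < N" by simp
    then obtain d g where "d < D" "\<forall>\<rho>. R \<rho> u v = g (\<rho> d)" using loc z(3) by blast
    moreover have "bit z \<rho> = R \<rho> u v" for \<rho>
      using z pair_vertex_inject[of v N] by (auto simp: bit_def vc_instance_def)
    ultimately have "good z d g" by (simp add: good_def)
    then show ?thesis by blast
  next
    case False
    then have "\<not> bit z \<rho>" for \<rho> by (auto simp: bit_def vc_instance_def)
    then have "good z 0 (\<lambda>_. False)" using \<open>0 < D\<close> by (simp add: good_def)
    then show ?thesis by blast
  qed
  then obtain d g where dg: "\<And>z. good z (d z) (g z)" by metis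
  define rest where "rest = concat (map (\<lambda>(u, v). self_delim (bin u) @ self_delim (bin v))
    (edge_list (vc_instance N (\<lambda>u v. False) k)))"
  define us :: template where "us = map (\<lambda>z. (d z, g z)) [0..<?n]"
  define us' :: template where
    "us' = concat (map (\<lambda>t. [(0, \<lambda>_. True), t]) us) @ [(0, \<lambda>_. False)]"
  define ts :: template where
    "ts = map (\<lambda>b. (0, \<lambda>_. b)) (self_delim (bin k)) @ us' @ map (\<lambda>b. (0, \<lambda>_. b)) rest"
  show thesis
  proof (rule that[of ts])
    show "\<forall>(d, g) \<in> set ts. d < D"
      using dg \<open>0 < D\<close> by (auto simp: ts_def us'_def us_def good_def)
    fix \<rho>
    have "fill us \<rho> = map (\<lambda>z. bit z \<rho>) [0..<?n]"
      using dg by (simp add: us_def fill_def good_def)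
    moreover have "edge_list (vc_instance N (R \<rho>) k) = edge_list (vc_instance N (\<lambda>u v. False) k)"
      by (simp add: edge_list_def vc_instance_def)
    ultimately show "fill ts \<rho> = enc_sfvs (vc_instance N (R \<rho>) k)"
      unfolding ts_def fill_append fill_const unfolding us'_def fill_self_delim
      by (simp add: enc_sfvs_def rest_def bit_def) (simp add: vc_instance_def)
  qed
qed

text \<open>Two vertices name at most one row, one column and one variable, hence consult at most
  one bit of one word. Where none is consulted, bit 0 is a dummy.\<close>

lemma compatible_local:
  assumes "0 < D"
    and idx: "\<And>p q i. p < s \<Longrightarrow> q < s \<Longrightarrow> i < n \<Longrightarrow> idx p q i < D"
    and X: "\<And>\<rho> p q i. p < s \<Longrightarrow> q < s \<Longrightarrow> i < n \<Longrightarrow> X \<rho> p q ! i = \<rho> (idx p q i)"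
    and vw: "v \<in> choice_vertices s m B" "w \<in> choice_vertices s m B"
  shows "\<exists>d < D. \<exists>g. \<forall>\<rho> :: nat \<Rightarrow> bool. (\<not> compatible n cs (X \<rho>) v w) = g (\<rho> d)"
proof -
  obtain a p i l a' p' i' l' where v: "v = (a, p, i, l)" and w: "w = (a', p', i', l')"
    by (cases v; cases w) blast
  have p: "p < s" "p' < s" using vw by (auto simp: v w choice_vertices_def)
  define P where "P = (if a then p' else p)"
  define Q where "Q = (if a then p else p')"
  have PQ: "P < s" "Q < s" using p by (auto simp: P_def Q_def)
  have XPQ: "(if a then X \<rho> p' p else X \<rho> p p') = X \<rho> P Q" for \<rho> by (simp add: P_def Q_def)
  show ?thesis
  proof (cases "fst l < n")
    case True
    show ?thesis
    proof (intro exI conjI allI)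
      show "idx P Q (fst l) < D" using idx PQ True by blast
      show "(\<not> compatible n cs (X \<rho>) v w) = (\<lambda>b. \<not> (if a = a' then p = p' \<and> i \<noteq> i'
          else l \<in> cs ! i \<and> l' \<in> cs ! i' \<and> (if i = i' then l = l' \<and> b = snd l
            else fst l = fst l' \<longrightarrow> snd l = snd l'))) (\<rho> (idx P Q (fst l)))" for \<rho>
        unfolding v w compatible.simps XPQ using True X[OF PQ True, of \<rho>] by simp
    qed
  next
    case False
    show ?thesis
    proof (intro exI conjI allI)
      show "0 < D" by fact
      show "(\<not> compatible n cs (X \<rho>) v w) = (\<lambda>b. \<not> (if a = a' then p = p' \<and> i \<noteq> i'
          else l \<in> cs ! i \<and> l' \<in> cs ! i' \<and> (if i = i' then l = l'
            else fst l = fst l' \<longrightarrow> snd l = snd l'))) (\<rho> 0)" for \<rho>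
        unfolding v w compatible.simps XPQ using False by simp
    qed
  qed
qed

text \<open>Summands for budget, terminal bits and edges, with numbers counted as if written in
  unary; only polynomiality matters.\<close>

definition enc_bound :: "nat \<Rightarrow> nat" where
  "enc_bound N = (2 * N + 1) + ((2 * (N + N * N) + 1) +
     (N + N * N) * (N + N * N) * (4 * (N + N * N) + 2))"

lemma enc_bound_mono: "N \<le> N' \<Longrightarrow> enc_bound N \<le> enc_bound N'"
  unfolding enc_bound_def by (intro add_mono mult_le_mono) auto

lemma length_concat_le:
  "(\<And>x. x \<in> set xs \<Longrightarrow> length (f x) \<le> c) \<Longrightarrow> length (concat (map f xs)) \<le> length xs * c"
  by (induction xs) (auto intro: add_mono)

lemma length_enc_le:
  assumes "k \<le> N"
  shows "length (enc_sfvs (vc_instance N R k)) \<le> enc_bound N"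
proof -
  let ?i = "vc_instance N R k" and ?n = "N + N * N"
  have nv: "num_vertices ?i = ?n" "budget ?i = k" by (simp_all add: vc_instance_def)
  have "length (edge_list ?i) \<le> ?n * ?n"
    unfolding edge_list_def nv by (rule order_trans[OF length_filter_le]) simp
  moreover have "length (concat (map (\<lambda>(u, v). self_delim (bin u) @ self_delim (bin v)) (edge_list ?i)))
      \<le> length (edge_list ?i) * (4 * ?n + 2)"
  proof (rule length_concat_le)
    fix e assume "e \<in> set (edge_list ?i)"
    moreover obtain u v where "e = (u, v)" by fastforce
    ultimately have e: "e = (u, v)" "u < ?n" "v < ?n" by (simp_all add: set_edge_list nv)
    show "length ((\<lambda>(u, v). self_delim (bin u) @ self_delim (bin v)) e) \<le> 4 * ?n + 2"
      using e(2,3) length_bin[of u] length_bin[of v] by (simp add: e(1) length_self_delim)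
  qed
  ultimately have "length (concat (map (\<lambda>(u, v). self_delim (bin u) @ self_delim (bin v)) (edge_list ?i)))
      \<le> ?n * ?n * (4 * ?n + 2)"
    using mult_le_mono1 order_trans by blast
  moreover have "length (self_delim (bin k)) \<le> 2 * N + 1"
    using length_bin[of k] assms by (simp add: length_self_delim)
  ultimately show ?thesis
    unfolding enc_sfvs_def enc_bound_def length_append nv
    by (intro add_mono) (simp_all add: length_self_delim)
qed

text \<open>\<open>Q\<close> is the polynomial overhead of the packing. With
  \<open>s = (b * Q ^ 2) ^ e\<close> and \<open>e \<ge> 1 / \<delta>\<close>, the saving
  \<open>s powr \<delta>\<close> is at least \<open>b * Q ^ 2\<close>, whereas the overhead
  \<open>(4 * Q) powr (2 - \<delta>)\<close> is at most \<open>16 * Q ^ 2\<close>; what is left is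
  the factor \<open>16 * C / b < 1\<close>.\<close>

lemma kernel_size_threshold:
  fixes h :: "nat \<Rightarrow> nat" and \<epsilon> :: real
  assumes "(\<lambda>k. real (h k)) \<in> O(\<lambda>k. real k powr (2 - \<epsilon>))" "\<epsilon> > 0"
  obtains b e :: nat where "b \<ge> 1"
    "\<And>Q k. Q \<ge> 1 \<Longrightarrow> (b * Q ^ 2) ^ e \<le> k \<Longrightarrow> k \<le> 4 * (b * Q ^ 2) ^ e * Q \<Longrightarrow>
       h k < (b * Q ^ 2) ^ e * (b * Q ^ 2) ^ e"
proof -
  obtain C where C: "C > 0" "eventually (\<lambda>k. norm (real (h k)) \<le> C * norm (real k powr (2 - \<epsilon>))) at_top"
    using landau_o.bigE[OF assms(1)] by blast
  then obtain k0 where k0: "\<And>k. k \<ge> k0 \<Longrightarrow> real (h k) \<le> C * real k powr (2 - \<epsilon>)"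
    unfolding eventually_at_top_linorder by auto
  \<comment> \<open>Capping at 1 keeps the exponent \<open>2 - \<delta>\<close> positive, so that
    the bound grows with \<open>k\<close> even if \<open>\<epsilon> > 2\<close>.\<close>
  define \<delta> where "\<delta> = min \<epsilon> 1"
  have \<delta>: "0 < \<delta>" "\<delta> \<le> 1" "\<delta> \<le> \<epsilon>" using assms(2) by (auto simp: \<delta>_def)
  \<comment> \<open>\<open>b\<close> exceeds \<open>16 * C\<close> to absorb the constants and is at
    least \<open>k0\<close>, so that \<open>s \<le> k\<close> puts \<open>k\<close> in the
    asymptotic range.\<close>
  define b where "b = nat \<lceil>16 * C\<rceil> + k0 + 1"
  define e where "e = nat \<lceil>1 / \<delta>\<rceil>"
  have b: "b \<ge> 1" "b \<ge> k0" "real b > 16 * C" unfolding b_def by linarith+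
  have e: "real e \<ge> 1 / \<delta>" unfolding e_def by linarith
  then have "real e > 0" using \<delta> by (smt (verit) divide_pos_pos)
  then have e1: "e \<ge> 1" by simp
  have "real e * \<delta> \<ge> 1" using e \<delta> by (simp add: field_simps)
  show thesis
  proof (rule that[OF b(1), where e = e])
    fix Q k :: nat
    assume Q: "Q \<ge> 1" and k: "(b * Q ^ 2) ^ e \<le> k" "k \<le> 4 * (b * Q ^ 2) ^ e * Q"
    define s where "s = (b * Q ^ 2) ^ e"
    have bQ: "b * Q ^ 2 \<ge> 1" using b(1) Q by simp
    have "b * Q ^ 2 \<le> s" unfolding s_def using bQ e1 by (simp add: self_le_power)
    moreover have "b \<le> b * Q ^ 2" using Q by simp
    ultimately have "b \<le> s" by linarith
    have s1: "real s \<ge> 1" using \<open>b \<le> s\<close> b(1) by simp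
    have "real s = real (b * Q ^ 2) powr real e"
      unfolding s_def of_nat_power using bQ by (intro powr_realpow[symmetric]) linarith
    then have "real s powr \<delta> = real (b * Q ^ 2) powr (real e * \<delta>)"
      by (simp only: powr_powr)
    also have "\<dots> \<ge> real (b * Q ^ 2) powr 1"
      by (rule powr_mono[OF \<open>real e * \<delta> \<ge> 1\<close>]) (metis bQ of_nat_1 of_nat_mono)
    finally have sd: "real s powr \<delta> \<ge> real b * real Q ^ 2" using bQ by simp
    have pos: "0 < real b * real Q ^ 2" "0 < real s powr \<delta>" using Q b(1) s1 by simp_all
    have "k0 \<le> k" "1 \<le> k" using k(1) \<open>b \<le> s\<close> b(1,2) unfolding s_def by linarith+
    have "real (h k) \<le> C * real k powr (2 - \<epsilon>)" by (rule k0[OF \<open>k0 \<le> k\<close>])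
    also have "\<dots> \<le> C * real k powr (2 - \<delta>)"
      using C(1) \<open>1 \<le> k\<close> \<delta> by (intro mult_left_mono powr_mono) auto
    also have "\<dots> \<le> C * (real (4 * Q) * real s) powr (2 - \<delta>)"
    proof -
      have "real k \<le> real (4 * s * Q)" using k(2) unfolding s_def of_nat_le_iff .
      then show ?thesis using C(1) \<delta> by (intro mult_left_mono powr_mono2) (auto simp: mult_ac)
    qed
    also have "\<dots> = C * (real (4 * Q) powr (2 - \<delta>) * real s powr (2 - \<delta>))"
      by (subst powr_mult) auto
    also have "\<dots> \<le> C * (real (4 * Q) powr 2 * real s powr (2 - \<delta>))"
      using C(1) \<delta> Q by (intro mult_left_mono mult_right_mono powr_mono) auto
    also have "\<dots> = C * (16 * real Q ^ 2) * (real s ^ 2 / real s powr \<delta>)"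
      using Q s1 by (simp add: powr_diff powr_numeral power_mult_distrib)
    also have "\<dots> \<le> C * (16 * real Q ^ 2) * (real s ^ 2 / (real b * real Q ^ 2))"
      using C(1) sd by (intro mult_left_mono divide_left_mono mult_pos_pos pos) auto
    also have "\<dots> = 16 * C / real b * real s ^ 2"
      using Q b(1) by (simp add: field_simps)
    also have "\<dots> < 1 * real s ^ 2"
      using s1 b(1,3) by (intro mult_strict_right_mono) (auto simp: field_simps)
    finally have "real (h k) < real (s * s)" by (simp add: power2_eq_square)
    then show "h k < (b * Q ^ 2) ^ e * (b * Q ^ 2) ^ e" unfolding s_def of_nat_less_iff .
  qed
qed

section \<open>Complementation\<close>

text \<open>The size of a union of \<open>Suc n * t\<close> formulas, one per kernel image and
  position in the tuple. Each is a tableau on the \<open>n\<close> bits of the word,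
  \<open>t\<close> blocks of \<open>n\<close> bits and one bit that makes index 0 available for
  constants.\<close>

definition complement_size :: "tm \<Rightarrow> nat poly \<Rightarrow> nat \<Rightarrow> nat \<Rightarrow> nat \<Rightarrow> nat" where
  "complement_size M p n B s = (let t = s * s;
     B' = tableau_size M (n + t * n + 1) (poly p (enc_bound (4 * s * (B * B)))) t
   in B' + Suc n * t * B' + Suc n * t + 1)"

lemma block_index_less: "p < s \<Longrightarrow> q < s \<Longrightarrow> p * s + q < s * (s :: nat)"
  using pair_vertex_less[of p s q] by (simp add: pair_vertex_def)

text \<open>Each \<open>y\<close> in \<open>Y\<close> is the image of a tuple of nonmembers. A tuple
  \<open>xs\<close> with the same image has the same kernel output, so its packed instance is
  negative too and it contains no member. Guessing the position \<open>b\<close> of \<open>x\<close>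
  as well makes membership of \<open>x\<close> in \<open>S (y, b)\<close> a single tableau.\<close>

lemma cnf_definable_complement:
  fixes K :: "sfvs_instance \<Rightarrow> sfvs_instance"
  assumes M: "wf_tm M"
    and run: "\<And>i. i \<in> sfvs_split_instances \<Longrightarrow>
      computes_within M (enc_sfvs i) (poly p (length (enc_sfvs i))) (enc_sfvs (K i))"
    and K: "\<And>i. i \<in> sfvs_split_instances \<Longrightarrow> K i \<in> sfvs_split_instances"
      "\<And>i. i \<in> sfvs_split_instances \<Longrightarrow>
        K i \<in> yes_instances subset_fvs_split \<longleftrightarrow> i \<in> yes_instances subset_fvs_split"
    and size: "\<And>i. i \<in> sfvs_split_instances \<Longrightarrow> length (enc_sfvs (K i)) \<le> h (budget i)"
    and A: "cnf_definable n B A"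
    and s: "1 \<le> s" "\<And>k. s \<le> k \<Longrightarrow> k \<le> 4 * s * (B * B) \<Longrightarrow> h k < s * s"
  shows "cnf_definable n (complement_size M p n B s) {x. length x = n \<and> x \<notin> A}"
proof -
  obtain cs where cs: "cs \<noteq> []" "length cs \<le> B" "\<forall>c \<in> set cs. fst ` c \<subseteq> {..<B}"
    and A_eq: "A = {x. length x = n \<and> (\<exists>\<sigma>. (\<forall>i < n. \<sigma> i = x ! i) \<and> satisfies \<sigma> (set cs))}"
    using A unfolding cnf_definable_def by (elim conjE exE)
  define m where "m = length cs"
  define t where "t = s * s"
  define N where "N = 4 * s * m * B"
  define k where "k = N - 2 * m"
  have m: "1 \<le> m" "m \<le> B" using cs(1,2) by (auto simp: m_def Suc_le_eq)
  have "1 \<le> B" using m by linarith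
  have "t > 0" using s(1) by (simp add: t_def)
  \<comment> \<open>\<open>N = 4 * z\<close> with \<open>m\<close> and \<open>s\<close> at most
    \<open>z\<close>, hence \<open>k \<ge> 2 * z \<ge> s\<close>: the budget is in the range where
    \<open>h\<close> is known to be small.\<close>
  define z where "z = m * B * s"
  have "m * (1 * 1) \<le> m * (B * s)" "1 * 1 * s \<le> m * B * s"
    using m \<open>1 \<le> B\<close> s(1) by (intro mult_le_mono; simp)+
  then have "m \<le> z" "s \<le> z" by (simp_all only: z_def mult.assoc mult_1 mult_1_right)
  moreover have "N = 4 * z" by (simp add: N_def z_def mult_ac)
  ultimately have kN: "2 * m \<le> N" "k \<le> N" "s \<le> k" by (simp_all add: k_def)
  have "N \<le> 4 * s * (B * B)"
    unfolding N_def mult.assoc using m(2) by (intro mult_le_mono) auto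
  have "h k < t"
    unfolding t_def using s(2)[of k] kN \<open>N \<le> 4 * s * (B * B)\<close> by linarith
  obtain v where v: "bij_betw v {..<N} (choice_vertices s m B)"
    using ex_bij_betw_nat_finite[OF finite_choice_vertices, of s m B] card_choice_vertices[of s m B]
    unfolding N_def atLeast0LessThan by auto
  define X :: "bool list list \<Rightarrow> nat \<Rightarrow> nat \<Rightarrow> bool list" where "X xs a b = xs ! (a * s + b)" for xs a b
  define G where "G xs = vc_instance N (\<lambda>u w. \<not> compatible n cs (X xs) (v u) (v w)) k" for xs
  define F where "F xs = enc_sfvs (K (G xs))" for xs
  define U where "U = {x :: bool list. length x = n}"
  have G_inst: "G xs \<in> sfvs_split_instances" for xs
    unfolding G_def by (rule vc_instance_split)
  have G_yes: "G xs \<in> yes_instances subset_fvs_split \<longleftrightarrow> (\<exists>b < t. xs ! b \<in> A)"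
    if xs: "xs \<in> tuples U t" for xs
  proof -
    have "G xs \<in> yes_instances subset_fvs_split \<longleftrightarrow>
        (\<exists>J \<subseteq> choice_vertices s m B. 2 * m \<le> card J \<and> compatible_set n cs (X xs) J)"
      unfolding G_def vc_instance_yes_iff k_def by (rule vertex_cover_iff_compatible_set[OF v kN(1)])
    also have "\<dots> \<longleftrightarrow> (\<exists>a < s. \<exists>b < s. \<exists>\<sigma>. (\<forall>i < n. \<sigma> i = X xs a b ! i) \<and> satisfies \<sigma> (set cs))"
    proof
      assume "\<exists>J \<subseteq> choice_vertices s m B. 2 * m \<le> card J \<and> compatible_set n cs (X xs) J"
      then show "\<exists>a < s. \<exists>b < s. \<exists>\<sigma>. (\<forall>i < n. \<sigma> i = X xs a b ! i) \<and> satisfies \<sigma> (set cs)"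
        unfolding m_def by (elim exE conjE) (rule compatible_set_imp_satisfiable[OF _ _ _ cs(1)])
    next
      assume "\<exists>a < s. \<exists>b < s. \<exists>\<sigma>. (\<forall>i < n. \<sigma> i = X xs a b ! i) \<and> satisfies \<sigma> (set cs)"
      then obtain a b \<sigma> where "a < s" "b < s" "\<forall>i < n. \<sigma> i = X xs a b ! i" "satisfies \<sigma> (set cs)"
        by (elim exE conjE)
      from satisfiable_imp_compatible_set[where X = "X xs", OF cs(3) this]
      show "\<exists>J \<subseteq> choice_vertices s m B. 2 * m \<le> card J \<and> compatible_set n cs (X xs) J"
        unfolding m_def by (elim exE conjE) (intro exI conjI, assumption, simp, assumption)
    qed
    also have "\<dots> \<longleftrightarrow> (\<exists>a < s. \<exists>b < s. X xs a b \<in> A)"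
    proof -
      have "length (X xs a b) = n" if "a < s" "b < s" for a b
      proof -
        have "X xs a b \<in> set xs"
          unfolding X_def using xs block_index_less[OF that] by (intro nth_mem) (simp add: tuples_def t_def)
        with xs show ?thesis by (auto simp: tuples_def U_def)
      qed
      then show ?thesis
        unfolding A_eq mem_Collect_eq by (intro iff_exI conj_cong refl) simp
    qed
    also have "\<dots> \<longleftrightarrow> (\<exists>b < t. xs ! b \<in> A)"
    proof
      assume "\<exists>a < s. \<exists>b < s. X xs a b \<in> A"
      then show "\<exists>b < t. xs ! b \<in> A" unfolding X_def t_def using block_index_less by blast
    next
      assume "\<exists>b < t. xs ! b \<in> A"
      then obtain b where b: "b < s * s" "xs ! b \<in> A" unfolding t_def by blast
      have "b div s < s" "b mod s < s" "X xs (b div s) (b mod s) = xs ! b"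
        using b(1) s(1) by (simp_all add: less_mult_imp_div_less X_def)
      with b(2) show "\<exists>a < s. \<exists>b < s. X xs a b \<in> A" by metis
    qed
    finally show ?thesis .
  qed
  have F_len: "length (F xs) < t" for xs
    using size[OF G_inst, of xs] \<open>h k < t\<close> unfolding F_def by (simp add: G_def vc_instance_def)
  define A' where "A' = {x \<in> U. x \<notin> A}"
  have U_eq: "U = {x. set x \<subseteq> UNIV \<and> length x = n}" by (simp add: U_def)
  have "finite U" unfolding U_eq by (rule finite_lists_length_eq) simp
  have "card U = 2 ^ n" unfolding U_eq by (subst card_lists_length_eq) auto
  then have "card A' \<le> 2 ^ n"
    using card_mono[OF \<open>finite U\<close>, of A'] by (auto simp: A'_def)
  \<comment> \<open>The covering argument wants a strict bound, hence \<open>Suc n\<close>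
    images.\<close>
  also have "(2 :: nat) ^ n < 2 ^ Suc n" by simp
  finally have "card A' < 2 ^ Suc n" .
  have "finite A'" using \<open>finite U\<close> by (simp add: A'_def)
  have "card (F ` tuples A' t) \<le> card {y :: bool list. length y < t}"
    by (rule card_mono[OF card_short_words(2)]) (use F_len in auto)
  then have "card (F ` tuples A' t) \<le> 2 ^ t" using card_short_words(1)[of t] by linarith
  from tuple_covering[OF \<open>finite A'\<close> \<open>t > 0\<close> this order_refl \<open>card A' < 2 ^ Suc n\<close>]
  obtain Y where Y: "finite Y" "card Y \<le> Suc n" "Y \<subseteq> F ` tuples A' t"
      "\<forall>x \<in> A'. \<exists>y \<in> Y. \<exists>xs \<in> tuples A' t. F xs = y \<and> x \<in> set xs"
    by (elim exE conjE)
  have A'_U: "tuples A' t \<subseteq> tuples U t" by (rule tuples_mono) (simp add: A'_def)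
  have sound: "xs ! b \<notin> A" if H: "xs \<in> tuples U t" "F xs \<in> Y" "b < t" for xs b
  proof -
    obtain zs where zs: "zs \<in> tuples A' t" "F xs = F zs" using Y(3) H(2) by blast
    have "\<forall>b < t. zs ! b \<notin> A"
      using zs(1) nth_mem by (fastforce simp: tuples_def A'_def)
    then have "G zs \<notin> yes_instances subset_fvs_split" using G_yes zs(1) A'_U by blast
    moreover have "K (G xs) = K (G zs)"
      using zs(2) unfolding F_def by (intro enc_sfvs_inject K(1) G_inst)
    ultimately have "G xs \<notin> yes_instances subset_fvs_split"
      using K(2)[OF G_inst, of xs] K(2)[OF G_inst, of zs] by simp
    then show ?thesis using G_yes[OF H(1)] H(3) by blast
  qed
  define S where "S r = {x. length x = n \<and> (\<exists>xs \<in> tuples U t. xs ! snd r = x \<and> F xs = fst r)}"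
    for r :: "bool list \<times> nat"
  have A'_eq: "A' = (\<Union>r \<in> Y \<times> {..<t}. S r)"
  proof (intro equalityI subsetI)
    fix x assume x: "x \<in> A'"
    then obtain xs where xs: "xs \<in> tuples A' t" "F xs \<in> Y" "x \<in> set xs" using Y(4) by blast
    then obtain b where "b < t" "x = xs ! b" unfolding tuples_def in_set_conv_nth by blast
    moreover have "length x = n" using x by (simp add: A'_def U_def)
    ultimately have "x \<in> S (F xs, b)" using xs(1) A'_U unfolding S_def by auto
    with xs(2) \<open>b < t\<close> show "x \<in> (\<Union>r \<in> Y \<times> {..<t}. S r)" by blast
  next
    fix x assume "x \<in> (\<Union>r \<in> Y \<times> {..<t}. S r)"
    then obtain y b xs where "y \<in> Y" "b < t" "length x = n" "xs \<in> tuples U t" "xs ! b = x" "F xs = y"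
      unfolding S_def by auto
    then show "x \<in> A'" using sound[of xs b] by (auto simp: A'_def U_def)
  qed
  define B' where "B' = tableau_size M (n + t * n + 1) (poly p (enc_bound (4 * s * (B * B)))) t"
  have S_def_cnf: "cnf_definable n B' (S r)" if r: "r \<in> Y \<times> {..<t}" for r
  proof -
    obtain y b where yb: "r = (y, b)" "y \<in> Y" "b < t" using r by blast
    define D where "D = n + t * n + 1"
    \<comment> \<open>Position \<open>b\<close> reads the word itself from the first
      \<open>n\<close> bits; any other position \<open>b'\<close> is guessed in a block of its own,
      which starts at \<open>n + b' * n\<close>.\<close>
    define idx where "idx b' i = (if b' = b then i else n + (b' * n + i))" for b' i
    define xs_of where "xs_of \<rho> = map (\<lambda>b'. map (\<lambda>i. \<rho> (idx b' i)) [0..<n]) [0..<t]" for \<rho> :: "nat \<Rightarrow> bool"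
    have idx_less: "idx b' i < D" if "b' < t" "i < n" for b' i
    proof -
      have "b' * n + i < Suc b' * n" using that(2) by simp
      also have "\<dots> \<le> t * n" using that(1) by (intro mult_le_mono1) simp
      finally show ?thesis using that(2) by (simp add: idx_def D_def)
    qed
    have loc: "\<exists>d < D. \<exists>g. \<forall>\<rho>. (\<not> compatible n cs (X (xs_of \<rho>)) (v u) (v w)) = g (\<rho> d)"
      if "u < N" "w < N" for u w
    proof (rule compatible_local[where idx = "\<lambda>p q i. idx (p * s + q) i"])
      show "0 < D" by (simp add: D_def)
      show "v u \<in> choice_vertices s m B" "v w \<in> choice_vertices s m B"
        using v that by (auto simp: bij_betw_def)
      fix p q i assume pqi: "p < s" "q < s" "i < n"
      then have "p * s + q < t" using block_index_less by (simp add: t_def)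
      with pqi show "idx (p * s + q) i < D" "X (xs_of \<rho>) p q ! i = \<rho> (idx (p * s + q) i)" for \<rho>
        using idx_less by (auto simp: X_def xs_of_def)
    qed
    obtain ts where ts: "\<forall>(d, g) \<in> set ts. d < D" "\<And>\<rho>. fill ts \<rho> = enc_sfvs (G (xs_of \<rho>))"
      unfolding G_def by (rule enc_template[of D N "\<lambda>\<rho> u w. \<not> compatible n cs (X (xs_of \<rho>)) (v u) (v w)" k])
        (use loc in \<open>auto simp: D_def\<close>)
    define T where "T = poly p (length ts)"
    have reads: "tape_reads (hd (snd ((tm_step M ^^ T) (init_config M (fill ts \<rho>))))) y \<longleftrightarrow>
        F (xs_of \<rho>) = y" for \<rho>
    proof -
      have "computes_within M (fill ts \<rho>) T (F (xs_of \<rho>))"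
        using run[OF G_inst, of "xs_of \<rho>"] length_fill[of ts \<rho>] unfolding F_def T_def by (simp add: ts(2))
      then show ?thesis
        unfolding computes_within_def Let_def using tape_reads_unique by blast
    qed
    have "cnf_definable n (tableau_size M D T (length y)) {x. length x = n \<and>
        (\<exists>\<rho>. (\<forall>i < n. \<rho> i = x ! i) \<and> tape_reads (hd (snd ((tm_step M ^^ T) (init_config M (fill ts \<rho>))))) y)}"
      by (rule cook_levin[OF M ts(1)]) (simp add: D_def)
    also have "{x. length x = n \<and>
        (\<exists>\<rho>. (\<forall>i < n. \<rho> i = x ! i) \<and> tape_reads (hd (snd ((tm_step M ^^ T) (init_config M (fill ts \<rho>))))) y)} = S r"
      unfolding reads
    proof (intro equalityI subsetI)
      fix x assume "x \<in> {x. length x = n \<and> (\<exists>\<rho>. (\<forall>i < n. \<rho> i = x ! i) \<and> F (xs_of \<rho>) = y)}"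
      then obtain \<rho> where \<rho>: "length x = n" "\<forall>i < n. \<rho> i = x ! i" "F (xs_of \<rho>) = y" by blast
      have "xs_of \<rho> \<in> tuples U t" by (auto simp: xs_of_def tuples_def U_def)
      moreover have "xs_of \<rho> ! b = x"
        using yb(3) \<rho>(1,2) by (intro nth_equalityI) (auto simp: xs_of_def idx_def)
      ultimately show "x \<in> S r" using \<rho>(1,3) unfolding S_def yb(1) by auto
    next
      fix x assume "x \<in> S r"
      then obtain xs where xs: "length x = n" "xs \<in> tuples U t" "xs ! b = x" "F xs = y"
        unfolding S_def yb(1) by auto
      define \<rho> where "\<rho> j = (if j < n then x ! j else xs ! ((j - n) div n) ! ((j - n) mod n))" for j
      have len: "length xs = t" "\<And>b'. b' < t \<Longrightarrow> length (xs ! b') = n"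
        using xs(2) nth_mem unfolding tuples_def U_def by blast+
      have "xs_of \<rho> = xs"
      proof (rule nth_equalityI)
        show "length (xs_of \<rho>) = length xs" by (simp add: xs_of_def len)
        fix b' assume "b' < length (xs_of \<rho>)"
        then have b': "b' < t" by (simp add: xs_of_def)
        show "xs_of \<rho> ! b' = xs ! b'"
        proof (rule nth_equalityI)
          show "length (xs_of \<rho> ! b') = length (xs ! b')" using b' len(2) by (simp add: xs_of_def)
          fix i assume "i < length (xs_of \<rho> ! b')"
          then have "i < n" using b' by (simp add: xs_of_def)
          then show "xs_of \<rho> ! b' ! i = xs ! b' ! i"
            using b' xs(3) by (auto simp: xs_of_def idx_def \<rho>_def)
        qed
      qed
      moreover have "\<forall>i < n. \<rho> i = x ! i" by (simp add: \<rho>_def)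
      ultimately show "x \<in> {x. length x = n \<and> (\<exists>\<rho>. (\<forall>i < n. \<rho> i = x ! i) \<and> F (xs_of \<rho>) = y)}"
        using xs(1,4) by blast
    qed
    finally have "cnf_definable n (tableau_size M D T (length y)) (S r)" .
    moreover have "tableau_size M D T (length y) \<le> B'"
      unfolding B'_def
    proof (rule tableau_size_mono)
      show "D \<le> n + t * n + 1" by (simp add: D_def)
      show "length y \<le> t" using yb(2) Y(3) F_len by (force intro: less_imp_le)
      have "length ts = length (enc_sfvs (G (xs_of (\<lambda>_. False))))"
        using ts(2)[of "\<lambda>_. False"] length_fill by metis
      also have "\<dots> \<le> enc_bound N" unfolding G_def using kN(2) by (rule length_enc_le)
      also have "\<dots> \<le> enc_bound (4 * s * (B * B))" by (rule enc_bound_mono) fact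
      finally show "T \<le> poly p (enc_bound (4 * s * (B * B)))" unfolding T_def by (rule poly_nat_mono)
    qed
    ultimately show ?thesis by (rule cnf_definable_mono)
  qed
  have cardR: "card (Y \<times> {..<t}) \<le> Suc n * t"
    unfolding card_cartesian_product card_lessThan using Y(2) by (rule mult_le_mono1)
  have "n \<le> B'" unfolding B'_def tableau_size_def Let_def by simp
  have "cnf_definable n (B' + card (Y \<times> {..<t}) * B' + card (Y \<times> {..<t}) + 1) (\<Union>r \<in> Y \<times> {..<t}. S r)"
    by (rule cnf_definable_Union[OF S_def_cnf]) (use Y(1) \<open>n \<le> B'\<close> in auto)
  moreover have "B' + card (Y \<times> {..<t}) * B' + card (Y \<times> {..<t}) + 1 \<le> complement_size M p n B s"
    unfolding complement_size_def Let_def t_def[symmetric] B'_def[symmetric]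
    using cardR by (intro add_mono mult_le_mono) auto
  moreover have "{x. length x = n \<and> x \<notin> A} = A'" by (simp add: A'_def U_def)
  ultimately show ?thesis by (simp only: A'_eq cnf_definable_mono)
qed

lemma small_cnfs_Compl:
  assumes kernel: "admits_kernel_of_size subset_fvs_split h"
    and h: "(\<lambda>k. real (h k)) \<in> O(\<lambda>k. real k powr (2 - \<epsilon>))" "\<epsilon> > 0"
    and L: "small_cnfs L"
  shows "small_cnfs (- L)"
proof -
  obtain K where ker: "is_kernel subset_fvs_split K"
    and size: "\<forall>i \<in> instances subset_fvs_split. length (enc subset_fvs_split (K i)) \<le> h (param subset_fvs_split i)"
    using kernel unfolding admits_kernel_of_size_def by blast
  obtain M p where M: "wf_tm M" and run: "\<forall>i \<in> instances subset_fvs_split.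
      computes_within M (enc subset_fvs_split i) (poly p (length (enc subset_fvs_split i))) (enc subset_fvs_split (K i))"
    using ker unfolding is_kernel_def poly_time_map_def by blast
  have K: "\<forall>i \<in> instances subset_fvs_split. K i \<in> instances subset_fvs_split \<and>
      (K i \<in> yes_instances subset_fvs_split \<longleftrightarrow> i \<in> yes_instances subset_fvs_split)"
    using ker unfolding is_kernel_def by blast
  have sel: "instances subset_fvs_split = sfvs_split_instances" "enc subset_fvs_split = enc_sfvs"
      "param subset_fvs_split = budget"
    by (simp_all add: subset_fvs_split_def)
  obtain b e :: nat where b: "b \<ge> 1"
    and be: "\<And>Q k. Q \<ge> 1 \<Longrightarrow> (b * Q ^ 2) ^ e \<le> k \<Longrightarrow> k \<le> 4 * (b * Q ^ 2) ^ e * Q \<Longrightarrow>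
       h k < (b * Q ^ 2) ^ e * (b * Q ^ 2) ^ e"
    using kernel_size_threshold[OF h] by blast
  obtain f where f: "poly_bounded f" "\<And>n. cnf_definable n (f n) {x \<in> L. length x = n}"
    using L unfolding small_cnfs_def by blast
  have f1: "f n \<ge> 1" for n
    using f(2)[of n] unfolding cnf_definable_def by (metis length_greater_0_conv less_one linorder_not_less order_trans nat_less_le)
  \<comment> \<open>This is the threshold for \<open>Q = f n * f n\<close>, since the packed graph
    has at most \<open>4 * s n * (f n * f n)\<close> clique vertices.\<close>
  define s where "s n = (b * (f n * f n) ^ 2) ^ e" for n
  define g where "g n = complement_size M p n (f n) (s n)" for n
  have "poly_bounded s"
    unfolding s_def by (intro poly_bounded_power poly_bounded_mult poly_bounded_const f(1))
  then have "poly_bounded g"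
    unfolding g_def complement_size_def Let_def enc_bound_def
    by (intro poly_bounded_add poly_bounded_mult poly_bounded_Suc poly_bounded_const
        poly_bounded_tableau_size poly_bounded_poly poly_bounded_id f(1))
  moreover have "cnf_definable n (g n) {x \<in> - L. length x = n}" for n
  proof -
    have "cnf_definable n (g n) {x. length x = n \<and> x \<notin> {x \<in> L. length x = n}}"
      unfolding g_def
    proof (rule cnf_definable_complement[OF M, where K = K and h = h])
      show "1 \<le> s n" unfolding s_def using b f1[of n] by simp
      show "h k < s n * s n" if "s n \<le> k" "k \<le> 4 * s n * (f n * f n)" for k
        unfolding s_def using that f1[of n] unfolding s_def by (intro be) auto
    qed (use run K size f(2) in \<open>auto simp: sel\<close>)
    also have "{x. length x = n \<and> x \<notin> {x \<in> L. length x = n}} = {x \<in> - L. length x = n}" by auto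
    finally show ?thesis .
  qed
  ultimately show ?thesis unfolding small_cnfs_def by blast
qed

theorem theorem2:
  fixes \<epsilon> :: real
  assumes "\<epsilon> > 0"
    and "\<not> class_NP \<subseteq> class_coNP_poly"
  shows "\<not> (\<exists>h :: nat \<Rightarrow> nat.
           (\<lambda>k. real (h k)) \<in> O(\<lambda>k. real k powr (2 - \<epsilon>)) \<and>
           admits_kernel_of_size subset_fvs_split h)"
proof
  assume "\<exists>h :: nat \<Rightarrow> nat. (\<lambda>k. real (h k)) \<in> O(\<lambda>k. real k powr (2 - \<epsilon>)) \<and>
           admits_kernel_of_size subset_fvs_split h"
  then obtain h :: "nat \<Rightarrow> nat" where h: "(\<lambda>k. real (h k)) \<in> O(\<lambda>k. real k powr (2 - \<epsilon>))"
    "admits_kernel_of_size subset_fvs_split h" by blast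
  have "class_NP \<subseteq> class_coNP_poly"
  proof
    fix L assume "L \<in> class_NP"
    then have "small_cnfs (- L)"
      by (intro small_cnfs_Compl[OF h(2,1) assms(1)] small_cnfs_NP)
    then show "L \<in> class_coNP_poly" by (rule coNP_poly_if_small_cnfs)
  qed
  with assms(2) show False by contradiction
qed

end
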